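(* Let $X$ be a Banach space and consider the initial value problem $u'(t)=F(u(t))=Au(t)+g(u(t))$, $u(t_0)=u_0$. Assume that: (i) the linear operator $A$ is the generator of a strongly continuous semigroup $e^{tA}$ in $X$; (ii) the problem possesses a sufficiently smooth solution $u:[0,T]\to X$ with derivatives in $X$, the nonlinearity $g:X\to X$ is sufficiently often Fréchet differentiable in a strip along the exact solution, and all occurring derivatives are uniformly bounded; (iii) $A$ and $g$ are such that, with $\tilde u_n=u(t_n)$, $\tilde u_n'=u'(t_n)$, $\tilde u_n''=u''(t_n)$, the expression $$A\big(g^{(3)}(\tilde u_n)(\tilde u_n',\tilde u_n',\tilde u_n')+3g''(\tilde u_n)(\tilde u_n',\tilde u_n'')\big)$$ is uniformly bounded on $X$. Then the numerical solution $u_n$ of the 2-stage explicit exponential Rosenbrock method $$U_{n2}=u_n+\tfrac34h\varphi_1(\tfrac34hJ_n)F(u_n),\qquad u_{n+1}=u_n+h\varphi_1(hJ_n)F(u_n)+h\,\tfrac{32}{9}\varphi_3(hJ_n)\big(g_n(U_{n2})-g_n(u_n)\big)$$ satisfies the error bound $$\|u_n-u(t_n)\|\le Ch^4$$ uniformly on $t_0\le t_n=t_0+nh\le T$, with a constant $C$ that depends on $T-t_0$, but is independent of $n$ and $h$.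
   Context: The method is called exprb42. Here $h>0$ is a constant step size, $t_n=t_0+nh$, the method starts from the initial value $u_0$, $u_n\approx u(t_n)$, $J_n=\frac{\partial F}{\partial u}(u_n)=A+g'(u_n)$ and $g_n(u)=F(u)-J_nu=g(u)-g'(u_n)u$. Functions $\varphi_k$: $\varphi_0(z)=e^z$ and $\varphi_k(z)=\int_0^1 e^{(1-\theta)z}\frac{\theta^{k-1}}{(k-1)!}\,d\theta$ for $k\ge1$. For the generator $J$ of a strongly continuous semigroup, $\varphi_k(hJ)$ is the bounded operator obtained by replacing $e^{(1-\theta)z}$ by the semigroup $e^{(1-\theta)hJ}$. Under (i) and (ii) the Jacobian $J(u)=A+g'(u)$ also generates a strongly continuous semigroup.
   Formalization: The error bound is stated for those step sizes h for which the steps evaluate g and g' only inside the strip along the exact solution; this is proved to hold for all sufficiently small h, since for arbitrary h>0 the bound can fail. *)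

theory Defs
  imports "HOL-Analysis.Analysis"
begin

text \<open>
  An unbounded operator is a pair of a domain \<open>D\<close> and a function \<open>A\<close> of which only the values
  on \<open>D\<close> matter. Only the values \<open>S t\<close> with \<open>t \<ge> 0\<close> of a semigroup matter.
\<close>

definition C0_semigroup :: "(real \<Rightarrow> 'a::real_normed_vector \<Rightarrow>\<^sub>L 'a) \<Rightarrow> bool" where
  "C0_semigroup S \<longleftrightarrow>
     S 0 = id_blinfun \<and>
     (\<forall>s\<ge>0. \<forall>t\<ge>0. S (s + t) = S s o\<^sub>L S t) \<and>
     (\<forall>x. ((\<lambda>t. blinfun_apply (S t) x) \<longlongrightarrow> x) (at_right 0))"

definition semigroup_generator ::
    "(real \<Rightarrow> 'a::real_normed_vector \<Rightarrow>\<^sub>L 'a) \<Rightarrow> 'a set \<Rightarrow> ('a \<Rightarrow> 'a) \<Rightarrow> bool" where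
  "semigroup_generator S D A \<longleftrightarrow>
     C0_semigroup S \<and>
     D = {x. \<exists>y. ((\<lambda>t. (1 / t) *\<^sub>R (blinfun_apply (S t) x - x)) \<longlongrightarrow> y) (at_right 0)} \<and>
     (\<forall>x\<in>D. ((\<lambda>t. (1 / t) *\<^sub>R (blinfun_apply (S t) x - x)) \<longlongrightarrow> A x) (at_right 0))"

text \<open>
  \<open>exp_op D A t\<close> is the operator $e^{tA}$. A generator determines its semigroup at all
  \<open>t \<ge> 0\<close>, so the choice made here is irrelevant for such \<open>t\<close>.
\<close>

definition exp_op ::
    "'a::real_normed_vector set \<Rightarrow> ('a \<Rightarrow> 'a) \<Rightarrow> real \<Rightarrow> 'a \<Rightarrow>\<^sub>L 'a" where
  "exp_op D A = (SOME S. semigroup_generator S D A)"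

text \<open>\<open>phi_op k h D J\<close> is $\varphi_k(hJ)$; $e^{(1-\theta)hJ}$ is the semigroup of \<open>J\<close> at time
  \<open>(1 - \<theta>) * h\<close>.\<close>

definition phi_op ::
    "nat \<Rightarrow> real \<Rightarrow> 'a::real_normed_vector set \<Rightarrow> ('a \<Rightarrow> 'a) \<Rightarrow> 'a \<Rightarrow> 'a" where
  "phi_op k h D J x =
     (if k = 0 then blinfun_apply (exp_op D J h) x
      else integral {0..1} (\<lambda>\<theta>. (\<theta> ^ (k - 1) / fact (k - 1)) *\<^sub>R
                                blinfun_apply (exp_op D J ((1 - \<theta>) * h)) x))"

text \<open>
  In the following, \<open>g1\<close> is the derivative of \<open>g\<close>. The Jacobian at \<open>v\<close> has the same domain
  as \<open>A\<close>.
\<close>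

definition rhs :: "('a::real_normed_vector \<Rightarrow> 'a) \<Rightarrow> ('a \<Rightarrow> 'a) \<Rightarrow> 'a \<Rightarrow> 'a" where
  "rhs A g v = A v + g v"

definition jacobian ::
    "('a::real_normed_vector \<Rightarrow> 'a) \<Rightarrow> ('a \<Rightarrow> 'a \<Rightarrow>\<^sub>L 'a) \<Rightarrow> 'a \<Rightarrow> 'a \<Rightarrow> 'a" where
  "jacobian A g1 v x = A x + blinfun_apply (g1 v) x"

definition nonlin_rem ::
    "('a::real_normed_vector \<Rightarrow> 'a) \<Rightarrow> ('a \<Rightarrow> 'a \<Rightarrow>\<^sub>L 'a) \<Rightarrow> 'a \<Rightarrow> 'a \<Rightarrow> 'a" where
  "nonlin_rem g g1 v w = g w - blinfun_apply (g1 v) w"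

definition exprb42_stage ::
    "'a::real_normed_vector set \<Rightarrow> ('a \<Rightarrow> 'a) \<Rightarrow> ('a \<Rightarrow> 'a) \<Rightarrow> ('a \<Rightarrow> 'a \<Rightarrow>\<^sub>L 'a) \<Rightarrow>
     real \<Rightarrow> 'a \<Rightarrow> 'a" where
  "exprb42_stage D A g g1 h v =
     v + (3/4 * h) *\<^sub>R phi_op 1 (3/4 * h) D (jacobian A g1 v) (rhs A g v)"

definition exprb42_step ::
    "'a::real_normed_vector set \<Rightarrow> ('a \<Rightarrow> 'a) \<Rightarrow> ('a \<Rightarrow> 'a) \<Rightarrow> ('a \<Rightarrow> 'a \<Rightarrow>\<^sub>L 'a) \<Rightarrow>
     real \<Rightarrow> 'a \<Rightarrow> 'a" where
  "exprb42_step D A g g1 h v =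
     v + h *\<^sub>R phi_op 1 h D (jacobian A g1 v) (rhs A g v)
       + (h * (32/9)) *\<^sub>R phi_op 3 h D (jacobian A g1 v)
           (nonlin_rem g g1 v (exprb42_stage D A g g1 h v) - nonlin_rem g g1 v v)"

primrec exprb42 ::
    "'a::real_normed_vector set \<Rightarrow> ('a \<Rightarrow> 'a) \<Rightarrow> ('a \<Rightarrow> 'a) \<Rightarrow> ('a \<Rightarrow> 'a \<Rightarrow>\<^sub>L 'a) \<Rightarrow>
     real \<Rightarrow> 'a \<Rightarrow> nat \<Rightarrow> 'a" where
  "exprb42 D A g g1 h u0 0 = u0"
| "exprb42 D A g g1 h u0 (Suc n) = exprb42_step D A g g1 h (exprb42 D A g g1 h u0 n)"

definition strip :: "(real \<Rightarrow> 'a::metric_space) \<Rightarrow> real set \<Rightarrow> real \<Rightarrow> 'a set" where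
  "strip u I r = (\<Union>t\<in>I. ball (u t) r)"

text \<open>
  The derivative of \<open>g\<close> is only assumed to exist in a strip along the exact solution. The
  following says that the first \<open>n\<close> steps evaluate \<open>g\<close> and \<open>g1\<close> only at points of a set \<open>V\<close>.
\<close>

definition exprb42_within ::
    "'a::real_normed_vector set \<Rightarrow> 'a set \<Rightarrow> ('a \<Rightarrow> 'a) \<Rightarrow> ('a \<Rightarrow> 'a) \<Rightarrow>
     ('a \<Rightarrow> 'a \<Rightarrow>\<^sub>L 'a) \<Rightarrow> real \<Rightarrow> 'a \<Rightarrow> nat \<Rightarrow> bool" where
  "exprb42_within V D A g g1 h u0 n \<longleftrightarrow>
     (\<forall>m<n. exprb42 D A g g1 h u0 m \<in> V \<and>
            exprb42_stage D A g g1 h (exprb42 D A g g1 h u0 m) \<in> V)"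

end

theory Submission
  imports Defs
begin

text \<open>
  The error \<open>e\<^sub>n = u\<^sub>n - u(t\<^sub>n)\<close> obeys a recursion
  \<open>e\<^sub>n\<^sub>+\<^sub>1 = exp(h J\<^sub>n) e\<^sub>n + O(h \<parallel>e\<^sub>n\<parallel>) + O(h\<^sup>5)\<close>. Order four follows by adding up the local
  errors \<open>O(h\<^sup>5)\<close> over the \<open>O(1/h)\<close> steps, provided that products of the operators
  \<open>exp(h J\<^sub>n)\<close> stay bounded. Both points need care because \<open>A\<close> is unbounded.

  Stability. The Jacobian changes from step to step, and a bound \<open>M exp(\<omega>t)\<close> with \<open>M > 1\<close> would
  be raised to the power \<open>n\<close>. In the equivalent norm
  \<open>N x = sup {exp(-\<omega>t) \<parallel>exp(tA) x\<parallel> | t \<ge> 0}\<close> (\<open>quasi_contractive_norm\<close>) the factor \<open>M\<close> disappears,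
  and the bounded perturbation \<open>g'(v)\<close> changes \<open>exp(tA)\<close> only by \<open>O(t)\<close>. So \<open>exp(t J(v))\<close> has
  \<open>N\<close>-norm at most \<open>exp(\<kappa>t)\<close> for all \<open>v\<close> in the strip, and products are harmless. Every other part
  of a step is Lipschitz in \<open>v\<close> with a constant \<open>O(h)\<close> (\<open>step_lipschitz\<close>), because
  \<open>exp(t J(v)) - exp(t J(w)) = O(t \<parallel>v - w\<parallel>)\<close> (\<open>semigroup_difference_le\<close>).

  Consistency (\<open>local_error\<close>). Linearised at \<open>w = u(t)\<close>, the equation reads \<open>u' = J(w) u + R(u)\<close>
  with \<open>R(x) = g(x) - g'(w) x\<close>, and \<open>u(t + h)\<close> is given by variation of constants with the
  inhomogeneity \<open>R(u(s))\<close>. As \<open>R'(w) = 0\<close>, the Taylor expansion of \<open>R(u(s))\<close> at \<open>s = t\<close> has no linear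
  term (\<open>remainder_taylor\<close>); let \<open>f\<^sub>2\<close> and \<open>f\<^sub>3\<close> be the second and third derivatives. The factor
  \<open>32/9\<close> makes the numerical scheme integrate the \<open>f\<^sub>2\<close> term exactly, since
  \<open>32/9 \<cdot> (3/4)\<^sup>2 / 2 = 1\<close>. For the cubic term the defect is
  \<open>h\<^sup>4 (\<phi>\<^sub>4(hJ) - \<phi>\<^sub>3(hJ)/4) f\<^sub>3\<close>. Its symbol vanishes at \<open>0\<close>, since \<open>\<phi>\<^sub>4(0) = 1/24\<close> and
  \<open>\<phi>\<^sub>3(0) = 1/6\<close>, which gains another factor \<open>h\<close> if \<open>J f\<^sub>3\<close> is bounded (\<open>phi_op_approx\<close>); this is
  what the bound on \<open>A f\<^sub>3\<close> is for. The stage has an error \<open>O(h\<^sup>3)\<close> only (\<open>stage_error\<close>), but it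
  enters through \<open>R\<close>, whose derivative is \<open>O(h)\<close> near \<open>w\<close> (\<open>remainder_small_lipschitz\<close>), so that it
  contributes \<open>O(h\<^sup>4)\<close> to the internal difference and \<open>O(h\<^sup>5)\<close> to the step.

  The argument rests on semigroup theory: exponential bounds, variation of constants,
  and the theorem that \<open>A + B\<close> generates a semigroup for bounded \<open>B\<close>, with bounds that are
  uniform for \<open>\<parallel>B\<parallel> \<le> \<beta>\<close> (\<open>bounded_perturbation\<close>). Uniqueness of the semigroup
  (\<open>semigroup_of_generator_unique\<close>) carries these bounds over to \<open>exp_op\<close>.

  For step sizes bounded away from zero a crude bound on the error is enough, because then
  \<open>h\<^sup>4\<close> is bounded below.
\<close>

section \<open>Calculus in Banach spaces\<close>

lemma norm_blinfun_le:
  assumes "norm T \<le> K" shows "norm (blinfun_apply T x) \<le> K * norm x"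
  using norm_blinfun[of T x] mult_right_mono[OF assms norm_ge_zero[of x]] by linarith

lemma norm_blinfun_le_mult:
  assumes "norm F \<le> p" "norm x \<le> q" shows "norm (blinfun_apply F x) \<le> p * q"
proof -
  have "0 \<le> p" using norm_ge_zero assms(1) by (rule order_trans)
  then show ?thesis using norm_blinfun_le[OF assms(1), of x] mult_left_mono[OF assms(2)] by fastforce
qed

lemma norm_diff_mono:
  fixes a b :: "'a::real_normed_vector"
  assumes "norm a \<le> p" "norm b \<le> q" shows "norm (a - b) \<le> p + q"
  using norm_triangle_ineq4[of a b] assms by linarith

lemma exp_add_le:
  fixes a b :: real assumes "a \<ge> 0" "b \<ge> 0" shows "exp a + b \<le> exp (a + b)"
proof -
  have "exp a + b \<le> exp a + exp a * b" using assms mult_right_mono[of 1 "exp a" b] by simp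
  also have "\<dots> = exp a * (1 + b)" by (simp add: distrib_left)
  also have "\<dots> \<le> exp a * exp b" using exp_ge_add_one_self[of b] by (intro mult_left_mono) auto
  finally show ?thesis by (simp add: exp_add)
qed

text \<open>
  Generators are defined by limits of difference quotients; this is the bridge to the calculus
  of vector derivatives.
\<close>

lemma has_vector_derivative_iff_quotient:
  "(f has_vector_derivative d) (at x within X) \<longleftrightarrow>
   ((\<lambda>y. (1 / (y - x)) *\<^sub>R (f y - f x)) \<longlongrightarrow> d) (at x within X)"
proof -
  have *: "norm ((1 / (y - x)) *\<^sub>R (f y - f x) - d) = norm (f y - f x - (y - x) *\<^sub>R d) / norm (y - x)"
    if "y \<noteq> x" for y
  proof -
    have "(1 / (y - x)) *\<^sub>R (f y - f x) - d = (1 / (y - x)) *\<^sub>R (f y - f x - (y - x) *\<^sub>R d)"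
      using that by (simp add: scaleR_diff_right)
    then show ?thesis using that by (simp add: divide_simps)
  qed
  have "((\<lambda>y. (1 / (y - x)) *\<^sub>R (f y - f x)) \<longlongrightarrow> d) (at x within X) \<longleftrightarrow>
        ((\<lambda>y. norm ((1 / (y - x)) *\<^sub>R (f y - f x) - d)) \<longlongrightarrow> 0) (at x within X)"
    by (subst LIM_zero_iff[symmetric], subst tendsto_norm_zero_iff) simp
  also have "\<dots> \<longleftrightarrow> ((\<lambda>y. norm (f y - f x - (y - x) *\<^sub>R d) / norm (y - x)) \<longlongrightarrow> 0) (at x within X)"
    by (intro tendsto_cong) (use * in \<open>auto simp: eventually_at_filter\<close>)
  finally show ?thesis
    by (simp add: has_vector_derivative_def has_derivative_iff_norm bounded_linear_scaleR_left)
qed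

lemma has_vector_derivative_chain:
  assumes "(u has_vector_derivative d) (at s within X)" "(f has_derivative f') (at (u s))"
  shows "((\<lambda>s. f (u s)) has_vector_derivative f' d) (at s within X)"
proof -
  have "((\<lambda>s. f (u s)) has_derivative (\<lambda>x. f' (x *\<^sub>R d))) (at s within X)"
    using has_derivative_compose[OF assms(1)[unfolded has_vector_derivative_def] assms(2)] .
  moreover have "f' (x *\<^sub>R d) = x *\<^sub>R f' d" for x
    using linear_scale[OF has_derivative_linear[OF assms(2)]] .
  ultimately show ?thesis by (simp add: has_vector_derivative_def)
qed

lemmas has_vector_derivative_blinfun_apply =
  bounded_bilinear.has_vector_derivative[OF bounded_bilinear_blinfun_apply]

lemma has_integral_norm_le:
  fixes f :: "real \<Rightarrow> 'a::real_normed_vector"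
  assumes "(f has_integral I) {a..b}" "a \<le> b" "\<And>s. s \<in> {a..b} \<Longrightarrow> norm (f s) \<le> K"
  shows "norm I \<le> K * (b - a)"
proof -
  have "0 \<le> K" using order_trans[OF norm_ge_zero assms(3)[of a]] assms(2) by simp
  then show ?thesis using has_integral_bound_real[of K "{}" f I a b] assms by simp
qed

lemma has_integral_reverse:
  fixes f :: "real \<Rightarrow> 'a::real_normed_vector"
  assumes "(f has_integral I) {0..h}" "h \<ge> 0"
  shows "((\<lambda>s. f (h - s)) has_integral I) {0..h}"
proof -
  have "(\<lambda>x. (1 / - 1) *\<^sub>R x + - ((1 / - 1) *\<^sub>R h)) ` cbox 0 h = {0..h}"
    using assms(2) by (auto simp: image_def intro!: bexI[of _ "h - _"])
  then show ?thesis
    using has_integral_affinity[of f I 0 h "- 1" h] assms(1) by (simp add: algebra_simps)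
qed

lemma norm_vector_derivative_le:
  fixes f :: "real \<Rightarrow> 'a::banach"
  assumes "a \<le> b" "\<And>s. s \<in> {a..b} \<Longrightarrow> (f has_vector_derivative f' s) (at s within {a..b})"
    and "\<And>s. s \<in> {a..b} \<Longrightarrow> norm (f' s) \<le> K"
  shows "norm (f b - f a) \<le> K * (b - a)"
  using has_integral_norm_le[OF fundamental_theorem_of_calculus[OF assms(1,2)] assms(1,3)] .

text \<open>
  The mixed second difference \<open>g(v + tx + ty) - g(v + tx) - g(v + ty) + g(v)\<close> is symmetric in \<open>x\<close>
  and \<open>y\<close>, and by the mean value inequality it equals \<open>t\<^sup>2 g2 x y\<close> up to \<open>O(\<epsilon> t\<^sup>2)\<close>, because
  \<open>g1\<close> is differentiable at \<open>v\<close>.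
\<close>

lemma second_derivative_symmetric:
  fixes g :: "'a::real_normed_vector \<Rightarrow> 'b::banach"
  assumes V: "open V" "v \<in> V"
    and g: "\<And>w. w \<in> V \<Longrightarrow> (g has_derivative blinfun_apply (g1 w)) (at w)"
    and g1: "(g1 has_derivative blinfun_apply g2) (at v)"
  shows "blinfun_apply (blinfun_apply g2 x) y = blinfun_apply (blinfun_apply g2 y) x"
proof -
  define K where "K = norm x + norm y + 1"
  have K: "K > 0" "norm x + norm y < K" unfolding K_def by (auto intro: add_nonneg_pos)
  have "norm (g2 x y - g2 y x) \<le> 4 * K\<^sup>2 * e" if e: "e > 0" for e
  proof -
    obtain d1 where d1: "d1 > 0" "ball v d1 \<subseteq> V" using V by (meson open_contains_ball)
    obtain d2 where d2: "d2 > 0"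
      "\<And>w. norm (w - v) < d2 \<Longrightarrow> norm (g1 w - g1 v - g2 (w - v)) \<le> e * norm (w - v)"
      using g1 e unfolding has_derivative_at_alt by blast
    \<comment> \<open>All points \<open>v + z\<close> used below have \<open>norm z < t * K\<close>, within both radii.\<close>
    define t where "t = min d1 d2 / K"
    have t: "t > 0" using d1 d2 K by (simp add: t_def)
    have tK: "t * K \<le> d1" "t * K \<le> d2" using K by (auto simp: t_def)
    have near: "v + z \<in> V" "norm (g1 (v + z) - g1 v - g2 z) \<le> e * (t * K)"
      if z: "z = (t * \<alpha>) *\<^sub>R p + (t * \<beta>) *\<^sub>R q" "\<alpha> \<in> {0..1}" "\<beta> \<in> {0..1}" "norm p + norm q < K" for z \<alpha> \<beta> p q
    proof -
      have "norm z \<le> t * \<alpha> * norm p + t * \<beta> * norm q"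
        unfolding z(1) using t z by (intro order_trans[OF norm_triangle_ineq]) auto
      also have "\<dots> \<le> t * 1 * norm p + t * 1 * norm q"
        using t z by (intro add_mono mult_right_mono mult_left_mono) auto
      also have "\<dots> < t * K" using t z by (simp flip: distrib_left)
      finally have *: "norm z < t * K" .
      then show "v + z \<in> V" using tK by (intro subsetD[OF d1(2)]) (simp add: dist_norm)
      have "norm (g1 (v + z) - g1 v - g2 z) \<le> e * norm z"
        using d2(2)[of "v + z"] * tK by simp
      also have "\<dots> \<le> e * (t * K)" using * e by simp
      finally show "norm (g1 (v + z) - g1 v - g2 z) \<le> e * (t * K)" .
    qed
    have half: "norm ((g (v + t *\<^sub>R p + t *\<^sub>R q) - g (v + t *\<^sub>R q) - (g (v + t *\<^sub>R p) - g v)) - t\<^sup>2 *\<^sub>R g2 p q)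
        \<le> 2 * e * t\<^sup>2 * K\<^sup>2" if pq: "norm p + norm q < K" for p q
    proof -
      \<comment> \<open>The increment in the direction \<open>p\<close>, moved along \<open>q\<close>, minus its linear prediction.\<close>
      define \<phi> where "\<phi> s = g ((v + t *\<^sub>R p) + (t * s) *\<^sub>R q) - g (v + (t * s) *\<^sub>R q) - s *\<^sub>R (t\<^sup>2 *\<^sub>R g2 p q)" for s
      define \<phi>' where "\<phi>' s = g1 ((v + t *\<^sub>R p) + (t * s) *\<^sub>R q) (t *\<^sub>R q) - g1 (v + (t * s) *\<^sub>R q) (t *\<^sub>R q)
          - t\<^sup>2 *\<^sub>R g2 p q" for s
      have "norm (\<phi> 1 - \<phi> 0) \<le> 2 * (e * (t * K)) * (t * K) * (1 - 0)"
      proof (rule norm_vector_derivative_le)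
        fix s :: real assume s: "s \<in> {0..1}"
        have z1: "v + t *\<^sub>R p + (t * s) *\<^sub>R q = v + ((t * 1) *\<^sub>R p + (t * s) *\<^sub>R q)" by simp
        have z0: "v + (t * s) *\<^sub>R q = v + ((t * 0) *\<^sub>R p + (t * s) *\<^sub>R q)" by simp
        have V1: "v + t *\<^sub>R p + (t * s) *\<^sub>R q \<in> V"
          unfolding z1 using s pq by (intro near(1)[OF refl]) auto
        have V0: "v + (t * s) *\<^sub>R q \<in> V"
          unfolding z0 using s pq by (intro near(1)[OF refl]) auto
        have line: "((\<lambda>s. c + (t * s) *\<^sub>R q) has_vector_derivative t *\<^sub>R q) (at s within {0..1})" for c
          by (auto intro!: derivative_eq_intros simp: has_vector_derivative_def)
        have lin: "((\<lambda>s. s *\<^sub>R (t\<^sup>2 *\<^sub>R g2 p q)) has_vector_derivative t\<^sup>2 *\<^sub>R g2 p q) (at s within {0..1})"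
          by (auto intro!: derivative_eq_intros simp: has_vector_derivative_def)
        show "(\<phi> has_vector_derivative \<phi>' s) (at s within {0..1})"
          unfolding \<phi>_def \<phi>'_def
          by (intro has_vector_derivative_diff lin has_vector_derivative_chain[OF line] g V0 V1)
        have n1: "norm (g1 (v + t *\<^sub>R p + (t * s) *\<^sub>R q) - g1 v - g2 ((t * 1) *\<^sub>R p + (t * s) *\<^sub>R q)) \<le> e * (t * K)"
          unfolding z1 using s pq by (intro near(2)[OF refl]) auto
        have n0: "norm (g1 (v + (t * s) *\<^sub>R q) - g1 v - g2 ((t * 0) *\<^sub>R p + (t * s) *\<^sub>R q)) \<le> e * (t * K)"
          unfolding z0 using s pq by (intro near(2)[OF refl]) auto
        have "\<phi>' s = ((g1 (v + t *\<^sub>R p + (t * s) *\<^sub>R q) - g1 v - g2 ((t * 1) *\<^sub>R p + (t * s) *\<^sub>R q))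
            - (g1 (v + (t * s) *\<^sub>R q) - g1 v - g2 ((t * 0) *\<^sub>R p + (t * s) *\<^sub>R q))) (t *\<^sub>R q)"
          by (simp add: \<phi>'_def blinfun.diff_left blinfun.add_left blinfun.diff_right blinfun.add_right
              blinfun.scaleR_left blinfun.scaleR_right power2_eq_square scaleR_diff_right)
        also have "norm \<dots> \<le> (2 * (e * (t * K))) * norm (t *\<^sub>R q)"
          by (rule norm_blinfun_le) (use norm_triangle_ineq4 n1 n0 in \<open>smt (verit)\<close>)
        also have "\<dots> \<le> 2 * (e * (t * K)) * (t * K)"
          using e t K pq norm_ge_zero[of p] by (intro mult_left_mono) (auto simp del: norm_ge_zero)
        finally show "norm (\<phi>' s) \<le> 2 * (e * (t * K)) * (t * K)" .
      qed simp
      moreover have "\<phi> 1 - \<phi> 0 = (g (v + t *\<^sub>R p + t *\<^sub>R q) - g (v + t *\<^sub>R q) - (g (v + t *\<^sub>R p) - g v)) - t\<^sup>2 *\<^sub>R g2 p q"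
        by (simp add: \<phi>_def)
      ultimately show ?thesis by (simp add: power2_eq_square mult_ac)
    qed
    have "t\<^sup>2 * norm (g2 x y - g2 y x) = norm (t\<^sup>2 *\<^sub>R g2 x y - t\<^sup>2 *\<^sub>R g2 y x)"
      by (simp flip: scaleR_diff_right)
    also have "\<dots> \<le> 2 * e * t\<^sup>2 * K\<^sup>2 + 2 * e * t\<^sup>2 * K\<^sup>2"
    proof -
      have "t\<^sup>2 *\<^sub>R g2 x y - t\<^sup>2 *\<^sub>R g2 y x =
        ((g (v + t *\<^sub>R y + t *\<^sub>R x) - g (v + t *\<^sub>R x) - (g (v + t *\<^sub>R y) - g v)) - t\<^sup>2 *\<^sub>R g2 y x) -
        ((g (v + t *\<^sub>R x + t *\<^sub>R y) - g (v + t *\<^sub>R y) - (g (v + t *\<^sub>R x) - g v)) - t\<^sup>2 *\<^sub>R g2 x y)"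
        by (simp add: algebra_simps)
      moreover have "norm y + norm x < K" using K by simp
      ultimately show ?thesis
        using half[OF K(2)] half[of y x] norm_triangle_ineq4 by (smt (verit))
    qed
    also have "\<dots> = t\<^sup>2 * (4 * K\<^sup>2 * e)" by simp
    finally show ?thesis using t by (simp only: mult_le_cancel_left) auto
  qed
  note * = this
  have "norm (g2 x y - g2 y x) \<le> 0"
  proof (rule field_le_epsilon)
    fix e :: real assume "e > 0"
    then show "norm (g2 x y - g2 y x) \<le> 0 + e"
      using *[of "e / (4 * K\<^sup>2)"] K by simp
  qed
  then show ?thesis by simp
qed

text \<open>
  The closed sets where all \<open>T i\<close> are bounded by \<open>n\<close> cover the space, so by Baire's theorem one of
  them contains a ball.
\<close>

lemma uniform_boundedness:
  fixes T :: "'i \<Rightarrow> 'a::banach \<Rightarrow>\<^sub>L 'b::real_normed_vector"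
  assumes "\<And>x. \<exists>B. \<forall>i\<in>I. norm (T i x) \<le> B"
  shows "\<exists>B. \<forall>i\<in>I. norm (T i) \<le> B"
proof -
  define F where "F n = {x. \<forall>i\<in>I. norm (T i x) \<le> real n}" for n
  have F_eq: "F n = (\<Inter>i\<in>I. {x. norm (T i x) \<le> real n})" for n
    by (auto simp: F_def)
  have closed: "closed (F n)" for n
    unfolding F_eq by (intro closed_INT ballI closed_Collect_le continuous_intros)
  have cover: "(\<Union>n. F n) = UNIV"
  proof (intro equalityI subsetI UNIV_I)
    fix x
    obtain B where "\<forall>i\<in>I. norm (T i x) \<le> B" using assms by blast
    moreover obtain n where "B \<le> real n" using real_arch_simple by blast
    ultimately have "x \<in> F n" unfolding F_def by (auto intro: order_trans)
    then show "x \<in> (\<Union>n. F n)" by blast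
  qed
  have "\<exists>n. interior (F n) \<noteq> {}"
  proof (rule ccontr)
    assume "\<nexists>n. interior (F n) \<noteq> {}"
    then have "Met_TC.mtopology interior_of \<Union>(range F) = {}"
      by (intro Met_TC.metric_Baire_category_alt)
        (auto simp: closed complete_UNIV)
    then show False using cover by simp
  qed
  then obtain n x0 where "x0 \<in> interior (F n)" by blast
  then obtain e where e: "e > 0" "cball x0 e \<subseteq> F n"
    by (meson mem_interior_cball)
  have "norm (T i) \<le> 2 * real n / e" if i: "i \<in> I" for i
  proof (rule norm_blinfun_bound)
    fix y
    show "norm (T i y) \<le> 2 * real n / e * norm y"
    proof (cases "y = 0")
      case False
      define z where "z = (e / norm y) *\<^sub>R y"
      have "norm z = e" using False e by (simp add: z_def)
      then have "x0 + z \<in> F n" "x0 \<in> F n"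
        using e by (auto simp: dist_norm intro!: subsetD[OF e(2)])
      then have "norm (T i (x0 + z)) \<le> n" "norm (T i x0) \<le> n"
        using i by (auto simp: F_def)
      moreover have "T i z = T i (x0 + z) - T i x0" by (simp add: blinfun.add_right)
      ultimately have "norm (T i z) \<le> 2 * real n"
        using norm_triangle_ineq4[of "T i (x0 + z)" "T i x0"] by simp
      moreover have "norm (T i z) = e / norm y * norm (T i y)"
        using e by (simp add: z_def blinfun.scaleR_right)
      ultimately show ?thesis using e False by (simp add: field_simps)
    qed simp
  qed (use e in auto)
  then show ?thesis by blast
qed

section \<open>Strongly continuous semigroups\<close>

locale generated_semigroup =
  fixes S :: "real \<Rightarrow> 'a::banach \<Rightarrow>\<^sub>L 'a" and D :: "'a set" and A :: "'a \<Rightarrow> 'a"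
  assumes generator: "semigroup_generator S D A"
begin

lemma semigroup_0 [simp]: "S 0 = id_blinfun"
  and semigroup_add: "s \<ge> 0 \<Longrightarrow> t \<ge> 0 \<Longrightarrow> S (s + t) x = S s (S t x)"
  and semigroup_at_0: "((\<lambda>t. S t x) \<longlongrightarrow> x) (at_right 0)"
  using generator by (auto simp: semigroup_generator_def C0_semigroup_def)

text \<open>
  Norms are bounded near \<open>0\<close>: otherwise they would be unbounded along a null sequence, against
  the uniform boundedness principle, as orbits converge there. The semigroup law spreads the
  bound with exponential growth.
\<close>

lemma exponential_bound:
  obtains M w where "M \<ge> 1" "w \<ge> 0" "\<And>t. t \<ge> 0 \<Longrightarrow> norm (S t) \<le> M * exp (w * t)"
proof -
  have "\<exists>d>0. \<exists>M. \<forall>t\<in>{0..d}. norm (S t) \<le> M"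
  proof (rule ccontr)
    assume "\<not> ?thesis"
    then have "\<exists>t\<in>{0..1 / Suc n}. norm (S t) > real n" for n
      by (meson divide_pos_pos linorder_not_less of_nat_0_less_iff zero_less_Suc zero_less_one)
    then obtain t where t: "\<And>n. t n \<in> {0..1 / Suc n}" "\<And>n. norm (S (t n)) > real n"
      by metis
    have lim_t: "t \<longlonglongrightarrow> 0"
      by (rule real_tendsto_sandwich[of "\<lambda>_. 0" _ _ "\<lambda>n. 1 / Suc n"])
        (use t LIMSEQ_inverse_real_of_nat in \<open>auto intro!: always_eventually simp: inverse_eq_divide\<close>)
    have "\<exists>B. \<forall>n\<in>UNIV. norm (S (t n) x) \<le> B" for x
    proof -
      have "((\<lambda>t. S t x) \<longlongrightarrow> S 0 x) (at 0 within {0..})"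
        using semigroup_at_0[of x] by (simp add: at_within_Ici_at_right)
      then have "continuous (at 0 within {0..}) (\<lambda>t. S t x)"
        by (simp add: continuous_within)
      then have "(\<lambda>n. S (t n) x) \<longlonglongrightarrow> S 0 x"
        using lim_t t(1) by (auto simp: continuous_within_sequentially o_def)
      then have "Bseq (\<lambda>n. S (t n) x)"
        by (intro convergent_imp_Bseq convergentI)
      then show ?thesis by (auto simp: Bseq_def)
    qed
    then obtain B where "\<And>n. norm (S (t n)) \<le> B"
      using uniform_boundedness[of UNIV "\<lambda>n. S (t n)"] by auto
    moreover obtain n where "B \<le> real n" using real_arch_simple by blast
    ultimately show False using t(2)[of n] by (meson linorder_not_le order_trans)
  qed
  then obtain d M0 where d: "d > 0" and M0: "\<And>t. t \<in> {0..d} \<Longrightarrow> norm (S t) \<le> M0" by blast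
  define M where "M = max 1 M0"
  define w where "w = ln M / d"
  have M: "M \<ge> 1" "\<And>t. t \<in> {0..d} \<Longrightarrow> norm (S t) \<le> M"
    using M0 by (auto simp: M_def le_max_iff_disj)
  have pow: "norm (S (real n * d + t)) \<le> M ^ Suc n" if "t \<in> {0..d}" for n t
  proof (induction n)
    case (Suc n)
    have "S (real (Suc n) * d + t) = S d o\<^sub>L S (real n * d + t)"
      using that d semigroup_add[of d "real n * d + t"]
      by (intro blinfun_eqI) (simp add: algebra_simps)
    then have "norm (S (real (Suc n) * d + t)) \<le> norm (S d) * norm (S (real n * d + t))"
      by (simp add: norm_blinfun_compose)
    also have "\<dots> \<le> M * M ^ Suc n"
      using Suc M d by (intro mult_mono) auto
    finally show ?case by simp
  qed (use M that in simp)
  have "norm (S t) \<le> M * exp (w * t)" if "t \<ge> 0" for t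
  proof -
    define n where "n = nat \<lfloor>t / d\<rfloor>"
    have n: "real n \<le> t / d" "t / d \<le> real n + 1"
      using that d unfolding n_def by (auto simp: le_nat_floor)
    have "norm (S (real n * d + (t - real n * d))) \<le> M ^ Suc n"
      using n d by (intro pow) (simp add: field_simps)
    moreover have "M ^ n \<le> exp (w * t)"
    proof -
      have "M ^ n = exp (ln M * real n)"
        using M by (simp add: exp_of_nat2_mult)
      also have "\<dots> \<le> exp (ln M * (t / d))"
        using n M by (intro exp_le_cancel_iff[THEN iffD2] mult_left_mono) auto
      finally show ?thesis by (simp add: w_def)
    qed
    ultimately show ?thesis using M by (auto intro: order_trans mult_left_mono)
  qed
  moreover have "w \<ge> 0" using M d by (simp add: w_def)
  ultimately show ?thesis using M that by blast
qed

text \<open>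
  The difference \<open>S s x - S t x\<close> is \<open>S (min s t)\<close> applied to \<open>S \<bar>s - t\<bar> x - x\<close> up to sign, which
  treats continuity from the left and from the right in one stroke. Joint continuity makes
  convolutions and parameter integrals with the semigroup continuous.
\<close>

lemma continuous_on_joint: "continuous_on ({0..} \<times> UNIV) (\<lambda>(t, x). S t x)"
proof -
  obtain M w where M: "M \<ge> 1" "w \<ge> 0" "\<And>t. t \<ge> 0 \<Longrightarrow> norm (S t) \<le> M * exp (w * t)"
    using exponential_bound by blast
  have "\<exists>d>0. \<forall>s y. s \<ge> 0 \<longrightarrow> dist (s, y) (t, x) < d \<longrightarrow> dist (S s y) (S t x) < e"
    if t: "t \<ge> 0" and e: "e > 0" for t x e
  proof -
    define K where "K = M * exp (w * (t + 1))"
    have K: "K > 0" using M unfolding K_def by (simp add: less_le_trans[OF zero_less_one])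
    have S_le: "norm (S s) \<le> K" if "s \<ge> 0" "s \<le> t + 1" for s
      unfolding K_def using M that
      by (intro order_trans[OF M(3)] mult_left_mono exp_le_cancel_iff[THEN iffD2]) auto
    obtain d0 where d0: "d0 > 0" "\<And>r. 0 < r \<Longrightarrow> r < d0 \<Longrightarrow> dist (S r x) x < e / (2 * K)"
    proof -
      have "\<forall>\<^sub>F r in at_right 0. dist (S r x) x < e / (2 * K)"
        using tendstoD[OF semigroup_at_0[of x], of "e / (2 * K)"] e K by simp
      then show ?thesis using that by (auto simp: eventually_at_right_field)
    qed
    define d where "d = min 1 (min d0 (e / (2 * K)))"
    have "dist (S s y) (S t x) < e" if s: "s \<ge> 0" and dist: "dist (s, y) (t, x) < d" for s y
    proof -
      have "dist s t < d" "dist y x < d"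
        using dist dist_fst_le[of "(s, y)" "(t, x)"] dist_snd_le[of "(s, y)" "(t, x)"] by auto
      then have st: "\<bar>s - t\<bar> < 1" "\<bar>s - t\<bar> < d0" and yx: "norm (y - x) < e / (2 * K)"
        by (auto simp: d_def dist_norm)
      have near: "norm (S \<bar>s - t\<bar> x - x) < e / (2 * K)"
        using d0(2)[of "\<bar>s - t\<bar>"] st e K by (cases "s = t") (auto simp: dist_norm)
      have "norm (S s x - S t x) \<le> K * norm (S \<bar>s - t\<bar> x - x)"
      proof (cases "t \<le> s")
        case True
        then have "S s x - S t x = S t (S \<bar>s - t\<bar> x - x)"
          using t semigroup_add[of t "s - t" x] by (simp add: blinfun.diff_right)
        then show ?thesis
          using norm_blinfun_le[OF S_le[of t]] t by simp
      next
        case False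
        then have "S t x - S s x = S s (S \<bar>s - t\<bar> x - x)"
          using s semigroup_add[of s "t - s" x] by (simp add: blinfun.diff_right)
        then have "norm (S s x - S t x) = norm (S s (S \<bar>s - t\<bar> x - x))"
          by (metis norm_minus_commute)
        then show ?thesis
          using norm_blinfun_le[OF S_le[of s]] s False by simp
      qed
      also have "\<dots> < K * (e / (2 * K))" using near K by (intro mult_strict_left_mono)
      finally have 1: "norm (S s x - S t x) < e / 2" using K by simp
      have "norm (S s y - S s x) \<le> K * norm (y - x)"
        using norm_blinfun_le[OF S_le[of s], of "y - x"] s st by (simp add: blinfun.diff_right)
      also have "\<dots> < K * (e / (2 * K))" using yx K by (intro mult_strict_left_mono)
      finally have "norm (S s y - S s x) < e / 2" using K by simp
      with 1 show ?thesis
        using norm_triangle_ineq[of "S s y - S s x" "S s x - S t x"] by (simp add: dist_norm)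
    qed
    moreover have "d > 0" using d0 e K by (simp add: d_def)
    ultimately show ?thesis by blast
  qed
  then show ?thesis by (fastforce simp: continuous_on_iff)
qed

lemma continuous_on_semigroup [continuous_intros]:
  assumes "continuous_on X f" "continuous_on X y" "\<And>x. x \<in> X \<Longrightarrow> f x \<ge> 0"
  shows "continuous_on X (\<lambda>x. S (f x) (y x))"
  using continuous_on_compose2[OF continuous_on_joint continuous_on_Pair[OF assms(1,2)]] assms(3)
  by (auto simp: image_subset_iff)

lemma tendsto_semigroup:
  assumes "(f \<longlongrightarrow> t) F" "(y \<longlongrightarrow> x) F" "t \<ge> 0" "\<forall>\<^sub>F z in F. f z \<ge> 0"
  shows "((\<lambda>z. S (f z) (y z)) \<longlongrightarrow> S t x) F"
  using continuous_on_tendsto_compose[OF continuous_on_joint tendsto_Pair[OF assms(1,2)]] assms(3,4)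
  by auto

lemma mem_domain_iff: "x \<in> D \<longleftrightarrow> (\<exists>y. ((\<lambda>t. (1 / t) *\<^sub>R (S t x - x)) \<longlongrightarrow> y) (at_right 0))"
  and generator_tendsto: "x \<in> D \<Longrightarrow> ((\<lambda>t. (1 / t) *\<^sub>R (S t x - x)) \<longlongrightarrow> A x) (at_right 0)"
  using generator unfolding semigroup_generator_def by auto

text \<open>
  The way to show that a vector lies in the domain: the difference quotient need only converge
  to something.
\<close>

lemma generator_eqI:
  assumes "((\<lambda>t. (1 / t) *\<^sub>R (S t x - x)) \<longlongrightarrow> y) (at_right 0)"
  shows "x \<in> D \<and> A x = y"
  using assms mem_domain_iff generator_tendsto tendsto_unique[OF trivial_limit_at_right_real]
  by blast

lemma generator_add:
  assumes "x \<in> D" "y \<in> D" shows "x + y \<in> D \<and> A (x + y) = A x + A y"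
  by (rule generator_eqI)
    (use tendsto_add[OF assms[THEN generator_tendsto]]
      in \<open>simp add: blinfun.add_right algebra_simps\<close>)

lemma generator_scaleR:
  assumes "x \<in> D" shows "c *\<^sub>R x \<in> D \<and> A (c *\<^sub>R x) = c *\<^sub>R A x"
  by (rule generator_eqI)
    (use tendsto_scaleR[OF tendsto_const[of c] generator_tendsto[OF assms]]
      in \<open>simp add: blinfun.scaleR_right algebra_simps\<close>)

lemma semigroup_domain:
  assumes "x \<in> D" "s \<ge> 0" shows "S s x \<in> D \<and> A (S s x) = S s (A x)"
proof (rule generator_eqI)
  have "((\<lambda>t. S s ((1 / t) *\<^sub>R (S t x - x))) \<longlongrightarrow> S s (A x)) (at_right 0)"
    using assms by (intro tendsto_intros generator_tendsto)
  moreover have "\<forall>\<^sub>F t in at_right 0. S s ((1 / t) *\<^sub>R (S t x - x)) = (1 / t) *\<^sub>R (S t (S s x) - S s x)"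
  proof (rule eventually_at_right_less[THEN eventually_mono])
    fix t :: real assume "0 < t"
    then have "S s (S t x) = S t (S s x)"
      using semigroup_add[of s t x] semigroup_add[of t s x] assms by (simp add: add.commute)
    then show "S s ((1 / t) *\<^sub>R (S t x - x)) = (1 / t) *\<^sub>R (S t (S s x) - S s x)"
      by (simp add: blinfun.scaleR_right blinfun.diff_right)
  qed
  ultimately show "((\<lambda>t. (1 / t) *\<^sub>R (S t (S s x) - S s x)) \<longlongrightarrow> S s (A x)) (at_right 0)"
    by (blast intro: Lim_transform_eventually)
qed

text \<open>
  The quotient at \<open>\<tau>\<close> is \<open>S (min \<tau> t)\<close> applied to the defining quotient of the generator at
  \<open>\<bar>\<tau> - t\<bar>\<close>, on either side of \<open>t\<close>.
\<close>

lemma orbit_has_vector_derivative: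
  assumes "x \<in> D" "t \<ge> 0"
  shows "((\<lambda>\<tau>. S \<tau> x) has_vector_derivative S t (A x)) (at t within {0..})"
  unfolding has_vector_derivative_iff_quotient
proof (rule Lim_transform_eventually)
  have "filterlim (\<lambda>\<tau>. \<bar>\<tau> - t\<bar>) (at_right 0) (at t within {0..})"
    by (auto simp: filterlim_at eventually_at_filter intro!: tendsto_eq_intros)
  then have lim: "((\<lambda>\<tau>. (1 / \<bar>\<tau> - t\<bar>) *\<^sub>R (S \<bar>\<tau> - t\<bar> x - x)) \<longlongrightarrow> A x) (at t within {0..})"
    by (rule filterlim_compose[OF generator_tendsto[OF assms(1)]])
  have "((\<lambda>\<tau>. min \<tau> t) \<longlongrightarrow> min t t) (at t within {0..})"
    by (intro tendsto_intros)
  then show "((\<lambda>\<tau>. S (min \<tau> t) ((1 / \<bar>\<tau> - t\<bar>) *\<^sub>R (S \<bar>\<tau> - t\<bar> x - x))) \<longlongrightarrow> S t (A x))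
          (at t within {0..})"
    using assms by (intro tendsto_semigroup lim) (auto simp: eventually_at_filter)
  have "S (min \<tau> t) ((1 / \<bar>\<tau> - t\<bar>) *\<^sub>R (S \<bar>\<tau> - t\<bar> x - x)) = (1 / (\<tau> - t)) *\<^sub>R (S \<tau> x - S t x)"
    if "\<tau> \<ge> 0" for \<tau>
  proof (cases "t \<le> \<tau>")
    case True
    then show ?thesis using assms semigroup_add[of t "\<tau> - t" x]
      by (simp add: blinfun.scaleR_right blinfun.diff_right)
  next
    case False
    then have *: "S \<tau> (S \<bar>\<tau> - t\<bar> x) = S t x"
      using semigroup_add[of \<tau> "t - \<tau>" x] that by simp
    have "1 / \<bar>\<tau> - t\<bar> = - (1 / (\<tau> - t))" "min \<tau> t = \<tau>" using False by (auto simp: field_simps)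
    then show ?thesis
      by (simp only: blinfun.scaleR_right blinfun.diff_right *)
        (simp add: algebra_simps)
  qed
  then show "\<forall>\<^sub>F \<tau> in at t within {0..}.
        S (min \<tau> t) ((1 / \<bar>\<tau> - t\<bar>) *\<^sub>R (S \<bar>\<tau> - t\<bar> x - x)) = (1 / (\<tau> - t)) *\<^sub>R (S \<tau> x - S t x)"
    by (auto simp: eventually_at_filter)
qed

text \<open>
  The operators \<open>S (b - \<sigma>)\<close> are differentiable only on the domain, so the product is split as
  \<open>S (b - \<sigma>) (y s) + S (b - \<sigma>) (y \<sigma> - y s)\<close>: the first term is an orbit of a fixed domain element,
  and for the second strong continuity suffices.
\<close>

lemma backward_product_rule:
  assumes y: "(y has_vector_derivative y') (at s within {a..b})" and "y s \<in> D" and s: "s \<in> {a..b}"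
  shows "((\<lambda>\<sigma>. S (b - \<sigma>) (y \<sigma>)) has_vector_derivative S (b - s) (y' - A (y s))) (at s within {a..b})"
proof -
  have 1: "((\<lambda>\<sigma>. S (b - \<sigma>) (y s)) has_vector_derivative (- 1) *\<^sub>R S (b - s) (A (y s)))
      (at s within {a..b})"
  proof -
    have "((\<lambda>\<sigma>. b - \<sigma>) has_vector_derivative - 1) (at s within {a..b})"
      by (auto intro!: derivative_eq_intros)
    moreover have "((\<lambda>\<tau>. S \<tau> (y s)) has_vector_derivative S (b - s) (A (y s)))
        (at (b - s) within (\<lambda>\<sigma>. b - \<sigma>) ` {a..b})"
      by (rule has_vector_derivative_within_subset[OF orbit_has_vector_derivative]) (use assms in auto)
    ultimately show ?thesis
      using vector_diff_chain_within[of "\<lambda>\<sigma>. b - \<sigma>" "- 1" s "{a..b}" "\<lambda>\<tau>. S \<tau> (y s)"]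
      by (simp add: o_def)
  qed
  have 2: "((\<lambda>\<sigma>. S (b - \<sigma>) (y \<sigma> - y s)) has_vector_derivative S (b - s) y') (at s within {a..b})"
    unfolding has_vector_derivative_iff_quotient
  proof -
    have "((\<lambda>\<sigma>. S (b - \<sigma>) ((1 / (\<sigma> - s)) *\<^sub>R (y \<sigma> - y s))) \<longlongrightarrow> S (b - s) y') (at s within {a..b})"
      using y s unfolding has_vector_derivative_iff_quotient
      by (intro tendsto_semigroup) (auto intro!: tendsto_intros simp: eventually_at_filter)
    then show "((\<lambda>\<sigma>. (1 / (\<sigma> - s)) *\<^sub>R (S (b - \<sigma>) (y \<sigma> - y s) - S (b - s) (y s - y s))) \<longlongrightarrow>
        S (b - s) y') (at s within {a..b})"
      by (simp add: blinfun.scaleR_right)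
  qed
  show ?thesis
    using has_vector_derivative_add[OF 1 2]
    by (simp add: blinfun.diff_right)
qed

text \<open>
  Used in three ways: with \<open>y\<close> an orbit of the same generator for uniqueness of the semigroup, with
  \<open>y\<close> an orbit of a perturbed generator for comparing semigroups, and with \<open>y\<close> the exact solution.
\<close>

lemma variation_of_constants:
  assumes "a \<le> b" "\<And>s. s \<in> {a..b} \<Longrightarrow> (y has_vector_derivative y' s) (at s within {a..b})"
    and "\<And>s. s \<in> {a..b} \<Longrightarrow> y s \<in> D"
  shows "((\<lambda>s. S (b - s) (y' s - A (y s))) has_integral (y b - S (b - a) (y a))) {a..b}"
  using fundamental_theorem_of_calculus[OF assms(1) backward_product_rule, OF assms(2,3)]
  by simp

lemma orbit_has_integral:
  assumes "x \<in> D" "t \<ge> 0"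
  shows "((\<lambda>s. S s (A x)) has_integral (S t x - x)) {0..t}"
proof -
  have "((\<lambda>s. S s x) has_vector_derivative S s (A x)) (at s within {0..t})" if "s \<in> {0..t}" for s
    by (rule has_vector_derivative_within_subset[OF orbit_has_vector_derivative]) (use assms that in auto)
  then show ?thesis using fundamental_theorem_of_calculus[OF assms(2)] by fastforce
qed

lemma domain_has_vector_derivativeI:
  assumes "((\<lambda>t. S t x) has_vector_derivative d) (at 0 within {0..1})"
  shows "x \<in> D"
  using assms generator_eqI[of x d]
  by (simp add: has_vector_derivative_iff_quotient at_within_Icc_at_right)

text \<open>
  Needed for quadratic weights because \<open>\<phi>\<^sub>3\<close> is such an integral. Applying \<open>S \<tau>\<close> shifts the interval
  of integration to \<open>[\<tau>, \<tau> + h]\<close> and the weight to \<open>p(s - \<tau>)\<close>. Expanding this weight in powers of \<open>s\<close>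
  leaves integrals of \<open>s\<^sup>i S s x\<close> over the moving interval, and the fundamental theorem of calculus
  differentiates them for every \<open>x\<close>.
\<close>

lemma weighted_integral_in_domain:
  assumes "h \<ge> 0"
  shows "integral {0..h} (\<lambda>s. (\<alpha> + \<beta> * s + \<gamma> * s\<^sup>2) *\<^sub>R S s x) \<in> D"
proof (rule domain_has_vector_derivativeI)
  define Q where "Q i t = integral {0..t} (\<lambda>s. s ^ i *\<^sub>R S s x)" for i t
  define K where "K i \<tau> = Q i (\<tau> + h) - Q i \<tau>" for i \<tau>
  have cont: "continuous_on {0..c} (\<lambda>s. s ^ i *\<^sub>R S s x)" for i c
    by (intro continuous_intros) auto
  have Q: "(Q i has_vector_derivative t ^ i *\<^sub>R S t x) (at t within {0..1 + h})" if "t \<in> {0..1 + h}" for i t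
    unfolding Q_def using integral_has_vector_derivative[OF cont that] .
  have K: "(K i has_vector_derivative h ^ i *\<^sub>R S h x - 0 ^ i *\<^sub>R S 0 x) (at 0 within {0..1})" for i
  proof -
    have "((Q i \<circ> (\<lambda>\<tau>. \<tau> + h)) has_vector_derivative 1 *\<^sub>R (h ^ i *\<^sub>R S h x)) (at 0 within {0..1})"
    proof (rule vector_diff_chain_within)
      show "((\<lambda>\<tau>. \<tau> + h) has_vector_derivative 1) (at 0 within {0..1})"
        by (auto intro!: derivative_eq_intros)
      show "(Q i has_vector_derivative h ^ i *\<^sub>R S h x) (at (0 + h) within (\<lambda>\<tau>. \<tau> + h) ` {0..1})"
        using Q[of h i] assms by (auto intro: has_vector_derivative_within_subset)
    qed
    moreover have "(Q i has_vector_derivative 0 ^ i *\<^sub>R S 0 x) (at 0 within {0..1})"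
      using Q[of 0 i] assms by (auto intro: has_vector_derivative_within_subset)
    ultimately show ?thesis
      unfolding K_def o_def by (intro has_vector_derivative_diff) auto
  qed
  let ?y = "integral {0..h} (\<lambda>s. (\<alpha> + \<beta> * s + \<gamma> * s\<^sup>2) *\<^sub>R S s x)"
  have "S \<tau> ?y = (\<alpha> - \<beta> * \<tau> + \<gamma> * \<tau>\<^sup>2) *\<^sub>R K 0 \<tau> + (\<beta> - 2 * \<gamma> * \<tau>) *\<^sub>R K 1 \<tau> + \<gamma> *\<^sub>R K 2 \<tau>"
    if \<tau>: "\<tau> \<ge> 0" for \<tau>
  proof -
    have K_int: "((\<lambda>s. s ^ i *\<^sub>R S s x) has_integral K i \<tau>) {\<tau>..\<tau> + h}" for i
    proof -
      have int: "(\<lambda>s. s ^ i *\<^sub>R S s x) integrable_on {0..\<tau> + h}"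
        by (intro integrable_continuous_real cont)
      have "integral {0..\<tau>} (\<lambda>s. s ^ i *\<^sub>R S s x) + integral {\<tau>..\<tau> + h} (\<lambda>s. s ^ i *\<^sub>R S s x) = Q i (\<tau> + h)"
        unfolding Q_def using \<tau> assms int by (intro Henstock_Kurzweil_Integration.integral_combine) auto
      then have "integral {\<tau>..\<tau> + h} (\<lambda>s. s ^ i *\<^sub>R S s x) = K i \<tau>"
        by (simp add: K_def Q_def algebra_simps)
      moreover have "(\<lambda>s. s ^ i *\<^sub>R S s x) integrable_on {\<tau>..\<tau> + h}"
        by (rule integrable_on_subinterval[OF int]) (use \<tau> in auto)
      ultimately show ?thesis by (simp add: has_integral_iff)
    qed
    have "((\<lambda>s. (\<alpha> + \<beta> * s + \<gamma> * s\<^sup>2) *\<^sub>R S s x) has_integral ?y) {0..h}"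
      by (intro integrable_integral integrable_continuous_real continuous_intros) auto
    from has_integral_linear[OF this blinfun.bounded_linear_right[of "S \<tau>"]]
    have "((\<lambda>s. (\<alpha> + \<beta> * s + \<gamma> * s\<^sup>2) *\<^sub>R S \<tau> (S s x)) has_integral S \<tau> ?y) {0..h}"
      by (simp add: o_def blinfun.scaleR_right)
    moreover have "((\<lambda>s. (\<alpha> + \<beta> * s + \<gamma> * s\<^sup>2) *\<^sub>R S \<tau> (S s x)) has_integral
        (\<alpha> - \<beta> * \<tau> + \<gamma> * \<tau>\<^sup>2) *\<^sub>R K 0 \<tau> + (\<beta> - 2 * \<gamma> * \<tau>) *\<^sub>R K 1 \<tau> + \<gamma> *\<^sub>R K 2 \<tau>) {0..h}"
    proof -
      have "((\<lambda>s. (\<alpha> - \<beta> * \<tau> + \<gamma> * \<tau>\<^sup>2) *\<^sub>R (s ^ 0 *\<^sub>R S s x) + (\<beta> - 2 * \<gamma> * \<tau>) *\<^sub>R (s ^ 1 *\<^sub>R S s x) +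
             \<gamma> *\<^sub>R (s ^ 2 *\<^sub>R S s x)) has_integral
        (\<alpha> - \<beta> * \<tau> + \<gamma> * \<tau>\<^sup>2) *\<^sub>R K 0 \<tau> + (\<beta> - 2 * \<gamma> * \<tau>) *\<^sub>R K 1 \<tau> + \<gamma> *\<^sub>R K 2 \<tau>) {0 + \<tau>..h + \<tau>}"
        using K_int[of 0] K_int[of 1] K_int[of 2]
        by (intro has_integral_add has_integral_cmul) (simp_all add: add.commute)
      then have "((\<lambda>s. (\<alpha> - \<beta> * \<tau> + \<gamma> * \<tau>\<^sup>2) *\<^sub>R ((\<tau> + s) ^ 0 *\<^sub>R S (\<tau> + s) x) +
             (\<beta> - 2 * \<gamma> * \<tau>) *\<^sub>R ((\<tau> + s) ^ 1 *\<^sub>R S (\<tau> + s) x) +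
             \<gamma> *\<^sub>R ((\<tau> + s) ^ 2 *\<^sub>R S (\<tau> + s) x)) has_integral
        (\<alpha> - \<beta> * \<tau> + \<gamma> * \<tau>\<^sup>2) *\<^sub>R K 0 \<tau> + (\<beta> - 2 * \<gamma> * \<tau>) *\<^sub>R K 1 \<tau> + \<gamma> *\<^sub>R K 2 \<tau>) {0..h}"
        by (subst (asm) has_integral_shift_Icc_real[symmetric]) (simp add: o_def)
      then show ?thesis
      proof (rule has_integral_eq[rotated])
        fix s assume "s \<in> {0..h}"
        then have "S (\<tau> + s) x = S \<tau> (S s x)" using \<tau> by (intro semigroup_add) auto
        moreover have "(\<alpha> - \<beta> * \<tau> + \<gamma> * \<tau>\<^sup>2) * (\<tau> + s) ^ 0 + (\<beta> - 2 * \<gamma> * \<tau>) * (\<tau> + s) ^ 1 +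
             \<gamma> * (\<tau> + s) ^ 2 = \<alpha> + \<beta> * s + \<gamma> * s\<^sup>2"
          by (simp add: algebra_simps power2_eq_square)
        ultimately show "(\<alpha> - \<beta> * \<tau> + \<gamma> * \<tau>\<^sup>2) *\<^sub>R ((\<tau> + s) ^ 0 *\<^sub>R S (\<tau> + s) x) +
             (\<beta> - 2 * \<gamma> * \<tau>) *\<^sub>R ((\<tau> + s) ^ 1 *\<^sub>R S (\<tau> + s) x) +
             \<gamma> *\<^sub>R ((\<tau> + s) ^ 2 *\<^sub>R S (\<tau> + s) x) = (\<alpha> + \<beta> * s + \<gamma> * s\<^sup>2) *\<^sub>R S \<tau> (S s x)"
          by (simp only: scaleR_scaleR scaleR_add_left[symmetric])
      qed
    qed
    ultimately show ?thesis by (rule has_integral_unique)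
  qed
  moreover have "((\<lambda>\<tau>. (\<alpha> - \<beta> * \<tau> + \<gamma> * \<tau>\<^sup>2) *\<^sub>R K 0 \<tau> + (\<beta> - 2 * \<gamma> * \<tau>) *\<^sub>R K 1 \<tau> + \<gamma> *\<^sub>R K 2 \<tau>)
      has_vector_derivative
        (\<alpha> *\<^sub>R (S h x - x) - \<beta> *\<^sub>R K 0 0) + (\<beta> *\<^sub>R (h *\<^sub>R S h x) - (2 * \<gamma>) *\<^sub>R K 1 0) + \<gamma> *\<^sub>R (h\<^sup>2 *\<^sub>R S h x))
      (at 0 within {0..1})"
  proof -
    have p0: "((\<lambda>\<tau>. \<alpha> - \<beta> * \<tau> + \<gamma> * \<tau>\<^sup>2) has_field_derivative - \<beta>) (at 0 within {0..1})"
      and p1: "((\<lambda>\<tau>. \<beta> - 2 * \<gamma> * \<tau>) has_field_derivative - (2 * \<gamma>)) (at 0 within {0..1})"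
      and p2: "((\<lambda>\<tau>::real. \<gamma>) has_field_derivative 0) (at 0 within {0..1})"
      by (auto intro!: derivative_eq_intros)
    show ?thesis
      using has_vector_derivative_add[OF has_vector_derivative_add[OF
          has_vector_derivative_scaleR[OF p0 K[of 0]] has_vector_derivative_scaleR[OF p1 K[of 1]]]
          has_vector_derivative_scaleR[OF p2 K[of 2]]]
      by (simp add: algebra_simps)
  qed
  ultimately show "((\<lambda>\<tau>. S \<tau> ?y) has_vector_derivative
        (\<alpha> *\<^sub>R (S h x - x) - \<beta> *\<^sub>R K 0 0) + (\<beta> *\<^sub>R (h *\<^sub>R S h x) - (2 * \<gamma>) *\<^sub>R K 1 0) + \<gamma> *\<^sub>R (h\<^sup>2 *\<^sub>R S h x))
      (at 0 within {0..1})"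
    by (auto intro: has_vector_derivative_transform[rotated -1])
qed

text \<open>
  Means of an orbit over \<open>[0, t]\<close> lie in the domain and tend to the initial value.
\<close>

lemma domain_dense: "closure D = UNIV"
proof (intro equalityI subsetI UNIV_I)
  fix x
  define Q where "Q t = integral {0..t} (\<lambda>s. (1 + 0 * s + 0 * s\<^sup>2) *\<^sub>R S s x)" for t
  have "(Q has_vector_derivative S 0 x) (at 0 within {0..1})"
  proof -
    have "continuous_on {0..1} (\<lambda>s. S s x)" by (intro continuous_intros) auto
    from integral_has_vector_derivative[OF this, of 0] show ?thesis
      by (simp add: Q_def[abs_def])
  qed
  then have "((\<lambda>t. (1 / t) *\<^sub>R Q t) \<longlongrightarrow> x) (at_right 0)"
    by (simp add: has_vector_derivative_iff_quotient at_within_Icc_at_right Q_def)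
  moreover have "\<forall>\<^sub>F t in at_right 0. (1 / t) *\<^sub>R Q t \<in> closure D"
  proof (rule eventually_at_right_less[THEN eventually_mono])
    fix t :: real assume "0 < t"
    then show "(1 / t) *\<^sub>R Q t \<in> closure D"
      unfolding Q_def by (intro subsetD[OF closure_subset] generator_scaleR[THEN conjunct1]
        weighted_integral_in_domain) auto
  qed
  ultimately show "x \<in> closure D"
    by (intro Lim_in_closed_set[OF closed_closure _ trivial_limit_at_right_real])
qed

end

text \<open>
  For \<open>x\<close> in the domain the function \<open>S (t - s) (P s x)\<close> of \<open>s\<close> has derivative \<open>0\<close>; the rest is density.
\<close>

lemma semigroup_of_generator_unique:
  fixes S P :: "real \<Rightarrow> 'a::banach \<Rightarrow>\<^sub>L 'a"
  assumes "semigroup_generator S D A" "semigroup_generator P D A" "t \<ge> 0"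
  shows "S t = P t"
proof (rule blinfun_eqI)
  interpret S: generated_semigroup S D A by unfold_locales fact
  interpret P: generated_semigroup P D A by unfold_locales fact
  have *: "S t x = P t x" if "x \<in> D" for x
  proof -
    have "((\<lambda>s. S (t - s) (P s (A x) - A (P s x))) has_integral (P t x - S (t - 0) (P 0 x))) {0..t}"
      using assms that P.semigroup_domain
      by (intro S.variation_of_constants has_vector_derivative_within_subset[OF P.orbit_has_vector_derivative]) auto
    moreover have "((\<lambda>s. S (t - s) (P s (A x) - A (P s x))) has_integral 0) {0..t}"
      using P.semigroup_domain that by (intro has_integral_is_0) auto
    ultimately show ?thesis by (auto dest: has_integral_unique)
  qed
  fix x
  have "closed {x. S t x = P t x}" by (intro closed_Collect_eq continuous_intros)
  then have "closure D \<subseteq> {x. S t x = P t x}" using * by (intro closure_minimal) auto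
  then show "S t x = P t x" using S.domain_dense by auto
qed

text \<open>
  The supremum of \<open>exp(-wt) \<parallel>S t x\<parallel>\<close> over \<open>t \<ge> 0\<close>: applying \<open>S t\<close> shifts the orbit and can lower the
  supremum only, up to the factor \<open>exp(wt)\<close>. In this norm the growth bound has no constant in
  front, so that it survives the multiplication of many such operators.
\<close>

lemma (in generated_semigroup) quasi_contractive_norm:
  obtains M w :: real and N :: "'a \<Rightarrow> real" where "M \<ge> 1" "w \<ge> 0"
    "\<And>x. norm x \<le> N x" "\<And>x. N x \<le> M * norm x" "\<And>x y. N (x + y) \<le> N x + N y"
    "\<And>t x. t \<ge> 0 \<Longrightarrow> N (S t x) \<le> exp (w * t) * N x"
proof -
  obtain M w where M: "M \<ge> 1" "w \<ge> 0" "\<And>t. t \<ge> 0 \<Longrightarrow> norm (S t) \<le> M * exp (w * t)"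
    using exponential_bound by blast
  define N where "N x = (SUP t\<in>{0..}. exp (- w * t) * norm (S t x))" for x
  have term_le: "exp (- w * t) * norm (S t x) \<le> M * norm x" if "t \<ge> 0" for t x
  proof -
    have "exp (- w * t) * norm (S t x) \<le> exp (- w * t) * (M * exp (w * t) * norm x)"
      by (intro mult_left_mono norm_blinfun_le M that) auto
    also have "\<dots> = M * norm x * (exp (- w * t) * exp (w * t))" by (simp only: mult_ac)
    also have "\<dots> = M * norm x" by (simp flip: exp_add)
    finally show ?thesis .
  qed
  have bdd: "bdd_above ((\<lambda>t. exp (- w * t) * norm (S t x)) ` {0..})" for x
    using term_le by (auto simp: bdd_above_def)
  have upper: "exp (- w * t) * norm (S t x) \<le> N x" if "t \<ge> 0" for t x
    unfolding N_def using that by (intro cSUP_upper bdd) auto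
  show ?thesis
  proof (rule that[of M w N])
    fix x y
    show "norm x \<le> N x" using upper[of 0 x] by simp
    show "N x \<le> M * norm x" unfolding N_def by (intro cSUP_least term_le) auto
    show "N (x + y) \<le> N x + N y"
      unfolding N_def[of "x + y"]
    proof (rule cSUP_least)
      fix t :: real assume "t \<in> {0..}"
      then have "t \<ge> 0" by simp
      have "exp (- w * t) * norm (S t (x + y)) \<le> exp (- w * t) * (norm (S t x) + norm (S t y))"
        by (intro mult_left_mono) (auto simp: blinfun.add_right norm_triangle_ineq)
      then show "exp (- w * t) * norm (S t (x + y)) \<le> N x + N y"
        using upper[OF \<open>t \<ge> 0\<close>, of x] upper[OF \<open>t \<ge> 0\<close>, of y] by (simp add: distrib_left)
    qed simp
  next
    fix t x assume t: "(t::real) \<ge> 0"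
    show "N (S t x) \<le> exp (w * t) * N x"
      unfolding N_def[of "S t x"]
    proof (rule cSUP_least)
      fix s :: real assume s: "s \<in> {0..}"
      have "exp (- w * s) * norm (S s (S t x)) = exp (w * t) * (exp (- w * (s + t)) * norm (S (s + t) x))"
        using s t by (simp add: semigroup_add algebra_simps flip: exp_add)
      also have "\<dots> \<le> exp (w * t) * N x" using s t by (intro mult_left_mono upper) auto
      finally show "exp (- w * s) * norm (S s (S t x)) \<le> exp (w * t) * N x" .
    qed simp
  qed (use M in auto)
qed

section \<open>Bounded perturbations of a generator\<close>

text \<open>
  If the difference quotients of two semigroups differ by a convergent term, then one converges
  exactly when the other does, so that the domains agree. This serves both for rescaling and for
  bounded perturbations.
\<close>

lemma (in generated_semigroup) generator_perturbI:
  assumes P: "C0_semigroup P"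
    and C: "\<And>x. ((\<lambda>t. (1 / t) *\<^sub>R (P t x - S t x)) \<longlongrightarrow> C x) (at_right 0)"
  shows "semigroup_generator P D (\<lambda>x. A x + C x)"
proof -
  have eq: "(1 / t) *\<^sub>R (P t x - x) = (1 / t) *\<^sub>R (S t x - x) + (1 / t) *\<^sub>R (P t x - S t x)"
    and eq': "(1 / t) *\<^sub>R (S t x - x) = (1 / t) *\<^sub>R (P t x - x) - (1 / t) *\<^sub>R (P t x - S t x)" for t x
    by (simp_all add: algebra_simps)
  have to: "((\<lambda>t. (1 / t) *\<^sub>R (P t x - x)) \<longlongrightarrow> y + C x) (at_right 0)"
    if "((\<lambda>t. (1 / t) *\<^sub>R (S t x - x)) \<longlongrightarrow> y) (at_right 0)" for x y
    unfolding eq by (intro tendsto_add that C)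
  have from_P: "((\<lambda>t. (1 / t) *\<^sub>R (S t x - x)) \<longlongrightarrow> y - C x) (at_right 0)"
    if "((\<lambda>t. (1 / t) *\<^sub>R (P t x - x)) \<longlongrightarrow> y) (at_right 0)" for x y
    unfolding eq' by (intro tendsto_diff that C)
  have "D = {x. \<exists>y. ((\<lambda>t. (1 / t) *\<^sub>R (P t x - x)) \<longlongrightarrow> y) (at_right 0)}"
    unfolding mem_domain_iff set_eq_iff mem_Collect_eq using to from_P by blast
  then show ?thesis
    using P to generator_tendsto by (auto simp: semigroup_generator_def)
qed

lemma (in generated_semigroup) semigroup_generator_rescale:
  "semigroup_generator (\<lambda>t. exp (c * t) *\<^sub>R S t) D (\<lambda>x. A x + c *\<^sub>R x)"
proof (rule generator_perturbI)
  have lim: "((\<lambda>t. exp (c * t)) \<longlongrightarrow> exp (c * 0)) (at_right 0)"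
    by (intro tendsto_intros)
  show "C0_semigroup (\<lambda>t. exp (c * t) *\<^sub>R S t)"
    unfolding C0_semigroup_def
  proof (intro conjI allI impI)
    fix s t :: real assume "s \<ge> 0" "t \<ge> 0"
    then show "exp (c * (s + t)) *\<^sub>R S (s + t) = exp (c * s) *\<^sub>R S s o\<^sub>L exp (c * t) *\<^sub>R S t"
      by (intro blinfun_eqI)
        (simp add: blinfun.scaleR_left blinfun.scaleR_right semigroup_add exp_add distrib_left)
  next
    fix x
    show "((\<lambda>t. (exp (c * t) *\<^sub>R S t) x) \<longlongrightarrow> x) (at_right 0)"
      using tendsto_scaleR[OF lim semigroup_at_0[of x]] by (simp add: blinfun.scaleR_left)
  qed simp
  fix x
  have "((\<lambda>t. exp (c * t)) has_field_derivative c) (at 0 within {0..1})"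
    by (auto intro!: derivative_eq_intros)
  then have "((\<lambda>t. (exp (c * t) - 1) / t) \<longlongrightarrow> c) (at_right 0)"
    by (simp add: has_field_derivative_iff at_within_Icc_at_right)
  from tendsto_scaleR[OF this semigroup_at_0[of x]]
  show "((\<lambda>t. (1 / t) *\<^sub>R ((exp (c * t) *\<^sub>R S t) x - S t x)) \<longlongrightarrow> c *\<^sub>R x) (at_right 0)"
    by (simp add: blinfun.scaleR_left algebra_simps diff_divide_distrib)
qed

text \<open>
  The smallness condition makes the Volterra operator of the perturbation \<open>B\<close> a contraction with
  factor \<open>1/2\<close> for the supremum norm on the half line. Rescaling reduces the general case to this one.
\<close>

locale decaying_semigroup = generated_semigroup S D A
  for S :: "real \<Rightarrow> 'a::banach \<Rightarrow>\<^sub>L 'a" and D A +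
  fixes M a :: real and B :: "'a \<Rightarrow>\<^sub>L 'a"
  assumes decay: "\<And>t. t \<ge> 0 \<Longrightarrow> norm (S t) \<le> M * exp (- a * t)"
    and M: "M \<ge> 1" and a: "a > 0" and small: "M * norm B \<le> a / 2"
begin

lemma norm_semigroup_le:
  assumes "t \<ge> 0" shows "norm (S t) \<le> M"
proof -
  have "M * exp (- a * t) \<le> M * 1" using M a assms by (intro mult_left_mono) auto
  then show ?thesis using decay[OF assms] by simp
qed

definition volterra :: "(real \<Rightarrow> 'a) \<Rightarrow> real \<Rightarrow> 'a" where
  "volterra f t = integral {0..t} (\<lambda>s. S (t - s) (B (f s)))"

lemma volterra_integrable:
  assumes "continuous_on {0..} f"
  shows "(\<lambda>s. S (t - s) (B (f s))) integrable_on {0..t}"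
  by (intro integrable_continuous_real continuous_intros continuous_on_subset[OF assms]) auto

text \<open>
  Transformation to a fixed interval, on which the integrand depends continuously on the parameter
  \<open>t\<close>. It yields continuity of the Volterra operator and the derivative at \<open>0\<close> of the perturbed orbits.
\<close>

lemma volterra_rescaled:
  assumes "continuous_on {0..} f" "t \<ge> 0"
  shows "volterra f t = t *\<^sub>R integral {0..1} (\<lambda>\<theta>. S (t * (1 - \<theta>)) (B (f (t * \<theta>))))"
proof (cases "t = 0")
  case False
  then have t: "t > 0" using assms by simp
  have "((\<lambda>s. S (t - s) (B (f s))) has_integral volterra f t) {0..t}"
    unfolding volterra_def by (intro integrable_integral volterra_integrable assms)
  from has_integral_stretch_real[OF this False]
  have "((\<lambda>\<theta>. S (t - t * \<theta>) (B (f (t * \<theta>)))) has_integral (1 / t) *\<^sub>R volterra f t) {0..1}"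
    using t by (simp add: image_divide_atLeastAtMost)
  then have "integral {0..1} (\<lambda>\<theta>. S (t * (1 - \<theta>)) (B (f (t * \<theta>)))) = (1 / t) *\<^sub>R volterra f t"
    by (simp add: has_integral_iff algebra_simps)
  then show ?thesis using t by simp
qed (simp add: volterra_def)

lemma continuous_on_rescaled_integral:
  assumes "continuous_on {0..} f"
  shows "continuous_on {0..} (\<lambda>t. integral {0..1} (\<lambda>\<theta>. S (t * (1 - \<theta>)) (B (f (t * \<theta>)))))"
proof -
  have "continuous_on ({0..} \<times> cbox 0 1) (\<lambda>(t, \<theta>). S (t * (1 - \<theta>)) (B (f (t * \<theta>))))"
    unfolding split_beta
    by (intro continuous_intros continuous_on_compose2[OF assms]) (auto intro!: mult_nonneg_nonneg)
  from integral_continuous_on_param[OF this] show ?thesis by simp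
qed

lemma continuous_on_volterra:
  assumes "continuous_on {0..} f"
  shows "continuous_on {0..} (volterra f)"
  using continuous_on_scaleR[OF continuous_on_id continuous_on_rescaled_integral[OF assms]]
  by (rule continuous_on_eq) (simp add: volterra_rescaled assms)

text \<open>
  The kernel \<open>M \<parallel>B\<parallel> exp(-a(t - s))\<close> has integral at most \<open>M \<parallel>B\<parallel> / a \<le> 1/2\<close>.
\<close>

lemma norm_volterra_le:
  assumes "continuous_on {0..} f" "\<And>s. s \<ge> 0 \<Longrightarrow> norm (f s) \<le> c" "t \<ge> 0"
  shows "norm (volterra f t) \<le> c / 2"
proof -
  have c: "c \<ge> 0" using assms(2)[of 0] norm_ge_zero order_trans by blast
  define K where "K = M * norm B * c"
  have K: "K \<ge> 0" "K \<le> a / 2 * c"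
    using M c mult_right_mono[OF small c] by (auto simp: K_def)
  have E: "((\<lambda>s. K * exp (- a * (t - s))) has_integral (K * (exp (- a * (t - t)) / a) - K * (exp (- a * (t - 0)) / a))) {0..t}"
    using assms(3) a
    by (intro fundamental_theorem_of_calculus)
      (auto intro!: derivative_eq_intros simp: has_real_derivative_iff_has_vector_derivative[symmetric])
  have "norm (volterra f t) \<le> integral {0..t} (\<lambda>s. K * exp (- a * (t - s)))"
    unfolding volterra_def
  proof (rule integral_norm_bound_integral[OF volterra_integrable])
    show "(\<lambda>s. K * exp (- a * (t - s))) integrable_on {0..t}"
      using E by blast
    fix s assume s: "s \<in> {0..t}"
    have "norm (S (t - s) (B (f s))) \<le> (M * exp (- a * (t - s))) * (norm B * c)"
      using s assms(2)[of s] M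
      by (intro order_trans[OF norm_blinfun] mult_mono decay order_trans[OF norm_blinfun]) auto
    then show "norm (S (t - s) (B (f s))) \<le> K * exp (- a * (t - s))"
      by (simp add: K_def mult_ac)
  qed (rule assms)
  also have "\<dots> = K / a * (1 - exp (- a * t))"
    using E by (simp add: has_integral_iff algebra_simps)
  also have "\<dots> \<le> K / a" using K a by (intro mult_left_le) auto
  also have "\<dots> \<le> c / 2" using K a by (simp add: field_simps)
  finally show ?thesis .
qed

lemma volterra_diff:
  assumes "continuous_on {0..} f" "continuous_on {0..} g"
  shows "volterra (\<lambda>s. f s - g s) t = volterra f t - volterra g t"
  unfolding volterra_def blinfun.diff_right
  by (intro Henstock_Kurzweil_Integration.integral_diff volterra_integrable assms)

lemma volterra_add:
  assumes "continuous_on {0..} f" "continuous_on {0..} g"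
  shows "volterra (\<lambda>s. f s + g s) t = volterra f t + volterra g t"
  unfolding volterra_def blinfun.add_right
  by (intro Henstock_Kurzweil_Integration.integral_add volterra_integrable assms)

lemma volterra_scaleR: "volterra (\<lambda>s. c *\<^sub>R f s) t = c *\<^sub>R volterra f t"
  unfolding volterra_def blinfun.scaleR_right by simp

text \<open>
  The only estimate behind the perturbation theorem. With \<open>k = 0\<close> it gives uniqueness for the
  Volterra equation, hence linearity in the initial value and the semigroup law; with
  \<open>k = M \<parallel>x\<parallel>\<close> it bounds the perturbed semigroup.
\<close>

lemma volterra_apriori_bound:
  assumes f: "continuous_on {0..} f" "bounded (f ` {0..})"
    and k: "\<And>t. t \<ge> 0 \<Longrightarrow> norm (f t - volterra f t) \<le> k" and t: "t \<ge> 0"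
  shows "norm (f t) \<le> 2 * k"
proof -
  define c where "c = (SUP t\<in>{0..}. norm (f t))"
  have bdd: "bdd_above ((\<lambda>t. norm (f t)) ` {0..})"
    using f(2) by (auto simp: bounded_iff bdd_above_def)
  have c: "norm (f s) \<le> c" if "s \<ge> 0" for s
    unfolding c_def using that by (intro cSUP_upper bdd) auto
  have "norm (f s) \<le> k + c / 2" if "s \<ge> 0" for s
    using norm_triangle_ineq[of "f s - volterra f s" "volterra f s"] k[OF that] norm_volterra_le[OF f(1) c that]
    by simp
  then have "c \<le> k + c / 2"
    unfolding c_def by (intro cSUP_least) (auto simp: c_def)
  then show ?thesis using c[OF t] by simp
qed

lemma volterra_unique:
  assumes "continuous_on {0..} f" "bounded (f ` {0..})" "\<And>t. t \<ge> 0 \<Longrightarrow> f t = h t + volterra f t"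
    and "continuous_on {0..} g" "bounded (g ` {0..})" "\<And>t. t \<ge> 0 \<Longrightarrow> g t = h t + volterra g t"
    and "t \<ge> 0"
  shows "f t = g t"
proof -
  have "norm (f t - g t) \<le> 2 * 0"
  proof (rule volterra_apriori_bound)
    fix s :: real assume s: "s \<ge> 0"
    have "f s - g s - volterra (\<lambda>s. f s - g s) s = (h s + volterra f s) - (h s + volterra g s) - (volterra f s - volterra g s)"
      using assms(3)[OF s] assms(6)[OF s] volterra_diff[OF assms(1,4)] by simp
    then show "norm (f s - g s - volterra (\<lambda>s. f s - g s) s) \<le> 0" by simp
  qed (intro continuous_intros bounded_minus_comp assms)+
  then show ?thesis by simp
qed

text \<open>
  Banach's fixed point theorem in the space of bounded continuous functions on the real line, to
  which functions on the half line are extended by their value at \<open>0\<close>.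
\<close>

lemma volterra_exists:
  "\<exists>f. continuous_on {0..} f \<and> bounded (f ` {0..}) \<and> (\<forall>t\<ge>0. f t = S t x + volterra f t)"
proof -
  define F where "F f t = S (max t 0) x + volterra (apply_bcontfun f) (max t 0)" for f t
  have cont: "continuous_on {0..} (apply_bcontfun f)" for f :: "real \<Rightarrow>\<^sub>C 'a" by simp
  have "F f \<in> bcontfun" for f
  proof (rule bcontfun_normI)
    show "continuous_on UNIV (F f)" unfolding F_def
      by (intro continuous_intros continuous_on_compose2[OF continuous_on_volterra[OF cont]]) auto
    fix t
    have "norm (S (max t 0) x) \<le> M * norm x"
      by (intro norm_blinfun_le norm_semigroup_le) simp
    moreover have "norm (volterra f (max t 0)) \<le> norm f / 2"
      by (intro norm_volterra_le cont norm_bounded) auto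
    ultimately show "norm (F f t) \<le> M * norm x + norm f / 2"
      unfolding F_def by (intro order_trans[OF norm_triangle_ineq] add_mono)
  qed
  then have F: "apply_bcontfun (Bcontfun (F f)) = F f" for f
    by (simp add: Bcontfun_inverse)
  have "dist (Bcontfun (F f)) (Bcontfun (F g)) \<le> 1 / 2 * dist f g" for f g
  proof (rule dist_bound)
    fix t
    have "norm (volterra (\<lambda>s. f s - g s) (max t 0)) \<le> dist f g / 2"
      by (intro norm_volterra_le continuous_intros cont) (auto simp: dist_bounded dist_norm[symmetric])
    then show "dist (Bcontfun (F f) t) (Bcontfun (F g) t) \<le> 1 / 2 * dist f g"
      by (simp add: F) (simp add: F_def dist_norm volterra_diff)
  qed
  then have "\<exists>!f. Bcontfun (F f) = f"
    by (intro banach_fix_type[of "1/2"]) auto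
  then obtain f where "Bcontfun (F f) = f" by blast
  then have "apply_bcontfun f t = F f t" for t using F[of f] by simp
  then have "\<forall>t\<ge>0. apply_bcontfun f t = S t x + volterra f t"
    by (simp add: F_def)
  moreover have "bounded (apply_bcontfun f ` {0..})"
    by (rule bounded_subset[OF bounded_apply_bcontfun]) auto
  ultimately show ?thesis using cont by blast
qed

definition solution :: "'a \<Rightarrow> real \<Rightarrow> 'a" where
  "solution x = (SOME f. continuous_on {0..} f \<and> bounded (f ` {0..}) \<and> (\<forall>t\<ge>0. f t = S t x + volterra f t))"

lemma solution: "continuous_on {0..} (solution x)" "bounded (solution x ` {0..})" "t \<ge> 0 \<Longrightarrow> solution x t = S t x + volterra (solution x) t"
  using someI_ex[OF volterra_exists[of x]] unfolding solution_def by blast+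

lemma norm_solution_le:
  assumes "t \<ge> 0" shows "norm (solution x t) \<le> 2 * M * norm x"
proof -
  have "norm (solution x t) \<le> 2 * (M * norm x)"
  proof (rule volterra_apriori_bound[OF solution(1,2) _ assms])
    fix t :: real assume t: "t \<ge> 0"
    show "norm (solution x t - volterra (solution x) t) \<le> M * norm x"
      using solution(3)[OF t, of x] norm_blinfun_le[OF norm_semigroup_le[OF t], of x] by simp
  qed
  then show ?thesis by simp
qed

lemma solution_add: assumes "t \<ge> 0" shows "solution (x + y) t = solution x t + solution y t"
proof (rule volterra_unique[OF solution])
  show "continuous_on {0..} (\<lambda>t. solution x t + solution y t)" by (intro continuous_intros solution)
  show "bounded ((\<lambda>t. solution x t + solution y t) ` {0..})" by (intro bounded_plus_comp solution)
  fix t :: real assume "t \<ge> 0"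
  from solution(3)[OF this, of x] solution(3)[OF this, of y]
  show "solution x t + solution y t = S t (x + y) + volterra (\<lambda>t. solution x t + solution y t) t"
    by (simp add: volterra_add solution blinfun.add_right)
qed (use assms in auto)

lemma solution_scaleR: assumes "t \<ge> 0" shows "solution (c *\<^sub>R x) t = c *\<^sub>R solution x t"
proof (rule volterra_unique[OF solution])
  show "continuous_on {0..} (\<lambda>t. c *\<^sub>R solution x t)" by (intro continuous_intros solution)
  show "bounded ((\<lambda>t. c *\<^sub>R solution x t) ` {0..})" by (intro bounded_scaleR_comp solution)
  fix t :: real assume "t \<ge> 0"
  from solution(3)[OF this, of x]
  show "c *\<^sub>R solution x t = S t (c *\<^sub>R x) + volterra (\<lambda>t. c *\<^sub>R solution x t) t"
    by (simp add: volterra_scaleR blinfun.scaleR_right scaleR_add_right[symmetric])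
qed (use assms in auto)

text \<open>
  Both sides solve the Volterra equation with initial value \<open>solution x r\<close>: splitting the integral
  over \<open>[0, t + r]\<close> at \<open>r\<close> turns the first part into \<open>S t\<close> applied to the integral up to \<open>r\<close>.
\<close>

lemma solution_semigroup:
  assumes r: "r \<ge> 0" and t: "t \<ge> 0"
  shows "solution x (t + r) = solution (solution x r) t"
proof (rule volterra_unique[OF _ _ _ solution])
  have Wr: "continuous_on {0..} (\<lambda>t. solution x (t + r))"
    by (intro continuous_on_compose2[OF solution(1)] continuous_intros) (use r in auto)
  then show "continuous_on {0..} (\<lambda>t. solution x (t + r))" .
  show "bounded ((\<lambda>t. solution x (t + r)) ` {0..})"
    by (rule bounded_subset[OF solution(2)[of x]]) (use r in auto)
  fix t :: real assume t: "t \<ge> 0"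
  let ?F = "\<lambda>s. S (t + r - s) (B (solution x s))"
  have int: "?F integrable_on {0..t + r}" by (rule volterra_integrable[OF solution(1)])
  have "integral {0..r} ?F + integral {r..t + r} ?F = volterra (solution x) (t + r)"
    unfolding volterra_def using r t int by (intro Henstock_Kurzweil_Integration.integral_combine) auto
  moreover have "integral {0..r} ?F = S t (volterra (solution x) r)"
  proof -
    have "S t (volterra (solution x) r) = integral {0..r} (\<lambda>s. S t (S (r - s) (B (solution x s))))"
      unfolding volterra_def
      using integral_linear[OF volterra_integrable[OF solution(1)] blinfun.bounded_linear_right[of "S t"], of r x]
      by (simp add: o_def)
    also have "\<dots> = integral {0..r} ?F"
    proof (rule integral_cong)
      fix s assume "s \<in> {0..r}"
      then show "S t (S (r - s) (B (solution x s))) = ?F s"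
        using semigroup_add[of t "r - s" "B (solution x s)"] t by (simp add: algebra_simps)
    qed
    finally show ?thesis ..
  qed
  moreover have "integral {r..t + r} ?F = volterra (\<lambda>s. solution x (s + r)) t"
  proof -
    have "(?F has_integral integral {r..t + r} ?F) {0 + r..t + r}"
      using integrable_on_subinterval[OF int, of r "t + r"] r by (simp add: integrable_integral)
    then have "((\<lambda>s. S (t - s) (B (solution x (s + r)))) has_integral integral {r..t + r} ?F) {0..t}"
      by (subst (asm) has_integral_shift_Icc_real[symmetric]) (simp add: o_def algebra_simps)
    then show ?thesis by (simp add: volterra_def has_integral_iff)
  qed
  ultimately have "volterra (solution x) (t + r) = S t (volterra (solution x) r) + volterra (\<lambda>s. solution x (s + r)) t" by simp
  then show "solution x (t + r) = S t (solution x r) + volterra (\<lambda>s. solution x (s + r)) t"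
    using solution(3)[of "t + r" x] solution(3)[of r x] r t
    by (simp add: semigroup_add blinfun.add_right)
qed (use t in auto)

text \<open>
  Continued to negative times by the value at \<open>0\<close>, so that it is a bounded operator at every time.
\<close>

definition perturbed :: "real \<Rightarrow> 'a \<Rightarrow>\<^sub>L 'a" where
  "perturbed t = Blinfun (\<lambda>x. solution x (max t 0))"

lemma perturbed_apply: assumes "t \<ge> 0" shows "perturbed t x = solution x t"
proof -
  have "bounded_linear (\<lambda>x. solution x t)"
    by (rule bounded_linear_intro[where K="2 * M"])
      (use assms solution_add solution_scaleR norm_solution_le in \<open>auto simp: mult_ac\<close>)
  then show ?thesis using assms by (simp add: perturbed_def bounded_linear_Blinfun_apply)
qed

text \<open>
  By the Volterra equation the difference quotients of the two semigroups differ by the mean of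
  \<open>S (t - s) (B (solution x s))\<close> over \<open>[0, t]\<close>, which tends to \<open>B x\<close>.
\<close>

lemma perturbed_generator: "semigroup_generator perturbed D (\<lambda>x. A x + B x)"
proof (rule generator_perturbI)
  have solution_0: "solution x 0 = x" for x using solution(3)[of 0 x] by (simp add: volterra_def)
  have solution_at_0: "(solution x \<longlongrightarrow> x) (at_right 0)" for x
    using solution(1)[of x] solution_0[of x]
    by (auto simp: continuous_on_def at_within_Ici_at_right dest: bspec[of _ _ 0])
  show "C0_semigroup perturbed"
    unfolding C0_semigroup_def
  proof (intro conjI allI impI)
    show "perturbed 0 = id_blinfun" by (rule blinfun_eqI) (simp add: perturbed_apply solution_0)
    fix s t :: real assume "s \<ge> 0" "t \<ge> 0"
    then show "perturbed (s + t) = perturbed s o\<^sub>L perturbed t"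
      by (intro blinfun_eqI) (simp add: perturbed_apply solution_semigroup)
  next
    fix x
    show "((\<lambda>t. perturbed t x) \<longlongrightarrow> x) (at_right 0)"
      using solution_at_0[of x]
      by (rule Lim_transform_eventually)
        (auto intro: eventually_at_right_less[THEN eventually_mono] simp: perturbed_apply)
  qed
  fix x
  let ?I = "\<lambda>t. integral {0..1} (\<lambda>\<theta>. S (t * (1 - \<theta>)) (B (solution x (t * \<theta>))))"
  have "(?I \<longlongrightarrow> ?I 0) (at 0 within {0..})"
    using continuous_on_rescaled_integral[OF solution(1)[of x]] unfolding continuous_on_def by (auto dest: bspec[of _ _ 0])
  then have "(?I \<longlongrightarrow> B x) (at_right 0)"
    by (simp add: at_within_Ici_at_right solution_0)
  then show "((\<lambda>t. (1 / t) *\<^sub>R (perturbed t x - S t x)) \<longlongrightarrow> B x) (at_right 0)"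
  proof (rule Lim_transform_eventually)
    show "\<forall>\<^sub>F t in at_right 0. ?I t = (1 / t) *\<^sub>R (perturbed t x - S t x)"
    proof (rule eventually_at_right_less[THEN eventually_mono])
      fix t :: real assume t: "0 < t"
      then show "?I t = (1 / t) *\<^sub>R (perturbed t x - S t x)"
        using solution(3)[of t x] volterra_rescaled[OF solution(1)[of x], of t] by (simp add: perturbed_apply)
    qed
  qed
qed

end

text \<open>
  The bound \<open>M\<close> depends on \<open>B\<close> only through \<open>\<beta>\<close>; this uniformity over all Jacobians in the strip is
  why \<open>B\<close> is quantified after \<open>M\<close>.
\<close>

lemma bounded_perturbation:
  fixes S :: "real \<Rightarrow> 'a::banach \<Rightarrow>\<^sub>L 'a"
  assumes "semigroup_generator S D A"
  shows "\<exists>M\<ge>1. \<forall>B. norm B \<le> \<beta> \<longrightarrow>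
    (\<exists>P. semigroup_generator P D (\<lambda>x. A x + blinfun_apply B x) \<and> (\<forall>t\<in>{0..T}. norm (P t) \<le> M))"
proof -
  interpret generated_semigroup S D A by unfold_locales fact
  obtain M w where M: "M \<ge> 1" "w \<ge> 0" "\<And>t. t \<ge> 0 \<Longrightarrow> norm (S t) \<le> M * exp (w * t)"
    using exponential_bound by blast
  \<comment> \<open>The decay \<open>a\<close> is chosen to meet the smallness condition for all \<open>B\<close> at once; adding \<open>1\<close>
    keeps it positive for \<open>\<beta> = 0\<close>.\<close>
  define a where "a = 2 * M * \<bar>\<beta>\<bar> + 1"
  define c where "c = w + a"
  have a: "a > 0" "M * \<bar>\<beta>\<bar> \<le> a / 2" using M by (auto simp: a_def intro: add_nonneg_pos)
  have c: "c \<ge> 0" using M a by (simp add: c_def)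
  have "\<exists>P. semigroup_generator P D (\<lambda>x. A x + B x) \<and> (\<forall>t\<in>{0..T}. norm (P t) \<le> exp (c * T) * (2 * M))"
    if B: "norm B \<le> \<beta>" for B :: "'a \<Rightarrow>\<^sub>L 'a"
  proof -
    interpret R: decaying_semigroup "\<lambda>t. exp (- c * t) *\<^sub>R S t" D "\<lambda>x. A x + (- c) *\<^sub>R x" M a B
    proof
      show "semigroup_generator (\<lambda>t. exp (- c * t) *\<^sub>R S t) D (\<lambda>x. A x + (- c) *\<^sub>R x)"
        by (rule semigroup_generator_rescale)
      show "norm (exp (- c * t) *\<^sub>R S t) \<le> M * exp (- a * t)" if "t \<ge> 0" for t
      proof -
        have "norm (exp (- c * t) *\<^sub>R S t) \<le> exp (- c * t) * (M * exp (w * t))"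
          using M(3)[OF that] by simp
        also have "\<dots> = M * exp (- a * t)"
          by (simp add: c_def exp_add[symmetric] algebra_simps)
        finally show ?thesis .
      qed
      show "M * norm B \<le> a / 2"
        using a M B mult_left_mono[of "norm B" "\<bar>\<beta>\<bar>" M] by linarith
    qed (use M a in auto)
    interpret P: generated_semigroup R.perturbed D "\<lambda>x. A x + (- c) *\<^sub>R x + B x"
      by unfold_locales (rule R.perturbed_generator)
    have "semigroup_generator (\<lambda>t. exp (c * t) *\<^sub>R R.perturbed t) D (\<lambda>x. A x + B x)"
      using P.semigroup_generator_rescale[of c] by (simp add: algebra_simps)
    moreover have "norm (exp (c * t) *\<^sub>R R.perturbed t) \<le> exp (c * T) * (2 * M)" if t: "t \<in> {0..T}" for t
    proof -
      have "norm (R.perturbed t) \<le> 2 * M"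
        by (rule norm_blinfun_bound) (use M t R.perturbed_apply R.norm_solution_le in auto)
      moreover have "exp (c * t) \<le> exp (c * T)" using t c by (simp add: mult_left_mono)
      ultimately show ?thesis by (auto intro: mult_mono)
    qed
    ultimately show ?thesis by blast
  qed
  then show ?thesis
    by (intro exI[of _ "max 1 (exp (c * T) * (2 * M))"]) (simp add: le_max_iff_disj, metis)
qed

lemma semigroup_generator_exp_op:
  assumes "semigroup_generator S D A" shows "semigroup_generator (exp_op D A) D A"
  unfolding exp_op_def using someI_ex[of "\<lambda>S. semigroup_generator S D A"] assms by blast

lemma perturbed_exp_op:
  fixes A :: "'a::banach \<Rightarrow> 'a"
  assumes "semigroup_generator S D A"
  obtains M where "M \<ge> 1"
    "\<And>B. norm B \<le> \<beta> \<Longrightarrow> semigroup_generator (exp_op D (\<lambda>x. A x + blinfun_apply B x)) D (\<lambda>x. A x + B x)"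
    "\<And>B t. norm B \<le> \<beta> \<Longrightarrow> 0 \<le> t \<Longrightarrow> t \<le> T \<Longrightarrow> norm (exp_op D (\<lambda>x. A x + blinfun_apply B x) t) \<le> M"
proof -
  obtain M where M: "M \<ge> 1" "\<And>B. norm B \<le> \<beta> \<Longrightarrow> \<exists>P. semigroup_generator P D (\<lambda>x. A x + blinfun_apply B x) \<and>
      (\<forall>t\<in>{0..T}. norm (P t) \<le> M)"
    using bounded_perturbation[OF assms] by blast
  show ?thesis
  proof (rule that[OF M(1)])
    fix B :: "'a \<Rightarrow>\<^sub>L 'a" assume "norm B \<le> \<beta>"
    then obtain P where P: "semigroup_generator P D (\<lambda>x. A x + B x)" "\<And>t. t \<in> {0..T} \<Longrightarrow> norm (P t) \<le> M"
      using M by blast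
    show gen: "semigroup_generator (exp_op D (\<lambda>x. A x + B x)) D (\<lambda>x. A x + B x)"
      using semigroup_generator_exp_op[OF P(1)] .
    show "norm (exp_op D (\<lambda>x. A x + B x) t) \<le> M" if "0 \<le> t" "t \<le> T" for t
      using semigroup_of_generator_unique[OF gen P(1), of t] P(2)[of t] that by simp
  qed
qed

text \<open>
  Duhamel's formula: on the domain, \<open>P t x - S t x\<close> is the integral of
  \<open>S (t - s) ((C - B) (P s x))\<close> over \<open>[0, t]\<close>. The estimate extends to all \<open>x\<close> by density.
\<close>

lemma semigroup_difference_le:
  fixes B C :: "'a::banach \<Rightarrow>\<^sub>L 'a"
  assumes S: "semigroup_generator S D (\<lambda>x. A x + B x)" and P: "semigroup_generator P D (\<lambda>x. A x + C x)"
    and M: "\<And>s. s \<in> {0..t} \<Longrightarrow> norm (S s) \<le> M" "\<And>s. s \<in> {0..t} \<Longrightarrow> norm (P s) \<le> M" and t: "t \<ge> 0"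
  shows "norm (P t x - S t x) \<le> M\<^sup>2 * t * norm (C - B) * norm x"
proof -
  interpret S: generated_semigroup S D "\<lambda>x. A x + B x" by unfold_locales fact
  interpret P: generated_semigroup P D "\<lambda>x. A x + C x" by unfold_locales fact
  have M0: "M \<ge> 0" using order_trans[OF norm_ge_zero M(1)[of 0]] t by simp
  have *: "norm (P t x - S t x) \<le> M\<^sup>2 * t * norm (C - B) * norm x" if x: "x \<in> D" for x
  proof -
    have "((\<lambda>s. S (t - s) (P s (A x + C x) - (A (P s x) + B (P s x)))) has_integral
        (P t x - S (t - 0) (P 0 x))) {0..t}"
      using t x P.semigroup_domain
      by (intro S.variation_of_constants has_vector_derivative_within_subset[OF P.orbit_has_vector_derivative]) auto
    then have "((\<lambda>s. S (t - s) ((C - B) (P s x))) has_integral (P t x - S (t - 0) (P 0 x))) {0..t}"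
    proof (rule has_integral_eq[rotated])
      fix s assume "s \<in> {0..t}"
      then have "P s (A x + C x) = A (P s x) + C (P s x)" using P.semigroup_domain[OF x, of s] by auto
      then show "S (t - s) (P s (A x + C x) - (A (P s x) + B (P s x))) = S (t - s) ((C - B) (P s x))"
        by (simp add: blinfun.diff_left)
    qed
    then have "((\<lambda>s. S (t - s) ((C - B) (P s x))) has_integral (P t x - S t x)) {0..t}" by simp
    moreover have "norm (S (t - s) ((C - B) (P s x))) \<le> M * (norm (C - B) * (M * norm x))"
      if "s \<in> {0..t}" for s
      using that M0
      by (intro order_trans[OF norm_blinfun] mult_mono M order_trans[OF norm_blinfun] order_trans[OF norm_blinfun_le]) auto
    ultimately have "norm (P t x - S t x) \<le> M * (norm (C - B) * (M * norm x)) * (t - 0)"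
      using t by (intro has_integral_norm_le) auto
    then show ?thesis using t by (simp add: power2_eq_square mult_ac)
  qed
  have "closed {x. norm (P t x - S t x) \<le> M\<^sup>2 * t * norm (C - B) * norm x}"
    by (intro closed_Collect_le continuous_intros)
  then have "closure D \<subseteq> {x. norm (P t x - S t x) \<le> M\<^sup>2 * t * norm (C - B) * norm x}"
    using * by (intro closure_minimal) auto
  then show ?thesis using S.domain_dense by auto
qed

section \<open>The operators \<open>\<phi>\<^sub>k(hJ)\<close>\<close>

lemma norm_phi_weight_le:
  assumes "\<theta> \<in> {0..1::real}" "norm y \<le> K"
  shows "norm ((\<theta> ^ k / fact k) *\<^sub>R y) \<le> K"
proof -
  have "\<theta> ^ k \<le> 1" using assms by (simp add: power_le_one)
  then have "\<theta> ^ k \<le> fact k" using fact_ge_1 by (rule order_trans)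
  then have "(\<theta> ^ k / fact k) * norm y \<le> 1 * norm y" using assms by (intro mult_right_mono) auto
  then show ?thesis using assms by simp
qed

text \<open>
  The definition of \<open>\<phi>\<^sub>k(hJ)\<close> refers to the semigroup \<open>exp_op D J\<close> chosen for \<open>J\<close>.
\<close>

locale exp_generator = generated_semigroup "exp_op D J" D J
  for D :: "'a::banach set" and J
begin

lemma phi_op_has_integral:
  assumes "h \<ge> 0"
  shows "((\<lambda>\<theta>. (\<theta> ^ k / fact k) *\<^sub>R exp_op D J ((1 - \<theta>) * h) x) has_integral phi_op (Suc k) h D J x) {0..1}"
proof -
  have "continuous_on {0..1} (\<lambda>\<theta>. (\<theta> ^ k / fact k) *\<^sub>R exp_op D J ((1 - \<theta>) * h) x)"
    using assms by (intro continuous_intros) auto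
  then show ?thesis
    by (simp add: phi_op_def integrable_integral integrable_continuous_real)
qed

text \<open>
  Substituting \<open>s = a + \<theta>h\<close> gives the form in which \<open>\<phi>\<^sub>k\<close> arises from variation of constants on a
  time step, with a power of \<open>s - a\<close> as inhomogeneity.
\<close>

lemma phi_op_has_integral_interval:
  assumes "h > 0"
  shows "((\<lambda>s. ((s - a) ^ k / fact k) *\<^sub>R exp_op D J (a + h - s) x) has_integral
    h ^ Suc k *\<^sub>R phi_op (Suc k) h D J x) {a..a + h}"
proof -
  let ?f = "\<lambda>\<theta>. (\<theta> ^ k / fact k) *\<^sub>R exp_op D J ((1 - \<theta>) * h) x"
  have "((\<lambda>s. ?f ((1 / h) *\<^sub>R s + (- a / h))) has_integral (phi_op (Suc k) h D J x /\<^sub>R (1 / h) ^ DIM(real)))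
      (cbox ((0 - (- a / h)) /\<^sub>R (1 / h)) ((1 - (- a / h)) /\<^sub>R (1 / h)))"
    using phi_op_has_integral[of h k x] assms by (intro has_integral_affinity') auto
  then have "((\<lambda>s. ?f ((s - a) / h)) has_integral (h *\<^sub>R phi_op (Suc k) h D J x)) {a..a + h}"
    using assms by (simp add: diff_divide_distrib distrib_left add.commute)
  from has_integral_cmul[OF this, of "h ^ k"]
  have "((\<lambda>s. h ^ k *\<^sub>R ?f ((s - a) / h)) has_integral (h ^ Suc k *\<^sub>R phi_op (Suc k) h D J x)) {a..a + h}"
    by (simp add: mult.commute)
  moreover have "h ^ k *\<^sub>R ?f ((s - a) / h) = ((s - a) ^ k / fact k) *\<^sub>R exp_op D J (a + h - s) x" for s
  proof -
    have "(1 - (s - a) / h) * h = a + h - s" using assms by (simp add: field_simps)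
    then show ?thesis using assms by (simp add: power_divide)
  qed
  ultimately show ?thesis by simp
qed

lemma norm_phi_op_le:
  assumes "h \<ge> 0" "\<And>t. 0 \<le> t \<Longrightarrow> t \<le> h \<Longrightarrow> norm (exp_op D J t) \<le> M"
  shows "norm (phi_op (Suc k) h D J x) \<le> M * norm x"
proof -
  have "norm (phi_op (Suc k) h D J x) \<le> M * norm x * (1 - 0)"
  proof (rule has_integral_norm_le[OF phi_op_has_integral[OF assms(1)]])
    fix \<theta> :: real assume \<theta>: "\<theta> \<in> {0..1}"
    then have *: "norm (exp_op D J ((1 - \<theta>) * h)) \<le> M"
      using assms by (intro assms(2)) (auto intro: mult_left_le_one_le)
    then show "norm ((\<theta> ^ k / fact k) *\<^sub>R exp_op D J ((1 - \<theta>) * h) x) \<le> M * norm x"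
      by (intro norm_phi_weight_le \<theta> norm_blinfun_le)
  qed simp
  then show ?thesis by simp
qed

lemma bounded_linear_phi_op:
  assumes "h \<ge> 0"
  shows "bounded_linear (phi_op (Suc k) h D J)"
proof -
  obtain M w where M: "M \<ge> 1" "w \<ge> 0" "\<And>t. t \<ge> 0 \<Longrightarrow> norm (exp_op D J t) \<le> M * exp (w * t)"
    using exponential_bound by blast
  show ?thesis
  proof (rule bounded_linear_intro)
    fix x y
    have "((\<lambda>\<theta>. (\<theta> ^ k / fact k) *\<^sub>R exp_op D J ((1 - \<theta>) * h) (x + y)) has_integral
        (phi_op (Suc k) h D J x + phi_op (Suc k) h D J y)) {0..1}"
      using has_integral_add[OF phi_op_has_integral[OF assms, of k x] phi_op_has_integral[OF assms, of k y]]
      by (simp add: blinfun.add_right scaleR_add_right)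
    then show "phi_op (Suc k) h D J (x + y) = phi_op (Suc k) h D J x + phi_op (Suc k) h D J y"
      by (rule has_integral_unique[OF phi_op_has_integral[OF assms]])
  next
    fix c x
    have "((\<lambda>\<theta>. (\<theta> ^ k / fact k) *\<^sub>R exp_op D J ((1 - \<theta>) * h) (c *\<^sub>R x)) has_integral
        c *\<^sub>R phi_op (Suc k) h D J x) {0..1}"
      using has_integral_cmul[OF phi_op_has_integral[OF assms, of k x], of c]
      by (simp add: blinfun.scaleR_right mult_ac)
    then show "phi_op (Suc k) h D J (c *\<^sub>R x) = c *\<^sub>R phi_op (Suc k) h D J x"
      by (rule has_integral_unique[OF phi_op_has_integral[OF assms]])
  next
    fix x
    have "norm (phi_op (Suc k) h D J x) \<le> (M * exp (w * h)) * norm x"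
    proof (rule norm_phi_op_le[OF assms])
      fix t assume "0 \<le> t" "t \<le> h"
      then show "norm (exp_op D J t) \<le> M * exp (w * h)"
        using M by (intro order_trans[OF M(3)] mult_left_mono) (auto intro: mult_left_mono)
    qed
    then show "norm (phi_op (Suc k) h D J x) \<le> norm x * (M * exp (w * h))" by (simp add: mult.commute)
  qed
qed

lemma phi_op_1_generator:
  assumes "x \<in> D" "h > 0"
  shows "h *\<^sub>R phi_op 1 h D J (J x) = exp_op D J h x - x"
proof -
  have "((\<lambda>s. exp_op D J (h - s) (J x)) has_integral (exp_op D J h x - x)) {0..h}"
    using orbit_has_integral[of x h] assms by (intro has_integral_reverse) auto
  moreover have "((\<lambda>s. exp_op D J (h - s) (J x)) has_integral (h *\<^sub>R phi_op 1 h D J (J x))) {0..h}"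
    using phi_op_has_integral_interval[OF assms(2), of 0 0 "J x"] by simp
  ultimately show ?thesis by (rule has_integral_unique[symmetric])
qed

lemma phi_op_1_in_domain:
  assumes "h > 0" shows "phi_op 1 h D J x \<in> D"
proof -
  have "((\<lambda>s. exp_op D J (h - s) x) has_integral (h *\<^sub>R phi_op 1 h D J x)) {0..h}"
    using phi_op_has_integral_interval[OF assms, of 0 0 x] by simp
  from has_integral_reverse[OF this]
  have "integral {0..h} (\<lambda>s. (1 + 0 * s + 0 * s\<^sup>2) *\<^sub>R exp_op D J s x) = h *\<^sub>R phi_op 1 h D J x"
    using assms by (simp add: has_integral_iff)
  then have "h *\<^sub>R phi_op 1 h D J x \<in> D"
    using weighted_integral_in_domain[of h 1 0 0 x] assms by simp
  from generator_scaleR[OF this, of "1 / h"] show ?thesis using assms by simp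
qed

lemma phi_op_3_in_domain:
  assumes "h > 0" shows "phi_op 3 h D J x \<in> D"
proof -
  have "((\<lambda>s. (s ^ 2 / 2) *\<^sub>R exp_op D J (h - s) x) has_integral (h ^ 3 *\<^sub>R phi_op 3 h D J x)) {0..h}"
    using phi_op_has_integral_interval[OF assms, of 0 2 x] by (simp add: numeral_3_eq_3 fact_2)
  from has_integral_reverse[OF this]
  have "integral {0..h} (\<lambda>s. ((h - s) ^ 2 / 2) *\<^sub>R exp_op D J s x) = h ^ 3 *\<^sub>R phi_op 3 h D J x"
    using assms by (simp add: has_integral_iff)
  moreover have "(h - s) ^ 2 / 2 = h\<^sup>2 / 2 + (- h) * s + (1 / 2) * s\<^sup>2" for s :: real
    by (simp add: power2_eq_square field_simps)
  ultimately have "h ^ 3 *\<^sub>R phi_op 3 h D J x \<in> D"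
    using weighted_integral_in_domain[of h "h\<^sup>2 / 2" "- h" "1 / 2" x] assms by simp
  from generator_scaleR[OF this, of "1 / h ^ 3"] show ?thesis using assms by simp
qed

text \<open>
  At \<open>J = 0\<close> the operator \<open>\<phi>\<^sub>k\<close> is \<open>1/k!\<close>. On the domain, \<open>exp(tJ) x - x\<close> is the integral of
  \<open>exp(sJ) J x\<close>, hence of size \<open>t\<close>.
\<close>

lemma phi_op_approx:
  assumes "h \<ge> 0" "x \<in> D" "\<And>t. 0 \<le> t \<Longrightarrow> t \<le> h \<Longrightarrow> norm (exp_op D J t) \<le> M"
  shows "norm (phi_op (Suc k) h D J x - (1 / fact (Suc k)) *\<^sub>R x) \<le> M * h * norm (J x)"
proof -
  have "((\<lambda>\<theta>. \<theta> ^ k / fact k) has_integral (1 ^ Suc k / fact (Suc k) - 0 ^ Suc k / fact (Suc k))) {0..1::real}"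
    by (intro fundamental_theorem_of_calculus)
      (auto intro!: derivative_eq_intros simp: has_real_derivative_iff_has_vector_derivative[symmetric] divide_simps
        simp del: power_Suc)
  then have "((\<lambda>\<theta>. (\<theta> ^ k / fact k) *\<^sub>R x) has_integral (1 / fact (Suc k)) *\<^sub>R x) {0..1::real}"
    by (intro has_integral_scaleR_left) simp
  from has_integral_diff[OF phi_op_has_integral[OF assms(1), of k x] this]
  have int: "((\<lambda>\<theta>. (\<theta> ^ k / fact k) *\<^sub>R (exp_op D J ((1 - \<theta>) * h) x - x)) has_integral
      (phi_op (Suc k) h D J x - (1 / fact (Suc k)) *\<^sub>R x)) {0..1}"
    by (simp add: scaleR_diff_right)
  have "norm (phi_op (Suc k) h D J x - (1 / fact (Suc k)) *\<^sub>R x) \<le> M * h * norm (J x) * (1 - 0)"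
  proof (rule has_integral_norm_le[OF int])
    fix \<theta> :: real assume \<theta>: "\<theta> \<in> {0..1}"
    have "norm (exp_op D J 0) \<le> M" using assms(1,3) by (simp del: semigroup_0)
    then have M: "M \<ge> 0" using norm_ge_zero order_trans by blast
    define t where "t = (1 - \<theta>) * h"
    have t: "0 \<le> t" "t \<le> h" using \<theta> assms(1) by (auto simp: t_def intro: mult_left_le_one_le)
    have "norm (exp_op D J t x - x) \<le> M * norm (J x) * (t - 0)"
      using t assms(2,3) by (intro has_integral_norm_le[OF orbit_has_integral] norm_blinfun_le) auto
    also have "\<dots> \<le> M * norm (J x) * h" using t M by (intro mult_left_mono) auto
    finally have *: "norm (exp_op D J t x - x) \<le> M * h * norm (J x)" by (simp add: mult_ac)
    then show "norm ((\<theta> ^ k / fact k) *\<^sub>R (exp_op D J ((1 - \<theta>) * h) x - x)) \<le> M * h * norm (J x)"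
      unfolding t_def by (rule norm_phi_weight_le[OF \<theta>])
  qed simp
  then show ?thesis by simp
qed

end

lemma phi_op_difference_le:
  assumes "semigroup_generator (exp_op D J) D J" "semigroup_generator (exp_op D J') D (J' :: 'a::banach \<Rightarrow> 'a)"
    and "h \<ge> 0" "\<And>t. 0 \<le> t \<Longrightarrow> t \<le> h \<Longrightarrow> norm (exp_op D J t x - exp_op D J' t x) \<le> K"
  shows "norm (phi_op (Suc k) h D J x - phi_op (Suc k) h D J' x) \<le> K"
proof -
  interpret J: exp_generator D J by unfold_locales fact
  interpret J': exp_generator D J' by unfold_locales fact
  have "norm (phi_op (Suc k) h D J x - phi_op (Suc k) h D J' x) \<le> K * (1 - 0)"
  proof (rule has_integral_norm_le[OF has_integral_diff[OF J.phi_op_has_integral J'.phi_op_has_integral]])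
    fix \<theta> :: real assume \<theta>: "\<theta> \<in> {0..1}"
    have "norm (exp_op D J ((1 - \<theta>) * h) x - exp_op D J' ((1 - \<theta>) * h) x) \<le> K"
      using \<theta> assms(3) by (intro assms(4)) (auto intro: mult_left_le_one_le)
    then show "norm ((\<theta> ^ k / fact k) *\<^sub>R exp_op D J ((1 - \<theta>) * h) x -
        (\<theta> ^ k / fact k) *\<^sub>R exp_op D J' ((1 - \<theta>) * h) x) \<le> K"
      unfolding scaleR_diff_right[symmetric] by (rule norm_phi_weight_le[OF \<theta>])
  qed (use assms in auto)
  then show ?thesis by simp
qed

section \<open>Stability of one step\<close>

text \<open>
  The hypotheses on the problem with their consequences in quantitative form: \<open>G\<close> bounds all
  values and derivatives, \<open>M\<close> the semigroups of all Jacobians in the strip on \<open>[0, T - t0]\<close>, and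
  \<open>N\<close> is an equivalent norm in which these semigroups grow at most like \<open>exp(\<kappa>t)\<close>.
\<close>

locale exprb_setting =
  fixes A g :: "'a::banach \<Rightarrow> 'a"
    and D :: "'a set"
    and u u1 u2 u3 u4 :: "real \<Rightarrow> 'a"
    and t0 T r :: real
    and g1 :: "'a \<Rightarrow> 'a \<Rightarrow>\<^sub>L 'a"
    and g2 :: "'a \<Rightarrow> 'a \<Rightarrow>\<^sub>L 'a \<Rightarrow>\<^sub>L 'a"
    and g3 :: "'a \<Rightarrow> 'a \<Rightarrow>\<^sub>L 'a \<Rightarrow>\<^sub>L 'a \<Rightarrow>\<^sub>L 'a"
    and g4 :: "'a \<Rightarrow> 'a \<Rightarrow>\<^sub>L 'a \<Rightarrow>\<^sub>L 'a \<Rightarrow>\<^sub>L 'a \<Rightarrow>\<^sub>L 'a"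
    and G M \<kappa> K :: real and N :: "'a \<Rightarrow> real"
  assumes t0_less: "t0 < T" and r: "r > 0"
    and u_D: "\<And>t. t \<in> {t0..T} \<Longrightarrow> u t \<in> D"
    and u1_eq: "\<And>t. t \<in> {t0..T} \<Longrightarrow> u1 t = rhs A g (u t)"
    and du: "\<And>t. t \<in> {t0..T} \<Longrightarrow> (u has_vector_derivative u1 t) (at t within {t0..T})"
      "\<And>t. t \<in> {t0..T} \<Longrightarrow> (u1 has_vector_derivative u2 t) (at t within {t0..T})"
      "\<And>t. t \<in> {t0..T} \<Longrightarrow> (u2 has_vector_derivative u3 t) (at t within {t0..T})"
      "\<And>t. t \<in> {t0..T} \<Longrightarrow> (u3 has_vector_derivative u4 t) (at t within {t0..T})"
    and dg: "\<And>v. v \<in> strip u {t0..T} r \<Longrightarrow> (g has_derivative blinfun_apply (g1 v)) (at v)"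
      "\<And>v. v \<in> strip u {t0..T} r \<Longrightarrow> (g1 has_derivative blinfun_apply (g2 v)) (at v)"
      "\<And>v. v \<in> strip u {t0..T} r \<Longrightarrow> (g2 has_derivative blinfun_apply (g3 v)) (at v)"
      "\<And>v. v \<in> strip u {t0..T} r \<Longrightarrow> (g3 has_derivative blinfun_apply (g4 v)) (at v)"
    and G: "G \<ge> 1"
    and u_le: "\<And>t. t \<in> {t0..T} \<Longrightarrow> norm (u1 t) \<le> G" "\<And>t. t \<in> {t0..T} \<Longrightarrow> norm (u2 t) \<le> G"
      "\<And>t. t \<in> {t0..T} \<Longrightarrow> norm (u3 t) \<le> G" "\<And>t. t \<in> {t0..T} \<Longrightarrow> norm (u4 t) \<le> G"
    and g_le: "\<And>v. v \<in> strip u {t0..T} r \<Longrightarrow> norm (g1 v) \<le> G"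
      "\<And>v. v \<in> strip u {t0..T} r \<Longrightarrow> norm (g2 v) \<le> G"
      "\<And>v. v \<in> strip u {t0..T} r \<Longrightarrow> norm (g3 v) \<le> G"
      "\<And>v. v \<in> strip u {t0..T} r \<Longrightarrow> norm (g4 v) \<le> G"
      "\<And>v. v \<in> strip u {t0..T} r \<Longrightarrow> norm (g v) \<le> G"
      "\<And>v. v \<in> strip u {t0..T} r \<Longrightarrow> norm v \<le> G"
    and f3_D: "\<And>t. t \<in> {t0..T} \<Longrightarrow> g3 (u t) (u1 t) (u1 t) (u1 t) + 3 *\<^sub>R g2 (u t) (u1 t) (u2 t) \<in> D"
    and A_f3_le: "\<And>t. t \<in> {t0..T} \<Longrightarrow>
      norm (A (g3 (u t) (u1 t) (u1 t) (u1 t) + 3 *\<^sub>R g2 (u t) (u1 t) (u2 t))) \<le> G"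
    and gen: "\<And>v. v \<in> strip u {t0..T} r \<Longrightarrow> semigroup_generator (exp_op D (jacobian A g1 v)) D (jacobian A g1 v)"
    and M: "M \<ge> 1"
    and E_le: "\<And>v t. v \<in> strip u {t0..T} r \<Longrightarrow> 0 \<le> t \<Longrightarrow> t \<le> T - t0 \<Longrightarrow> norm (exp_op D (jacobian A g1 v) t) \<le> M"
    and K: "K \<ge> 1"
    and N: "\<And>x. norm x \<le> N x" "\<And>x. N x \<le> K * norm x" "\<And>x y. N (x + y) \<le> N x + N y"
    and \<kappa>: "\<kappa> \<ge> 0"
    and N_E: "\<And>v t x. v \<in> strip u {t0..T} r \<Longrightarrow> 0 \<le> t \<Longrightarrow> t \<le> T - t0 \<Longrightarrow>
      N (exp_op D (jacobian A g1 v) t x) \<le> exp (\<kappa> * t) * N x"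
begin

abbreviation "V \<equiv> strip u {t0..T} r"
abbreviation "H \<equiv> T - t0"
abbreviation "J \<equiv> jacobian A g1"
abbreviation "E v \<equiv> exp_op D (jacobian A g1 v)"
abbreviation "\<Phi> k h v \<equiv> phi_op k h D (jacobian A g1 v)"
abbreviation "R \<equiv> nonlin_rem g g1"
abbreviation "stage \<equiv> exprb42_stage D A g g1"
abbreviation "step \<equiv> exprb42_step D A g g1"
abbreviation "f2 t \<equiv> g2 (u t) (u1 t) (u1 t)"
abbreviation "f3 t \<equiv> g3 (u t) (u1 t) (u1 t) (u1 t) + 3 *\<^sub>R g2 (u t) (u1 t) (u2 t)"

lemma H_pos: "H > 0" using t0_less by simp

lemma ball_subset_strip: "t \<in> {t0..T} \<Longrightarrow> ball (u t) r \<subseteq> V"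
  unfolding strip_def by blast

lemma u_in_strip: "t \<in> {t0..T} \<Longrightarrow> u t \<in> V"
  using ball_subset_strip[of t] r by auto

lemma open_strip: "open V"
  unfolding strip_def by blast

lemma generator: "v \<in> V \<Longrightarrow> exp_generator D (J v)"
  by (intro exp_generator.intro generated_semigroup.intro gen)

lemma E_lipschitz:
  assumes v: "v \<in> V" and w: "w \<in> V" and t: "0 \<le> t" "t \<le> H"
  shows "norm (E v t x - E w t y) \<le> M * norm (x - y) + M\<^sup>2 * t * norm (g1 v - g1 w) * norm y"
proof -
  have J: "(\<lambda>x. A x + g1 v x) = J v" for v by (simp add: jacobian_def fun_eq_iff)
  have gen': "semigroup_generator (E v) D (\<lambda>x. A x + g1 v x)" if "v \<in> V" for v
    unfolding J by (rule gen[OF that])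
  have "norm (E v t y - E w t y) \<le> M\<^sup>2 * t * norm (g1 v - g1 w) * norm y"
    by (rule semigroup_difference_le[OF gen'[OF w] gen'[OF v]]) (use v w t in \<open>auto intro!: E_le\<close>)
  moreover have "norm (E v t (x - y)) \<le> M * norm (x - y)"
    by (intro norm_blinfun_le E_le v t)
  moreover have eq: "E v t x - E w t y = E v t (x - y) + (E v t y - E w t y)"
    by (simp add: blinfun.diff_right)
  ultimately show ?thesis unfolding eq by (intro norm_triangle_mono)
qed

lemma phi_lipschitz:
  assumes v: "v \<in> V" and w: "w \<in> V" and h: "0 \<le> h" "h \<le> H" and k: "k > 0"
  shows "norm (\<Phi> k h v x - \<Phi> k h w y) \<le> M * norm (x - y) + M\<^sup>2 * h * norm (g1 v - g1 w) * norm y"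
proof -
  obtain j where j: "k = Suc j" using k gr0_implies_Suc by blast
  interpret v: exp_generator D "J v" by (rule generator[OF v])
  interpret v: bounded_linear "\<Phi> k h v" unfolding j by (rule v.bounded_linear_phi_op[OF h(1)])
  have "norm (\<Phi> k h v y - \<Phi> k h w y) \<le> M\<^sup>2 * h * norm (g1 v - g1 w) * norm y"
    unfolding j
  proof (rule phi_op_difference_le[OF gen[OF v] gen[OF w] h(1)])
    fix t assume t: "0 \<le> t" "t \<le> h"
    have "norm (E v t y - E w t y) \<le> M * norm (y - y) + M\<^sup>2 * t * norm (g1 v - g1 w) * norm y"
      using t h by (intro E_lipschitz v w) auto
    also have "\<dots> \<le> M\<^sup>2 * h * norm (g1 v - g1 w) * norm y"
      using t by (auto intro!: mult_right_mono mult_left_mono)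
    finally show "norm (E v t y - E w t y) \<le> M\<^sup>2 * h * norm (g1 v - g1 w) * norm y" .
  qed
  moreover have "norm (\<Phi> k h v (x - y)) \<le> M * norm (x - y)"
    unfolding j using h by (intro v.norm_phi_op_le E_le v) auto
  moreover have eq: "\<Phi> k h v x - \<Phi> k h w y = \<Phi> k h v (x - y) + (\<Phi> k h v y - \<Phi> k h w y)"
    by (simp add: v.diff)
  ultimately show ?thesis unfolding eq by (intro norm_triangle_mono)
qed

lemma phi_lipschitz_le:
  assumes "v \<in> V" "w \<in> V" "0 \<le> h" "h \<le> H" "k > 0"
    and "norm (x - y) \<le> a" "norm (g1 v - g1 w) \<le> b" "norm y \<le> c"
  shows "norm (\<Phi> k h v x - \<Phi> k h w y) \<le> M * a + M\<^sup>2 * H * b * c"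
proof -
  have "0 \<le> b" using norm_ge_zero assms(7) by (rule order_trans)
  then have "M * norm (x - y) + M\<^sup>2 * h * norm (g1 v - g1 w) * norm y \<le> M * a + M\<^sup>2 * H * b * c"
    using assms M by (intro add_mono mult_mono) auto
  then show ?thesis using phi_lipschitz[OF assms(1-5), of x y] by linarith
qed

lemma norm_phi_le:
  assumes "v \<in> V" "0 \<le> h" "h \<le> H" "k > 0"
  shows "norm (\<Phi> k h v x) \<le> M * norm x"
proof -
  obtain j where j: "k = Suc j" using assms gr0_implies_Suc by blast
  interpret v: exp_generator D "J v" by (rule generator[OF assms(1)])
  show ?thesis unfolding j using assms by (intro v.norm_phi_op_le E_le) auto
qed

lemma phi_1_rhs:
  assumes "v \<in> V" "v \<in> D" "h > 0"
  shows "h *\<^sub>R \<Phi> 1 h v (rhs A g v) = E v h v - v + h *\<^sub>R \<Phi> 1 h v (R v v)"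
proof -
  interpret v: exp_generator D "J v" by (rule generator[OF assms(1)])
  interpret v: bounded_linear "\<Phi> 1 h v" unfolding One_nat_def using assms by (intro v.bounded_linear_phi_op) simp
  have "rhs A g v = J v v + R v v" by (simp add: rhs_def jacobian_def nonlin_rem_def)
  then show ?thesis
    using v.phi_op_1_generator[OF assms(2,3)] by (simp add: v.add[unfolded One_nat_def] scaleR_add_right)
qed

lemma stage_eq:
  assumes "v \<in> V" "v \<in> D" "h > 0"
  shows "stage h v = E v (3/4 * h) v + (3/4 * h) *\<^sub>R \<Phi> 1 (3/4 * h) v (R v v)"
  using phi_1_rhs[OF assms(1,2), of "3/4 * h"] assms(3) by (simp add: exprb42_stage_def)

text \<open>
  With \<open>F(v) = J v + R v\<close>, the \<open>\<phi>\<^sub>1\<close> term applied to the unbounded part \<open>J v\<close> is \<open>exp(hJ) v - v\<close>. Only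
  in this form does a step depend continuously on \<open>v\<close> in the norm of the space.
\<close>

lemma step_eq:
  assumes "v \<in> V" "v \<in> D" "h > 0"
  shows "step h v = E v h v + h *\<^sub>R \<Phi> 1 h v (R v v) + (h * (32/9)) *\<^sub>R \<Phi> 3 h v (R v (stage h v) - R v v)"
  using phi_1_rhs[OF assms] by (simp add: exprb42_step_def)

text \<open>
  The \<open>\<phi>\<^sub>k\<close> map the whole space into the domain, so all iterates stay in \<open>D\<close>, where \<open>A\<close> has a
  meaning.
\<close>

lemma step_in_domain:
  assumes "v \<in> V" "v \<in> D" "h > 0"
  shows "step h v \<in> D"
proof -
  interpret v: exp_generator D "J v" by (rule generator[OF assms(1)])
  show ?thesis
    unfolding exprb42_step_def
    using assms by (intro v.generator_add[THEN conjunct1] v.generator_scaleR[THEN conjunct1]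
      v.phi_op_1_in_domain v.phi_op_3_in_domain)
qed

lemma norm_R_le: "v \<in> V \<Longrightarrow> x \<in> V \<Longrightarrow> norm (R v x) \<le> 2 * G\<^sup>2"
proof -
  assume *: "v \<in> V" "x \<in> V"
  have "norm (g1 v x) \<le> G * G" using * g_le by (intro norm_blinfun_le_mult) auto
  moreover have "G \<le> G * G" using G by simp
  ultimately show "norm (R v x) \<le> 2 * G\<^sup>2"
    unfolding nonlin_rem_def using g_le(5)[OF *(2)] norm_triangle_ineq4[of "g x" "g1 v x"]
    by (simp add: power2_eq_square)
qed

lemma ball_lipschitz:
  assumes t: "t \<in> {t0..T}" and x: "x \<in> ball (u t) r" and y: "y \<in> ball (u t) r"
  shows "norm (g x - g y) \<le> G * norm (x - y)" "norm (g1 x - g1 y) \<le> G * norm (x - y)"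
proof -
  have sub: "ball (u t) r \<subseteq> V" by (rule ball_subset_strip[OF t])
  show "norm (g x - g y) \<le> G * norm (x - y)"
  proof (rule differentiable_bound[OF convex_ball _ _ x y])
    fix z assume "z \<in> ball (u t) r"
    then have z: "z \<in> V" using sub by blast
    show "(g has_derivative blinfun_apply (g1 z)) (at z within ball (u t) r)"
      by (rule has_derivative_at_withinI[OF dg(1)[OF z]])
    show "onorm (blinfun_apply (g1 z)) \<le> G"
      using g_le(1)[OF z] by (simp add: norm_blinfun.rep_eq)
  qed
  show "norm (g1 x - g1 y) \<le> G * norm (x - y)"
  proof (rule differentiable_bound[OF convex_ball _ _ x y])
    fix z assume "z \<in> ball (u t) r"
    then have z: "z \<in> V" using sub by blast
    show "(g1 has_derivative blinfun_apply (g2 z)) (at z within ball (u t) r)"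
      by (rule has_derivative_at_withinI[OF dg(2)[OF z]])
    show "onorm (blinfun_apply (g2 z)) \<le> G"
      using g_le(2)[OF z] by (simp add: norm_blinfun.rep_eq)
  qed
qed

lemma R_lipschitz:
  assumes t: "t \<in> {t0..T}"
    and "v \<in> ball (u t) r" "w \<in> ball (u t) r" "x \<in> ball (u t) r" "y \<in> ball (u t) r"
  shows "norm (R v x - R w y) \<le> 2 * G * norm (x - y) + G\<^sup>2 * norm (v - w)"
proof -
  have V: "v \<in> V" "y \<in> V" using assms ball_subset_strip[OF t] by blast+
  have eq: "R v x - R w y = (g x - g y) - g1 v (x - y) - (g1 v - g1 w) y"
    by (simp add: nonlin_rem_def blinfun.diff_left blinfun.diff_right)
  have 1: "norm (g x - g y) \<le> G * norm (x - y)"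
    by (rule ball_lipschitz(1)[OF t]) fact+
  have 2: "norm (g1 v (x - y)) \<le> G * norm (x - y)"
    by (intro norm_blinfun_le g_le V)
  have 3: "norm ((g1 v - g1 w) y) \<le> (G * norm (v - w)) * G"
    by (intro norm_blinfun_le_mult ball_lipschitz(2)[OF t] g_le V) fact+
  have "norm (R v x - R w y) \<le> G * norm (x - y) + G * norm (x - y) + (G * norm (v - w)) * G"
    unfolding eq by (rule norm_diff_mono[OF norm_diff_mono[OF 1 2] 3])
  then show ?thesis by (simp add: power2_eq_square algebra_simps)
qed

lemma stage_lipschitz:
  "\<exists>C\<ge>0. \<forall>t\<in>{t0..T}. \<forall>h v. 0 < h \<longrightarrow> h \<le> H \<longrightarrow> v \<in> ball (u t) r \<longrightarrow> v \<in> D \<longrightarrow>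
    norm (stage h v - stage h (u t)) \<le> C * norm (v - u t)"
proof -
  define L where "L = 2 * G + G\<^sup>2"
  define C where "C = M + M\<^sup>2 * H * G * G + H * (M * L + M\<^sup>2 * H * G * (2 * G\<^sup>2))"
  have "norm (stage h v - stage h (u t)) \<le> C * norm (v - u t)"
    if t: "t \<in> {t0..T}" and h: "0 < h" "h \<le> H" and v: "v \<in> ball (u t) r" "v \<in> D" for t h v
  proof -
    define w where "w = u t"
    define k where "k = 3/4 * h"
    have k: "0 < k" "k \<le> H" using h by (auto simp: k_def)
    have w: "w \<in> ball w r" "w \<in> V" "w \<in> D" using t r u_D u_in_strip by (auto simp: w_def)
    have vV: "v \<in> V" using v ball_subset_strip[OF t] by blast
    have v': "v \<in> ball w r" using v by (simp add: w_def)
    define \<delta> where "\<delta> = norm (v - w)"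
    have \<delta>: "\<delta> \<ge> 0" by (simp add: \<delta>_def)
    have g1: "norm (g1 v - g1 w) \<le> G * \<delta>" "norm (g1 v - g1 w) \<ge> 0"
      unfolding \<delta>_def w_def by (intro ball_lipschitz(2)[OF t]) (use v r in auto)
    have R: "norm (R v v - R w w) \<le> L * \<delta>"
      using R_lipschitz[OF t, folded w_def, OF v' w(1) v' w(1)] by (simp add: L_def \<delta>_def algebra_simps)
    have "norm (E v k v - E w k w) \<le> M * \<delta> + M\<^sup>2 * k * norm (g1 v - g1 w) * norm w"
      unfolding \<delta>_def using k by (intro E_lipschitz vV w) auto
    also have "\<dots> \<le> M * \<delta> + M\<^sup>2 * H * (G * \<delta>) * G"
      using k g1 g_le(6)[OF w(2)] \<delta> G by (intro add_mono mult_mono order_refl) auto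
    finally have 1: "norm (E v k v - E w k w) \<le> M * \<delta> + M\<^sup>2 * H * (G * \<delta>) * G" .
    have "norm (\<Phi> 1 k v (R v v) - \<Phi> 1 k w (R w w)) \<le> M * (L * \<delta>) + M\<^sup>2 * H * (G * \<delta>) * (2 * G\<^sup>2)"
      using k by (intro phi_lipschitz_le vV g1 R norm_R_le w) auto
    then have 2: "norm (k *\<^sub>R (\<Phi> 1 k v (R v v) - \<Phi> 1 k w (R w w)))
        \<le> H * (M * (L * \<delta>) + M\<^sup>2 * H * (G * \<delta>) * (2 * G\<^sup>2))"
      using k by (auto intro!: mult_mono)
    have "stage h v - stage h w = (E v k v - E w k w) + k *\<^sub>R (\<Phi> 1 k v (R v v) - \<Phi> 1 k w (R w w))"
      using stage_eq[OF vV v(2) h(1)] stage_eq[OF w(2,3) h(1)] by (simp add: k_def scaleR_diff_right)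
    then have "norm (stage h v - stage h w) \<le> M * \<delta> + M\<^sup>2 * H * (G * \<delta>) * G +
        H * (M * (L * \<delta>) + M\<^sup>2 * H * (G * \<delta>) * (2 * G\<^sup>2))"
      using 1 2 norm_triangle_mono by metis
    also have "\<dots> = C * \<delta>" by (simp add: C_def algebra_simps)
    finally show ?thesis by (simp add: w_def \<delta>_def)
  qed
  moreover have "C \<ge> 0" using M G H_pos unfolding C_def L_def by (intro add_nonneg_nonneg mult_nonneg_nonneg) auto
  ultimately show ?thesis by blast
qed

text \<open>
  Apart from the propagated difference \<open>E v h (v - u t)\<close>, all terms carry a factor \<open>h\<close>: the change of
  the semigroup by \<open>semigroup_difference_le\<close>, the others explicitly. The base point \<open>u t\<close> of the
  comparison is needed because Lipschitz bounds for \<open>g\<close> are available on balls around it.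
\<close>

lemma step_lipschitz:
  "\<exists>C\<ge>0. \<forall>t\<in>{t0..T}. \<forall>h v. 0 < h \<longrightarrow> h \<le> H \<longrightarrow> v \<in> ball (u t) r \<longrightarrow> v \<in> D \<longrightarrow>
    stage h v \<in> ball (u t) r \<longrightarrow> stage h (u t) \<in> ball (u t) r \<longrightarrow>
    norm (step h v - step h (u t) - E v h (v - u t)) \<le> C * h * norm (v - u t)"
proof -
  define L where "L = 2 * G + G\<^sup>2"
  obtain C1 where C1: "C1 \<ge> 0" "\<And>t h v. t \<in> {t0..T} \<Longrightarrow> 0 < h \<Longrightarrow> h \<le> H \<Longrightarrow> v \<in> ball (u t) r \<Longrightarrow> v \<in> D \<Longrightarrow>
      norm (stage h v - stage h (u t)) \<le> C1 * norm (v - u t)"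
    using stage_lipschitz by blast
  define L' where "L' = 2 * G * C1 + G\<^sup>2 + L"
  define C where "C = M\<^sup>2 * G * G + (M * L + M\<^sup>2 * H * G * (2 * G\<^sup>2)) + 32/9 * (M * L' + M\<^sup>2 * H * G * (4 * G\<^sup>2))"
  have "norm (step h v - step h (u t) - E v h (v - u t)) \<le> C * h * norm (v - u t)"
    if t: "t \<in> {t0..T}" and h: "0 < h" "h \<le> H" and v: "v \<in> ball (u t) r" "v \<in> D"
      and st: "stage h v \<in> ball (u t) r" "stage h (u t) \<in> ball (u t) r" for t h v
  proof -
    define w where "w = u t"
    have w: "w \<in> ball w r" "w \<in> V" "w \<in> D" using t r u_D u_in_strip by (auto simp: w_def)
    have vV: "v \<in> V" using v ball_subset_strip[OF t] by blast
    have wS: "stage h w \<in> V" using st ball_subset_strip[OF t] by (auto simp: w_def)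
    have v': "v \<in> ball w r" and st': "stage h v \<in> ball w r" "stage h w \<in> ball w r"
      using v st by (auto simp: w_def)
    define \<delta> where "\<delta> = norm (v - w)"
    have \<delta>: "\<delta> \<ge> 0" by (simp add: \<delta>_def)
    have g1: "norm (g1 v - g1 w) \<le> G * \<delta>" "norm (g1 v - g1 w) \<ge> 0"
      unfolding \<delta>_def w_def by (intro ball_lipschitz(2)[OF t]) (use v r in auto)
    define p where "p = R v v"
    define q where "q = R w w"
    define p' where "p' = R v (stage h v) - R v v"
    define q' where "q' = R w (stage h w) - R w w"
    have pq: "norm (p - q) \<le> L * \<delta>"
      using R_lipschitz[OF t, folded w_def, OF v' w(1) v' w(1)] by (simp add: p_def q_def L_def \<delta>_def algebra_simps)
    have q: "norm q \<le> 2 * G\<^sup>2" unfolding q_def by (intro norm_R_le w)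
    have RR: "norm (R v (stage h v) - R w (stage h w)) \<le> 2 * G * (C1 * \<delta>) + G\<^sup>2 * \<delta>"
    proof -
      have "norm (stage h v - stage h w) \<le> C1 * \<delta>"
        unfolding w_def \<delta>_def by (rule C1(2)[OF t h v])
      then have "2 * G * norm (stage h v - stage h w) \<le> 2 * G * (C1 * \<delta>)"
        using G by (intro mult_left_mono) auto
      then show ?thesis
        using R_lipschitz[OF t, folded w_def, OF v' w(1) st'] by (simp add: \<delta>_def)
    qed
    have eq: "p' - q' = (R v (stage h v) - R w (stage h w)) - (p - q)"
      by (simp add: p'_def q'_def p_def q_def)
    have "norm (p' - q') \<le> 2 * G * (C1 * \<delta>) + G\<^sup>2 * \<delta> + L * \<delta>"
      unfolding eq by (rule norm_diff_mono[OF RR pq])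
    then have pq': "norm (p' - q') \<le> L' * \<delta>" by (simp add: L'_def algebra_simps)
    have q': "norm q' \<le> 4 * G\<^sup>2"
      using norm_diff_mono[OF norm_R_le[OF w(2) wS] norm_R_le[OF w(2,2)]] unfolding q'_def by simp
    have "norm (E v h w - E w h w) \<le> M\<^sup>2 * h * norm (g1 v - g1 w) * norm w"
      using E_lipschitz[OF vV w(2), of h w w] h by simp
    also have "\<dots> \<le> M\<^sup>2 * h * (G * \<delta>) * G"
      using h g1 g_le(6)[OF w(2)] \<delta> G by (intro mult_mono order_refl) auto
    finally have 1: "norm (E v h w - E w h w) \<le> M\<^sup>2 * h * (G * \<delta>) * G" .
    have 2: "norm (\<Phi> 1 h v p - \<Phi> 1 h w q) \<le> M * (L * \<delta>) + M\<^sup>2 * H * (G * \<delta>) * (2 * G\<^sup>2)"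
      using h by (intro phi_lipschitz_le vV w g1 pq q) auto
    have 3: "norm (\<Phi> 3 h v p' - \<Phi> 3 h w q') \<le> M * (L' * \<delta>) + M\<^sup>2 * H * (G * \<delta>) * (4 * G\<^sup>2)"
      using h by (intro phi_lipschitz_le vV w g1 pq' q') auto
    have "step h v - step h w - E v h (v - w) = (E v h w - E w h w) +
        (h *\<^sub>R (\<Phi> 1 h v p - \<Phi> 1 h w q) + (h * (32/9)) *\<^sub>R (\<Phi> 3 h v p' - \<Phi> 3 h w q'))"
      using step_eq[OF vV v(2) h(1)] step_eq[OF w(2,3) h(1)]
      by (simp add: p_def q_def p'_def q'_def scaleR_diff_right blinfun.diff_right)
    also have "norm \<dots> \<le> M\<^sup>2 * h * (G * \<delta>) * G +
        (h * (M * (L * \<delta>) + M\<^sup>2 * H * (G * \<delta>) * (2 * G\<^sup>2)) +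
         (h * (32/9)) * (M * (L' * \<delta>) + M\<^sup>2 * H * (G * \<delta>) * (4 * G\<^sup>2)))"
    proof (intro norm_triangle_mono 1)
      show "norm (h *\<^sub>R (\<Phi> 1 h v p - \<Phi> 1 h w q)) \<le> h * (M * (L * \<delta>) + M\<^sup>2 * H * (G * \<delta>) * (2 * G\<^sup>2))"
        unfolding norm_scaleR using h 2 by (intro mult_mono) auto
      show "norm ((h * (32/9)) *\<^sub>R (\<Phi> 3 h v p' - \<Phi> 3 h w q'))
          \<le> h * (32/9) * (M * (L' * \<delta>) + M\<^sup>2 * H * (G * \<delta>) * (4 * G\<^sup>2))"
        unfolding norm_scaleR using h 3 by (intro mult_mono) auto
    qed
    also have "\<dots> = C * h * \<delta>" by (simp add: C_def algebra_simps)
    finally show ?thesis by (simp add: w_def \<delta>_def)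
  qed
  moreover have "C \<ge> 0" using M G H_pos C1(1) unfolding C_def L'_def L_def
    by (intro add_nonneg_nonneg mult_nonneg_nonneg) auto
  ultimately show ?thesis by blast
qed

end

section \<open>The local error\<close>

context exprb_setting
begin

lemma u_near:
  assumes "t \<in> {t0..T}" "s \<in> {t..T}"
  shows "norm (u s - u t) \<le> G * (s - t)"
proof (rule norm_vector_derivative_le)
  fix x assume "x \<in> {t..s}"
  then have x: "x \<in> {t0..T}" using assms by auto
  show "(u has_vector_derivative u1 x) (at x within {t..s})"
    by (rule has_vector_derivative_within_subset[OF du(1)[OF x]]) (use assms in auto)
  show "norm (u1 x) \<le> G" by (rule u_le(1)[OF x])
qed (use assms in auto)

text \<open>
  The first derivative vanishes at \<open>t\<close> because \<open>g1 (u s) - g1 (u t)\<close> does. Symmetry of \<open>g2\<close> collects the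
  three mixed terms of the third derivative in the coefficient \<open>3\<close> of \<open>f3\<close>.
\<close>

lemma remainder_taylor:
  assumes t: "t \<in> {t0..T}" and s: "s \<in> {t..T}"
  shows "norm (R (u t) (u s) - R (u t) (u t) - ((s - t)\<^sup>2 / 2) *\<^sub>R f2 t - ((s - t) ^ 3 / 6) *\<^sub>R f3 t)
    \<le> 16 * G ^ 5 * (s - t) ^ 4"
proof -
  define w where "w = u t"
  have wV: "w \<in> V" using u_in_strip[OF t] by (simp add: w_def)
  define F0 where "F0 x = R w (u x)" for x
  define F1 where "F1 x = (g1 (u x) - g1 w) (u1 x)" for x
  define F2 where "F2 x = (g1 (u x) - g1 w) (u2 x) + g2 (u x) (u1 x) (u1 x)" for x
  define F3 where "F3 x = (g1 (u x) - g1 w) (u3 x) + 2 *\<^sub>R g2 (u x) (u1 x) (u2 x) + g2 (u x) (u2 x) (u1 x)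
    + g3 (u x) (u1 x) (u1 x) (u1 x)" for x
  define F4 where "F4 x = (g1 (u x) - g1 w) (u4 x) + g2 (u x) (u1 x) (u3 x)
    + 2 *\<^sub>R (g2 (u x) (u1 x) (u3 x) + g2 (u x) (u2 x) (u2 x) + g3 (u x) (u1 x) (u1 x) (u2 x))
    + (g2 (u x) (u2 x) (u2 x) + g2 (u x) (u3 x) (u1 x) + g3 (u x) (u1 x) (u2 x) (u1 x))
    + (g3 (u x) (u1 x) (u1 x) (u2 x) + g3 (u x) (u1 x) (u2 x) (u1 x) + g3 (u x) (u2 x) (u1 x) (u1 x)
       + g4 (u x) (u1 x) (u1 x) (u1 x) (u1 x))" for x
  define Df where "Df n = [F0, F1, F2, F3, F4] ! n" for n
  note bl = has_vector_derivative_blinfun_apply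
  have deriv: "(Df m has_vector_derivative Df (Suc m) x) (at x within {t..s})"
    if m: "m < 4" and x': "t \<le> x" "x \<le> s" for m x
  proof -
    have x: "x \<in> {t0..T}" using x' t s by auto
    have sub: "{t..s} \<subseteq> {t0..T}" using t s by auto
    note d = du[OF x, THEN has_vector_derivative_within_subset[OF _ sub]]
    note c = dg[OF u_in_strip[OF x], THEN has_vector_derivative_chain[OF d(1)]]
    have c1: "((\<lambda>x. g1 (u x) - g1 w) has_vector_derivative g2 (u x) (u1 x)) (at x within {t..s})"
      using has_vector_derivative_diff[OF c(2) has_vector_derivative_const[of "g1 w"]] by simp
    have w: "((\<lambda>x. g1 w (u x)) has_vector_derivative g1 w (u1 x)) (at x within {t..s})"
      using bl[OF has_vector_derivative_const[of "g1 w"] d(1)] by simp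
    have "(F0 has_vector_derivative F1 x) (at x within {t..s})"
      using has_vector_derivative_diff[OF c(1) w]
      by (simp add: F0_def[abs_def] F1_def nonlin_rem_def blinfun.diff_left)
    moreover have "(F1 has_vector_derivative F2 x) (at x within {t..s})"
      using bl[OF c1 d(2)] by (simp add: F1_def[abs_def] F2_def)
    moreover have "(F2 has_vector_derivative F3 x) (at x within {t..s})"
      using has_vector_derivative_add[OF bl[OF c1 d(3)] bl[OF bl[OF c(3) d(2)] d(2)]]
      by (simp add: F2_def[abs_def] F3_def blinfun.add_left scaleR_2 algebra_simps)
    moreover have "(F3 has_vector_derivative F4 x) (at x within {t..s})"
      using has_vector_derivative_add[OF has_vector_derivative_add[OF has_vector_derivative_add[OF
          bl[OF c1 d(4)]
          bl[OF has_vector_derivative_const[of "2 *\<^sub>R id_blinfun"] bl[OF bl[OF c(3) d(2)] d(3)]]]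
          bl[OF bl[OF c(3) d(3)] d(2)]] bl[OF bl[OF bl[OF c(4) d(2)] d(2)] d(2)]]
      by (simp add: F3_def[abs_def] F4_def blinfun.add_left blinfun.scaleR_left scaleR_2 algebra_simps)
    moreover have "m = 0 \<or> m = 1 \<or> m = 2 \<or> m = 3" using m by auto
    ultimately show ?thesis by (auto simp: Df_def numeral_2_eq_2 numeral_3_eq_3)
  qed
  have F4_le: "norm (F4 x) \<le> 16 * G ^ 5" if x': "x \<in> {t..s}" for x
  proof -
    have x: "x \<in> {t0..T}" using x' t s by auto
    note U = u_le[OF x] and B = g_le[OF u_in_strip[OF x]]
    have pow: "G * G \<le> G ^ 5" "G * G * G \<le> G ^ 5" "G * G * G * G \<le> G ^ 5" "G * G * G * G * G \<le> G ^ 5"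
      using G power_increasing[of 2 5 G] power_increasing[of 3 5 G] power_increasing[of 4 5 G]
      by (simp_all add: numeral_eq_Suc mult_ac)
    have "norm (g1 (u x) - g1 w) \<le> G + G" by (intro norm_diff_mono B g_le wV)
    then have "norm ((g1 (u x) - g1 w) (u4 x)) \<le> (G + G) * G" by (intro norm_blinfun_le_mult U)
    then have n1: "norm ((g1 (u x) - g1 w) (u4 x)) \<le> 2 * G ^ 5" using pow(1) by (simp add: algebra_simps)
    have n2: "norm (g2 (u x) a b) \<le> G ^ 5" if "norm a \<le> G" "norm b \<le> G" for a b
      by (rule order_trans[OF _ pow(2)]) (intro norm_blinfun_le_mult that B)
    have n3: "norm (g3 (u x) a b c) \<le> G ^ 5" if "norm a \<le> G" "norm b \<le> G" "norm c \<le> G" for a b c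
      by (rule order_trans[OF _ pow(3)]) (intro norm_blinfun_le_mult that B)
    have n4: "norm (g4 (u x) a b c d) \<le> G ^ 5" if "norm a \<le> G" "norm b \<le> G" "norm c \<le> G" "norm d \<le> G" for a b c d
      by (rule order_trans[OF _ pow(4)]) (intro norm_blinfun_le_mult that B)
    have two: "norm (2 *\<^sub>R y) \<le> 2 * p" if "norm y \<le> p" for y :: 'a and p using that by simp
    \<comment> \<open>Counted with multiplicity, \<open>F4\<close> has 16 terms if the first one counts twice.\<close>
    have "norm (F4 x) \<le> 2 * G ^ 5 + G ^ 5 + 2 * (G ^ 5 + G ^ 5 + G ^ 5) + (G ^ 5 + G ^ 5 + G ^ 5)
        + (G ^ 5 + G ^ 5 + G ^ 5 + G ^ 5)"
      unfolding F4_def by (intro norm_triangle_mono two n1 n2 n3 n4 U)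
    then show ?thesis by simp
  qed
  have ts: "t \<le> s" using s by simp
  have int: "((\<lambda>x. ((s - x) ^ (4 - 1) / fact (4 - 1)) *\<^sub>R Df 4 x) has_integral
      F0 s - (\<Sum>i<4. ((s - t) ^ i / fact i) *\<^sub>R Df i t)) {t..s}"
    by (rule Taylor_has_integral[where Df = Df]) (use deriv ts in \<open>auto simp: Df_def\<close>)
  have "norm (F0 s - (\<Sum>i<4. ((s - t) ^ i / fact i) *\<^sub>R Df i t)) \<le> ((s - t) ^ 3 * (16 * G ^ 5)) * (s - t)"
  proof (rule has_integral_norm_le[OF int ts])
    fix x assume x: "x \<in> {t..s}"
    have "(s - x) ^ 3 \<le> (s - t) ^ 3" "(s - x) ^ 3 \<ge> 0"
      using x by (auto intro!: power_mono)
    then have "\<bar>(s - x) ^ 3 / 6\<bar> \<le> (s - t) ^ 3" "0 \<le> (s - t) ^ 3"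
      by linarith+
    moreover have six: "(s - x) ^ (4 - 1) / fact (4 - 1) = (s - x) ^ 3 / 6" by (simp add: fact_numeral)
    ultimately have "\<bar>(s - x) ^ (4 - 1) / fact (4 - 1)\<bar> \<le> (s - t) ^ 3" "0 \<le> (s - t) ^ 3"
      unfolding six by blast+
    then show "norm (((s - x) ^ (4 - 1) / fact (4 - 1)) *\<^sub>R Df 4 x) \<le> (s - t) ^ 3 * (16 * G ^ 5)"
      using F4_le[OF x] unfolding norm_scaleR
      by (intro mult_mono) (auto simp: Df_def)
  qed
  moreover have "(\<Sum>i<4. ((s - t) ^ i / fact i) *\<^sub>R Df i t) = F0 t + ((s - t)\<^sup>2 / 2) *\<^sub>R f2 t + ((s - t) ^ 3 / 6) *\<^sub>R f3 t"
  proof -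
    have "g2 w (u2 t) (u1 t) = g2 w (u1 t) (u2 t)"
      by (rule second_derivative_symmetric[OF open_strip wV dg(1) dg(2)[OF wV]])
    moreover have "3 *\<^sub>R y = y + (y + y)" for y :: 'a
      using scaleR_add_left[of 2 1 y] by (simp add: scaleR_2)
    ultimately have "F1 t = 0" "F2 t = f2 t" "F3 t = f3 t"
      by (simp_all add: F1_def F2_def F3_def w_def scaleR_2 algebra_simps)
    then show ?thesis
      by (simp add: Df_def numeral_eq_Suc lessThan_Suc fact_reduce algebra_simps)
  qed
  ultimately show ?thesis
    by (simp add: F0_def w_def algebra_simps power_numeral_reduce)
qed

lemma stage_near:
  assumes t: "t \<in> {t0..T}" and h: "0 < h" "h \<le> H"
  shows "norm (stage h (u t) - u t) \<le> M * G * h"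
proof -
  have "norm (\<Phi> 1 (3/4 * h) (u t) (u1 t)) \<le> M * norm (u1 t)"
    using h by (intro norm_phi_le u_in_strip t) auto
  also have "\<dots> \<le> M * G" using M u_le(1)[OF t] by (intro mult_left_mono) auto
  finally have "norm ((3/4 * h) *\<^sub>R \<Phi> 1 (3/4 * h) (u t) (u1 t)) \<le> h * (M * G)"
    unfolding norm_scaleR using h M G by (intro mult_mono) auto
  then show ?thesis using u1_eq[OF t] by (simp add: exprb42_stage_def mult_ac)
qed

text \<open>
  The exact solution solves the equation linearised at \<open>u t\<close>, with the nonlinear remainder as
  inhomogeneity.
\<close>

lemma exact_has_integral:
  assumes t: "t \<in> {t0..T}" and h: "0 \<le> h" "t + h \<le> T"
  shows "((\<lambda>s. E (u t) (t + h - s) (R (u t) (u s))) has_integral (u (t + h) - E (u t) h (u t))) {t..t + h}"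
proof -
  interpret w: exp_generator D "J (u t)" by (rule generator[OF u_in_strip[OF t]])
  have "((\<lambda>s. E (u t) (t + h - s) (u1 s - J (u t) (u s))) has_integral
      (u (t + h) - E (u t) (t + h - t) (u t))) {t..t + h}"
  proof (rule w.variation_of_constants)
    fix s assume "s \<in> {t..t + h}"
    then have s: "s \<in> {t0..T}" using t h by auto
    show "(u has_vector_derivative u1 s) (at s within {t..t + h})"
      by (rule has_vector_derivative_within_subset[OF du(1)[OF s]]) (use t h in auto)
    show "u s \<in> D" by (rule u_D[OF s])
  qed (use h in simp)
  then have "((\<lambda>s. E (u t) (t + h - s) (R (u t) (u s))) has_integral
      (u (t + h) - E (u t) (t + h - t) (u t))) {t..t + h}"
  proof (rule has_integral_eq[rotated])
    fix s assume "s \<in> {t..t + h}"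
    then have s: "s \<in> {t0..T}" using t h by auto
    show "E (u t) (t + h - s) (u1 s - J (u t) (u s)) = E (u t) (t + h - s) (R (u t) (u s))"
      by (simp add: u1_eq[OF s] rhs_def jacobian_def nonlin_rem_def)
  qed
  then show ?thesis by simp
qed

lemma f2_le: "t \<in> {t0..T} \<Longrightarrow> norm (f2 t) \<le> G ^ 3"
  and f3_le: "t \<in> {t0..T} \<Longrightarrow> norm (f3 t) \<le> 4 * G ^ 4"
proof -
  assume t: "t \<in> {t0..T}"
  note U = u_le[OF t] and B = g_le[OF u_in_strip[OF t]]
  have "norm (f2 t) \<le> G * G * G" by (intro norm_blinfun_le_mult U B)
  then show "norm (f2 t) \<le> G ^ 3" by (simp add: power3_eq_cube)
  have "norm (g2 (u t) (u1 t) (u2 t)) \<le> G * G * G" by (intro norm_blinfun_le_mult U B)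
  also have "\<dots> \<le> G ^ 4" using G power_increasing[of 3 4 G] by (simp add: power3_eq_cube)
  finally have "norm (3 *\<^sub>R g2 (u t) (u1 t) (u2 t)) \<le> 3 * G ^ 4" by simp
  moreover have "norm (g3 (u t) (u1 t) (u1 t) (u1 t)) \<le> G * G * G * G" by (intro norm_blinfun_le_mult U B)
  then have "norm (g3 (u t) (u1 t) (u1 t) (u1 t)) \<le> G ^ 4" by (simp add: numeral_eq_Suc mult_ac)
  ultimately have "norm (f3 t) \<le> G ^ 4 + 3 * G ^ 4" by (intro norm_triangle_mono)
  then show "norm (f3 t) \<le> 4 * G ^ 4" by simp
qed

lemma remainder_quadratic:
  assumes t: "t \<in> {t0..T}" and h: "0 \<le> h" "t + h \<le> T" and s: "s \<in> {t..t + h}"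
  shows "norm (R (u t) (u s) - R (u t) (u t)) \<le> (G ^ 3 + 4 * G ^ 4 * H + 16 * G ^ 5 * H\<^sup>2) * h\<^sup>2"
proof -
  define d where "d = s - t"
  have d: "0 \<le> d" "d \<le> h" "h \<le> H" using s t h by (auto simp: d_def)
  define \<rho> where "\<rho> = R (u t) (u s) - R (u t) (u t) - (d\<^sup>2 / 2) *\<^sub>R f2 t - (d ^ 3 / 6) *\<^sub>R f3 t"
  have d2: "d\<^sup>2 \<le> h\<^sup>2" using d by (intro power_mono) auto
  have d3: "d ^ 3 \<le> H * h\<^sup>2" using d d2 mult_mono[of d H "d\<^sup>2" "h\<^sup>2"] by (simp add: power3_eq_cube power2_eq_square)
  have "d\<^sup>2 \<le> H\<^sup>2" using d by (intro power_mono) auto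
  then have d4: "d ^ 4 \<le> H\<^sup>2 * h\<^sup>2" using d2 mult_mono[of "d\<^sup>2" "H\<^sup>2" "d\<^sup>2" "h\<^sup>2"] by (simp flip: power_add)
  have "norm \<rho> \<le> 16 * G ^ 5 * d ^ 4"
    unfolding \<rho>_def d_def using s h by (intro remainder_taylor t) auto
  also have "\<dots> \<le> 16 * G ^ 5 * (H\<^sup>2 * h\<^sup>2)" using d4 G by (intro mult_left_mono) auto
  finally have 1: "norm \<rho> \<le> 16 * G ^ 5 * (H\<^sup>2 * h\<^sup>2)" .
  have 2: "norm ((d\<^sup>2 / 2) *\<^sub>R f2 t) \<le> h\<^sup>2 * G ^ 3"
  proof -
    have "\<bar>d\<^sup>2 / 2\<bar> \<le> h\<^sup>2" using d2 zero_le_power2[of h] zero_le_power2[of d] by linarith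
    then show ?thesis unfolding norm_scaleR by (intro mult_mono f2_le[OF t]) auto
  qed
  have 3: "norm ((d ^ 3 / 6) *\<^sub>R f3 t) \<le> (H * h\<^sup>2) * (4 * G ^ 4)"
  proof -
    have "d ^ 3 \<ge> 0" using d by simp
    then have "\<bar>d ^ 3 / 6\<bar> \<le> H * h\<^sup>2" using d3 by linarith
    then show ?thesis unfolding norm_scaleR using d by (intro mult_mono f3_le[OF t]) auto
  qed
  have "R (u t) (u s) - R (u t) (u t) = \<rho> + (d\<^sup>2 / 2) *\<^sub>R f2 t + (d ^ 3 / 6) *\<^sub>R f3 t"
    by (simp add: \<rho>_def)
  then have "norm (R (u t) (u s) - R (u t) (u t)) \<le> 16 * G ^ 5 * (H\<^sup>2 * h\<^sup>2) + h\<^sup>2 * G ^ 3 + (H * h\<^sup>2) * (4 * G ^ 4)"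
    by (metis norm_triangle_mono 1 2 3)
  then show ?thesis by (simp add: algebra_simps)
qed

text \<open>
  The stage is the exponential Rosenbrock--Euler method over \<open>3/4 h\<close>: it freezes the remainder at its
  initial value. The error it makes is \<open>O(h\<^sup>2)\<close> over an interval of length \<open>O(h)\<close>.
\<close>

lemma stage_error:
  assumes t: "t \<in> {t0..T}" and h: "0 < h" "t + h \<le> T"
  shows "norm (u (t + 3/4 * h) - stage h (u t)) \<le> M * (G ^ 3 + 4 * G ^ 4 * H + 16 * G ^ 5 * H\<^sup>2) * h ^ 3"
proof -
  define C where "C = G ^ 3 + 4 * G ^ 4 * H + 16 * G ^ 5 * H\<^sup>2"
  have C: "C \<ge> 0" using G H_pos by (simp add: C_def)
  define w where "w = u t"
  define k where "k = 3/4 * h"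
  have k: "0 < k" "k \<le> h" "t + k \<le> T" using h by (auto simp: k_def)
  have w: "w \<in> V" "w \<in> D" using u_in_strip[OF t] u_D[OF t] by (auto simp: w_def)
  interpret w: exp_generator D "J w" by (rule generator[OF w(1)])
  have "((\<lambda>s. E w (t + k - s) (R w (u s))) has_integral (u (t + k) - E w k w)) {t..t + k}"
    unfolding w_def using k by (intro exact_has_integral t) auto
  from has_integral_diff[OF this w.phi_op_has_integral_interval[OF k(1), of t 0 "R w w"]]
  have int: "((\<lambda>s. E w (t + k - s) (R w (u s) - R w w)) has_integral
      (u (t + k) - E w k w - k *\<^sub>R \<Phi> 1 k w (R w w))) {t..t + k}"
    by (simp add: blinfun.diff_right)
  have "norm (u (t + k) - E w k w - k *\<^sub>R \<Phi> 1 k w (R w w)) \<le> M * (C * h\<^sup>2) * (t + k - t)"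
  proof (rule has_integral_norm_le[OF int])
    fix s assume s: "s \<in> {t..t + k}"
    show "norm (E w (t + k - s) (R w (u s) - R w w)) \<le> M * (C * h\<^sup>2)"
    proof (rule norm_blinfun_le_mult)
      show "norm (E w (t + k - s)) \<le> M" using s k t h by (intro E_le w) auto
      show "norm (R w (u s) - R w w) \<le> C * h\<^sup>2"
        unfolding w_def C_def using s k h by (intro remainder_quadratic t) auto
    qed
  qed (use k in simp)
  also have "\<dots> \<le> M * (C * h\<^sup>2) * h" using k M C by (intro mult_left_mono) auto
  finally have "norm (u (t + k) - E w k w - k *\<^sub>R \<Phi> 1 k w (R w w)) \<le> M * C * h ^ 3"
    by (simp add: power3_eq_cube power2_eq_square mult_ac)
  moreover have "stage h w = E w k w + k *\<^sub>R \<Phi> 1 k w (R w w)"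
    unfolding k_def by (rule stage_eq[OF w h(1)])
  ultimately show ?thesis
    unfolding C_def[symmetric] w_def[symmetric] k_def[symmetric] by (simp add: diff_diff_eq)
qed

text \<open>
  The derivative of the remainder at \<open>z\<close> is \<open>g1 z - g1 (u t)\<close>, which is small near \<open>u t\<close>.
\<close>

lemma remainder_small_lipschitz:
  assumes t: "t \<in> {t0..T}" and \<rho>: "\<rho> < r" and x: "x \<in> cball (u t) \<rho>" and y: "y \<in> cball (u t) \<rho>"
  shows "norm (R (u t) x - R (u t) y) \<le> G * \<rho> * norm (x - y)"
proof (rule differentiable_bound[OF convex_cball _ _ x y])
  fix z assume z: "z \<in> cball (u t) \<rho>"
  then have zb: "z \<in> ball (u t) r" using \<rho> by simp
  then have zV: "z \<in> V" using ball_subset_strip[OF t] by blast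
  show "(R (u t) has_derivative blinfun_apply (g1 z - g1 (u t))) (at z within cball (u t) \<rho>)"
    unfolding nonlin_rem_def[abs_def]
    by (auto intro!: derivative_eq_intros has_derivative_at_withinI[OF dg(1)[OF zV]] simp: blinfun.diff_left)
  have "norm (g1 z - g1 (u t)) \<le> G * norm (z - u t)"
    using zb r by (intro ball_lipschitz(2)[OF t]) auto
  also have "\<dots> \<le> G * \<rho>" using z G by (intro mult_left_mono) (auto simp: dist_norm norm_minus_commute)
  finally show "onorm (blinfun_apply (g1 z - g1 (u t))) \<le> G * \<rho>" by (simp add: norm_blinfun.rep_eq)
qed

text \<open>
  The difference between the exact solution and the step started on it is
  \<open>X + h\<^sup>4 Z - (32/9) h \<phi>\<^sub>3(hJ) Y\<close>, where \<open>X\<close> collects the Taylor remainder in the integral, \<open>Z\<close> the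
  mismatch \<open>\<phi>\<^sub>4 - \<phi>\<^sub>3/4\<close> in the cubic term, and \<open>Y\<close> the stage error and the Taylor remainder at the stage.
\<close>

lemma local_error:
  "\<exists>C\<ge>0. \<exists>h1>0. \<forall>t h. t \<in> {t0..T} \<longrightarrow> 0 < h \<longrightarrow> h \<le> h1 \<longrightarrow> t + h \<le> T \<longrightarrow>
    stage h (u t) \<in> ball (u t) (r / 2) \<and> norm (step h (u t) - u (t + h)) \<le> C * h ^ 5"
proof -
  define C2 where "C2 = G ^ 3 + 4 * G ^ 4 * H + 16 * G ^ 5 * H\<^sup>2"
  define C3 where "C3 = G * (M * G) * (M * C2) + 16 * G ^ 5"
  define C where "C = M * (16 * G ^ 5) + 2 * (M * (G + G * (4 * G ^ 4))) + 32/9 * (M * C3)"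
  \<comment> \<open>Keeps \<open>stage h (u t)\<close>, at distance at most \<open>M * G * h\<close>, in the ball of radius \<open>r / 2\<close>.\<close>
  define h1 where "h1 = r / (4 * M * G)"
  have C2: "C2 \<ge> 0" using G H_pos by (simp add: C2_def)
  have C3: "C3 \<ge> 0" using G M C2 by (simp add: C3_def)
  have C: "C \<ge> 0" using G M C3 by (simp add: C_def)
  have h1: "h1 > 0" using r M G by (simp add: h1_def)
  have "stage h (u t) \<in> ball (u t) (r / 2) \<and> norm (step h (u t) - u (t + h)) \<le> C * h ^ 5"
    if t: "t \<in> {t0..T}" and h: "0 < h" "h \<le> h1" "t + h \<le> T" for t h
  proof -
    have hH: "h \<le> H" using t h by auto
    have MGh: "M * G * h < r / 2"
    proof -
      have "M * G * h \<le> M * G * h1" using h M G by (intro mult_left_mono) auto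
      also have "\<dots> = r / 4" using M G by (simp add: h1_def)
      finally show ?thesis using r by simp
    qed
    define w where "w = u t"
    define U where "U = stage h w"
    define m where "m = t + 3/4 * h"
    have w: "w \<in> V" "w \<in> D" using u_in_strip[OF t] u_D[OF t] by (auto simp: w_def)
    have m: "m \<in> {t..t + h}" "m \<in> {t..T}" using h by (auto simp: m_def)
    interpret w: exp_generator D "J w" by (rule generator[OF w(1)])
    interpret phi3: bounded_linear "\<Phi> 3 h w"
      using w.bounded_linear_phi_op[of h 2] h by simp
    have U_near: "norm (U - w) \<le> M * G * h"
      unfolding U_def w_def by (rule stage_near[OF t h(1) hH])
    define \<rho> where "\<rho> s = R w (u s) - R w w - ((s - t)\<^sup>2 / 2) *\<^sub>R f2 t - ((s - t) ^ 3 / 6) *\<^sub>R f3 t" for s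
    have \<rho>_le: "norm (\<rho> s) \<le> 16 * G ^ 5 * h ^ 4" if s: "s \<in> {t..t + h}" for s
    proof -
      have "norm (\<rho> s) \<le> 16 * G ^ 5 * (s - t) ^ 4"
        unfolding \<rho>_def w_def using s h by (intro remainder_taylor t) auto
      also have "\<dots> \<le> 16 * G ^ 5 * h ^ 4" using s G by (intro mult_left_mono power_mono) auto
      finally show ?thesis .
    qed
    define X where "X = u (t + h) - E w h w - h *\<^sub>R \<Phi> 1 h w (R w w)
        - h ^ 3 *\<^sub>R \<Phi> 3 h w (f2 t) - h ^ 4 *\<^sub>R \<Phi> 4 h w (f3 t)"
    have X: "norm X \<le> M * (16 * G ^ 5 * h ^ 4) * (t + h - t)"
    proof (rule has_integral_norm_le)
      have "((\<lambda>s. E w (t + h - s) (R w (u s))) has_integral (u (t + h) - E w h w)) {t..t + h}"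
        unfolding w_def using h by (intro exact_has_integral t) auto
      from has_integral_diff[OF has_integral_diff[OF has_integral_diff[OF this
        w.phi_op_has_integral_interval[OF h(1), of t 0 "R w w"]]
        w.phi_op_has_integral_interval[OF h(1), of t 2 "f2 t"]]
        w.phi_op_has_integral_interval[OF h(1), of t 3 "f3 t"]]
      show "((\<lambda>s. E w (t + h - s) (\<rho> s)) has_integral X) {t..t + h}"
        by (simp add: \<rho>_def X_def blinfun.diff_right blinfun.scaleR_right fact_numeral flip: power_Suc)
      fix s assume s: "s \<in> {t..t + h}"
      show "norm (E w (t + h - s) (\<rho> s)) \<le> M * (16 * G ^ 5 * h ^ 4)"
        using s t h by (intro norm_blinfun_le_mult \<rho>_le E_le w) auto
    qed (use h in simp)
    define Y where "Y = (R w U - R w (u m)) + \<rho> m"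
    have Y: "norm Y \<le> C3 * h ^ 4"
    proof -
      have "norm (u m - w) \<le> M * G * h"
      proof -
        have "norm (u m - w) \<le> G * (m - t)" unfolding w_def by (rule u_near[OF t m(2)])
        also have "\<dots> \<le> G * h" using m G by (intro mult_left_mono) auto
        also have "\<dots> \<le> M * (G * h)" using M G h mult_right_mono[of 1 M "G * h"] by simp
        finally show ?thesis by (simp add: mult_ac)
      qed
      then have "norm (R w U - R w (u m)) \<le> G * (M * G * h) * norm (U - u m)"
        unfolding w_def using U_near MGh r
        by (intro remainder_small_lipschitz[OF t]) (auto simp: dist_norm norm_minus_commute w_def)
      also have "norm (U - u m) \<le> M * C2 * h ^ 3"
        using stage_error[OF t h(1,3)] by (simp add: U_def w_def m_def C2_def norm_minus_commute)
      finally have "norm (R w U - R w (u m)) \<le> G * (M * G * h) * (M * C2 * h ^ 3)"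
        using G M h by (simp add: mult_left_mono)
      then have "norm Y \<le> G * (M * G * h) * (M * C2 * h ^ 3) + 16 * G ^ 5 * h ^ 4"
        unfolding Y_def by (intro norm_triangle_mono \<rho>_le m)
      also have "\<dots> = C3 * h ^ 4" by (simp add: C3_def algebra_simps power3_eq_cube power4_eq_xxxx)
      finally show ?thesis .
    qed
    define Z where "Z = \<Phi> 4 h w (f3 t) - (1/4) *\<^sub>R \<Phi> 3 h w (f3 t)"
    have Z: "norm Z \<le> 2 * (M * h * (G + G * (4 * G ^ 4)))"
    proof -
      have "norm (J w (f3 t)) \<le> G + G * (4 * G ^ 4)"
        unfolding jacobian_def w_def
        by (intro norm_triangle_mono A_f3_le[OF t] norm_blinfun_le_mult f3_le[OF t] g_le u_in_strip[OF t])
      then have J: "M * h * norm (J w (f3 t)) \<le> M * h * (G + G * (4 * G ^ 4))"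
        using M h by (intro mult_left_mono) auto
      have E: "norm (E w s) \<le> M" if "0 \<le> s" "s \<le> h" for s using that hH by (intro E_le w) auto
      have 4: "norm (\<Phi> 4 h w (f3 t) - (1/24) *\<^sub>R f3 t) \<le> M * h * (G + G * (4 * G ^ 4))"
        using w.phi_op_approx[of h "f3 t" M 3] f3_D[OF t] E h J by (simp add: fact_numeral)
      have 3: "norm (\<Phi> 3 h w (f3 t) - (1/6) *\<^sub>R f3 t) \<le> M * h * (G + G * (4 * G ^ 4))"
        using w.phi_op_approx[of h "f3 t" M 2] f3_D[OF t] E h J by (simp add: fact_numeral)
      then have "norm ((1/4) *\<^sub>R (\<Phi> 3 h w (f3 t) - (1/6) *\<^sub>R f3 t)) \<le> M * h * (G + G * (4 * G ^ 4))"
        unfolding norm_scaleR using norm_ge_zero[of "\<Phi> 3 h w (f3 t) - (1/6) *\<^sub>R f3 t"] by linarith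
      from norm_diff_mono[OF 4 this] show ?thesis
        unfolding Z_def by (simp add: scaleR_diff_right)
    qed
    \<comment> \<open>The coefficients are \<open>(3/4)\<^sup>2 / 2\<close> and \<open>(3/4)\<^sup>3 / 6\<close>; multiplied by \<open>32/9\<close> they become
      \<open>1\<close> and \<open>1/4\<close>.\<close>
    have RU: "R w U - R w w = Y + (9/32 * h\<^sup>2) *\<^sub>R f2 t + (9/128 * h ^ 3) *\<^sub>R f3 t"
      by (simp add: Y_def \<rho>_def m_def power_mult_distrib power3_eq_cube power2_eq_square)
    have "u (t + h) - step h w = X + h ^ 4 *\<^sub>R Z - (h * (32/9)) *\<^sub>R \<Phi> 3 h w Y"
    proof -
      have "(h * (32/9)) *\<^sub>R \<Phi> 3 h w (R w U - R w w) =
          (h * (32/9)) *\<^sub>R \<Phi> 3 h w Y + h ^ 3 *\<^sub>R \<Phi> 3 h w (f2 t) + (h ^ 4 * (1/4)) *\<^sub>R \<Phi> 3 h w (f3 t)"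
        unfolding RU phi3.add phi3.scaleR
        by (simp add: scaleR_add_right power2_eq_square power3_eq_cube power4_eq_xxxx mult_ac)
      then show ?thesis
        using step_eq[OF w h(1)] by (simp add: X_def Z_def U_def[symmetric] scaleR_diff_right algebra_simps)
    qed
    also have "norm \<dots> \<le> M * (16 * G ^ 5 * h ^ 4) * h + h ^ 4 * (2 * (M * h * (G + G * (4 * G ^ 4))))
        + (h * (32/9)) * (M * (C3 * h ^ 4))"
    proof (intro norm_diff_mono norm_triangle_mono)
      show "norm X \<le> M * (16 * G ^ 5 * h ^ 4) * h" using X by simp
      show "norm (h ^ 4 *\<^sub>R Z) \<le> h ^ 4 * (2 * (M * h * (G + G * (4 * G ^ 4))))"
        using Z h by (simp add: mult_left_mono)
      have "norm (\<Phi> 3 h w Y) \<le> M * norm Y" using h hH by (intro norm_phi_le w) auto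
      also have "\<dots> \<le> M * (C3 * h ^ 4)" using Y M by (intro mult_left_mono) auto
      finally show "norm ((h * (32/9)) *\<^sub>R \<Phi> 3 h w Y) \<le> (h * (32/9)) * (M * (C3 * h ^ 4))"
        unfolding norm_scaleR using h by (intro mult_mono) auto
    qed
    also have "\<dots> = C * h ^ 5" by (simp add: C_def algebra_simps power_numeral_reduce)
    finally have "norm (step h (u t) - u (t + h)) \<le> C * h ^ 5"
      by (simp add: w_def norm_minus_commute)
    moreover have "stage h (u t) \<in> ball (u t) (r / 2)"
      using U_near MGh by (simp add: U_def w_def dist_norm norm_minus_commute)
    ultimately show ?thesis by simp
  qed
  with C h1 show ?thesis by blast
qed

end

section \<open>The global error\<close>

context exprb_setting
begin

text \<open>
  Stability and local error together, in the norm \<open>N\<close>. The condition \<open>norm (v - u t) \<le> \<rho>\<close> keeps the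
  stage inside the ball of radius \<open>r\<close> about \<open>u t\<close>.
\<close>

lemma one_step:
  "\<exists>C\<ge>0. \<exists>L\<ge>0. \<exists>h1>0. \<exists>\<rho>>0. \<forall>t h v. t \<in> {t0..T} \<longrightarrow> 0 < h \<longrightarrow> h \<le> h1 \<longrightarrow> t + h \<le> T \<longrightarrow>
    v \<in> D \<longrightarrow> norm (v - u t) \<le> \<rho> \<longrightarrow>
    v \<in> V \<and> stage h v \<in> V \<and> N (step h v - u (t + h)) \<le> exp (L * h) * N (v - u t) + C * h ^ 5"
proof -
  obtain C1 where C1: "C1 \<ge> 0" "\<And>t h v. t \<in> {t0..T} \<Longrightarrow> 0 < h \<Longrightarrow> h \<le> H \<Longrightarrow> v \<in> ball (u t) r \<Longrightarrow> v \<in> D \<Longrightarrow>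
      norm (stage h v - stage h (u t)) \<le> C1 * norm (v - u t)"
    using stage_lipschitz by blast
  obtain C2 where C2: "C2 \<ge> 0" "\<And>t h v. t \<in> {t0..T} \<Longrightarrow> 0 < h \<Longrightarrow> h \<le> H \<Longrightarrow> v \<in> ball (u t) r \<Longrightarrow> v \<in> D \<Longrightarrow>
      stage h v \<in> ball (u t) r \<Longrightarrow> stage h (u t) \<in> ball (u t) r \<Longrightarrow>
      norm (step h v - step h (u t) - E v h (v - u t)) \<le> C2 * h * norm (v - u t)"
    using step_lipschitz by blast
  obtain C3 h3 where C3: "C3 \<ge> 0" "h3 > 0"
    "\<And>t h. t \<in> {t0..T} \<Longrightarrow> 0 < h \<Longrightarrow> h \<le> h3 \<Longrightarrow> t + h \<le> T \<Longrightarrow>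
      stage h (u t) \<in> ball (u t) (r / 2) \<and> norm (step h (u t) - u (t + h)) \<le> C3 * h ^ 5"
    using local_error by blast
  \<comment> \<open>The stage from \<open>v\<close> is within \<open>C1 * \<rho> \<le> r / 2\<close> of the stage from \<open>u t\<close>, which is itself
    within \<open>r / 2\<close> of \<open>u t\<close>.\<close>
  define \<rho> where "\<rho> = r / (2 * (C1 + 1))"
  have \<rho>: "\<rho> > 0" using r C1 by (simp add: \<rho>_def)
  have "v \<in> V \<and> stage h v \<in> V \<and>
      N (step h v - u (t + h)) \<le> exp ((\<kappa> + K * C2) * h) * N (v - u t) + (K * C3) * h ^ 5"
    if t: "t \<in> {t0..T}" and h: "0 < h" "h \<le> h3" "t + h \<le> T" and v: "v \<in> D" "norm (v - u t) \<le> \<rho>" for t h v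
  proof -
    have hH: "h \<le> H" using t h by auto
    have *: "(C1 + 1) * norm (v - u t) \<le> (C1 + 1) * \<rho>" using v C1 by (intro mult_left_mono) auto
    have half: "C1 * norm (v - u t) + norm (v - u t) \<le> r / 2"
    proof -
      have "(C1 + 1) * \<rho> = r / 2" using C1(1) by (simp add: \<rho>_def field_simps)
      then show ?thesis using * by (simp add: distrib_right)
    qed
    then have "norm (v - u t) \<le> r / 2"
      using C1(1) mult_nonneg_nonneg[OF C1(1) norm_ge_zero[of "v - u t"]] by linarith
    then have vb: "v \<in> ball (u t) r" using r by (simp add: dist_norm norm_minus_commute)
    have err: "stage h (u t) \<in> ball (u t) (r / 2)" "norm (step h (u t) - u (t + h)) \<le> C3 * h ^ 5"
      using C3(3)[OF t h] by auto
    then have ub: "stage h (u t) \<in> ball (u t) r" using r by simp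
    have "norm (stage h v - stage h (u t)) \<le> r / 2"
      using C1(2)[OF t h(1) hH vb v(1)] half norm_ge_zero[of "v - u t"] by linarith
    moreover have "norm (stage h (u t) - u t) < r / 2"
      using err(1) by (simp add: dist_norm norm_minus_commute)
    ultimately have "norm (stage h v - u t) < r"
      using norm_triangle_ineq[of "stage h v - stage h (u t)" "stage h (u t) - u t"] by simp
    then have sb: "stage h v \<in> ball (u t) r" by (simp add: dist_norm norm_minus_commute)
    have V: "v \<in> V" "stage h v \<in> V" using vb sb ball_subset_strip[OF t] by blast+
    define X where "X = (step h v - step h (u t) - E v h (v - u t)) + (step h (u t) - u (t + h))"
    have "norm X \<le> C2 * h * norm (v - u t) + C3 * h ^ 5"
      unfolding X_def by (intro norm_triangle_mono C2(2)[OF t h(1) hH vb v(1) sb ub] err)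
    also have "\<dots> \<le> C2 * h * N (v - u t) + C3 * h ^ 5"
      using C2(1) h N(1)[of "v - u t"] by (intro add_right_mono mult_left_mono) auto
    finally have "N X \<le> K * (C2 * h * N (v - u t) + C3 * h ^ 5)"
      using N(2)[of X] K by (auto intro: order_trans mult_left_mono)
    moreover have "N (E v h (v - u t)) \<le> exp (\<kappa> * h) * N (v - u t)"
      using h hH by (intro N_E V) auto
    moreover have "step h v - u (t + h) = E v h (v - u t) + X" by (simp add: X_def)
    ultimately have "N (step h v - u (t + h)) \<le>
        exp (\<kappa> * h) * N (v - u t) + K * (C2 * h * N (v - u t) + C3 * h ^ 5)"
      using N(3)[of "E v h (v - u t)" X] by simp
    also have "\<dots> = (exp (\<kappa> * h) + K * C2 * h) * N (v - u t) + K * C3 * h ^ 5"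
      by (simp add: algebra_simps)
    also have "\<dots> \<le> exp (\<kappa> * h + K * C2 * h) * N (v - u t) + K * C3 * h ^ 5"
      using \<kappa> K C2(1) h order_trans[OF norm_ge_zero N(1)]
      by (intro add_right_mono mult_right_mono exp_add_le) auto
    finally show ?thesis using V by (simp add: distrib_right)
  qed
  moreover have "K * C3 \<ge> 0" "\<kappa> + K * C2 \<ge> 0" using K C2 C3 \<kappa> by auto
  ultimately show ?thesis using C3(2) \<rho> by blast
qed

abbreviation "iter \<equiv> \<lambda>h. exprb42 D A g g1 h (u t0)"
abbreviation "evaluable \<equiv> \<lambda>h. exprb42_within V D A g g1 h (u t0)"

text \<open>
  Induction over the steps. The error bound keeps the iterate within \<open>\<rho>\<close> of the solution, so that the
  next step can be taken inside the strip; therefore evaluability and the error bound are proved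
  simultaneously.
\<close>

lemma small_steps:
  "\<exists>C\<ge>0. \<exists>h0>0. \<forall>h. 0 < h \<longrightarrow> h \<le> h0 \<longrightarrow> (\<forall>n. t0 + real n * h \<le> T \<longrightarrow>
    norm (iter h n - u (t0 + real n * h)) \<le> C * h ^ 4 \<and> evaluable h n)"
proof -
  obtain C L h1 \<rho> where *: "C \<ge> 0" "L \<ge> 0" "h1 > 0" "\<rho> > 0"
    "\<And>t h v. t \<in> {t0..T} \<Longrightarrow> 0 < h \<Longrightarrow> h \<le> h1 \<Longrightarrow> t + h \<le> T \<Longrightarrow> v \<in> D \<Longrightarrow> norm (v - u t) \<le> \<rho> \<Longrightarrow>
      v \<in> V \<and> stage h v \<in> V \<and> N (step h v - u (t + h)) \<le> exp (L * h) * N (v - u t) + C * h ^ 5"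
    using one_step by blast
  define C' where "C' = H * C * exp (L * H)"
  \<comment> \<open>For \<open>h \<le> h0\<close> the error bound \<open>C' * h ^ 4 \<le> C' * h\<close> is at most \<open>\<rho>\<close>.\<close>
  define h0 where "h0 = min h1 (min 1 (\<rho> / (C' + 1)))"
  have C': "C' \<ge> 0" using H_pos *(1) by (simp add: C'_def)
  have h0: "h0 > 0" using *(3,4) C' by (simp add: h0_def)
  have main: "norm (iter h n - u (t0 + real n * h)) \<le> C' * h ^ 4 \<and> evaluable h n"
    if h: "0 < h" "h \<le> h0" and n: "t0 + real n * h \<le> T" for h n
  proof -
    have conv: "norm (iter h m - u (t0 + real m * h)) \<le> C' * h ^ 4"
      if m: "m \<le> n" and N_le: "N (iter h m - u (t0 + real m * h)) \<le> real m * (C * h ^ 5) * exp (L * (real m * h))" for m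
    proof -
      have "real m * h \<le> real n * h" using m h by (intro mult_right_mono) auto
      then have mh: "real m * h \<le> H" using n by simp
      have "norm (iter h m - u (t0 + real m * h)) \<le> (real m * h) * (C * h ^ 4) * exp (L * (real m * h))"
        using order_trans[OF N(1) N_le] by (simp add: algebra_simps power_numeral_reduce)
      also have "\<dots> \<le> H * (C * h ^ 4) * exp (L * H)"
        using mh *(1,2) h H_pos by (intro mult_mono) (auto intro: mult_left_mono)
      finally show ?thesis by (simp add: C'_def mult_ac)
    qed
    have "C' * h ^ 4 \<le> C' * h"
      using h h0 C' power_decreasing[of 1 4 h] by (intro mult_left_mono) (auto simp: h0_def)
    also have "\<dots> \<le> C' * (\<rho> / (C' + 1))" using h C' by (intro mult_left_mono) (auto simp: h0_def)
    also have "\<dots> \<le> \<rho>" using C' *(4) by (simp add: field_simps)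
    finally have small: "C' * h ^ 4 \<le> \<rho>" .
    have "iter h m \<in> D \<and> N (iter h m - u (t0 + real m * h)) \<le> real m * (C * h ^ 5) * exp (L * (real m * h)) \<and>
        evaluable h m" if "m \<le> n" for m
      using that
    proof (induction m)
      case 0
      have "N 0 \<le> K * 0" using N(2)[of 0] by simp
      then show ?case using u_D[of t0] t0_less by (simp add: exprb42_within_def)
    next
      case (Suc m)
      then have IH: "iter h m \<in> D" "evaluable h m"
        "N (iter h m - u (t0 + real m * h)) \<le> real m * (C * h ^ 5) * exp (L * (real m * h))" by auto
      define t where "t = t0 + real m * h"
      have "real (Suc m) * h \<le> real n * h" using Suc.prems h by (intro mult_right_mono) auto
      then have t: "t \<in> {t0..T}" "t + h \<le> T" using n h by (auto simp: t_def algebra_simps)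
      have "norm (iter h m - u t) \<le> \<rho>"
        using conv[OF _ IH(3)] Suc.prems small by (simp add: t_def)
      from *(5)[OF t(1) h(1) _ t(2) IH(1) this] h
      have step: "iter h m \<in> V" "stage h (iter h m) \<in> V"
        "N (iter h (Suc m) - u (t + h)) \<le> exp (L * h) * N (iter h m - u t) + C * h ^ 5"
        by (auto simp: h0_def)
      have "N (iter h (Suc m) - u (t + h)) \<le>
          exp (L * h) * (real m * (C * h ^ 5) * exp (L * (real m * h))) + C * h ^ 5 * exp (L * (real (Suc m) * h))"
      proof (rule order_trans[OF step(3) add_mono])
        show "exp (L * h) * N (iter h m - u t) \<le> exp (L * h) * (real m * (C * h ^ 5) * exp (L * (real m * h)))"
          using IH(3) by (intro mult_left_mono) (auto simp: t_def)
        have "C * h ^ 5 * 1 \<le> C * h ^ 5 * exp (L * (real (Suc m) * h))"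
          using *(1,2) h by (intro mult_left_mono) auto
        then show "C * h ^ 5 \<le> C * h ^ 5 * exp (L * (real (Suc m) * h))" by simp
      qed
      also have "\<dots> = real (Suc m) * (C * h ^ 5) * exp (L * (real (Suc m) * h))"
        by (simp add: algebra_simps exp_add)
      finally have "N (iter h (Suc m) - u (t0 + real (Suc m) * h)) \<le>
          real (Suc m) * (C * h ^ 5) * exp (L * (real (Suc m) * h))"
        by (simp add: t_def algebra_simps)
      moreover have "evaluable h (Suc m)"
        using IH(2) step(1,2) by (auto simp: exprb42_within_def less_Suc_eq)
      moreover have "iter h (Suc m) \<in> D"
        using step_in_domain[OF step(1) IH(1) h(1)] by simp
      ultimately show ?case by blast
    qed
    then show ?thesis using conv[of n] by blast
  qed
  show ?thesis using C' h0 main by blast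
qed

text \<open>
  For step sizes that are not small only boundedness of an iterate is available. It holds uniformly
  although \<open>A\<close> is unbounded, by the form of the step in \<open>step_eq\<close>.
\<close>

lemma step_bounded:
  "\<exists>C\<ge>0. \<forall>h v. 0 < h \<longrightarrow> h \<le> H \<longrightarrow> v \<in> V \<longrightarrow> v \<in> D \<longrightarrow> stage h v \<in> V \<longrightarrow> norm (step h v) \<le> C"
proof -
  define C where "C = M * G + H * (M * (2 * G\<^sup>2)) + H * (32/9) * (M * (2 * G\<^sup>2 + 2 * G\<^sup>2))"
  have "norm (step h v) \<le> C" if h: "0 < h" "h \<le> H" and v: "v \<in> V" "v \<in> D" "stage h v \<in> V" for h v
    unfolding C_def step_eq[OF v(1,2) h(1)]
  proof (intro norm_triangle_mono)
    show "norm (E v h v) \<le> M * G" using h by (intro norm_blinfun_le_mult E_le g_le v) auto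
    have "norm (\<Phi> 1 h v (R v v)) \<le> M * norm (R v v)" using h by (intro norm_phi_le v) auto
    also have "\<dots> \<le> M * (2 * G\<^sup>2)" using norm_R_le[OF v(1,1)] M by (intro mult_left_mono) auto
    finally show "norm (h *\<^sub>R \<Phi> 1 h v (R v v)) \<le> H * (M * (2 * G\<^sup>2))"
      unfolding norm_scaleR using h by (intro mult_mono) auto
    have "norm (\<Phi> 3 h v (R v (stage h v) - R v v)) \<le> M * norm (R v (stage h v) - R v v)"
      using h by (intro norm_phi_le v) auto
    also have "\<dots> \<le> M * (2 * G\<^sup>2 + 2 * G\<^sup>2)"
      using M by (intro mult_left_mono norm_diff_mono norm_R_le v) auto
    finally show "norm ((h * (32/9)) *\<^sub>R \<Phi> 3 h v (R v (stage h v) - R v v)) \<le> H * (32/9) * (M * (2 * G\<^sup>2 + 2 * G\<^sup>2))"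
      unfolding norm_scaleR using h by (intro mult_mono) auto
  qed
  moreover have "C \<ge> 0" using M G H_pos by (simp add: C_def)
  ultimately show ?thesis by blast
qed

lemma iter_in_domain: "0 < h \<Longrightarrow> evaluable h n \<Longrightarrow> iter h n \<in> D"
proof (induction n)
  case 0
  then show ?case using u_D[of t0] t0_less by simp
next
  case (Suc n)
  then have "iter h n \<in> V" "evaluable h n" by (auto simp: exprb42_within_def)
  then show ?case using Suc step_in_domain by simp
qed

theorem fourth_order_convergence:
  "(\<exists>C. \<forall>h>0. \<forall>n. t0 + real n * h \<le> T \<longrightarrow> evaluable h n \<longrightarrow>
      norm (iter h n - u (t0 + real n * h)) \<le> C * h ^ 4) \<and>
   (\<exists>h0>0. \<forall>h. 0 < h \<and> h \<le> h0 \<longrightarrow> (\<forall>n. t0 + real n * h \<le> T \<longrightarrow> evaluable h n))"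
proof -
  obtain C1 h0 where C1: "C1 \<ge> 0" "h0 > 0"
    "\<And>h n. 0 < h \<Longrightarrow> h \<le> h0 \<Longrightarrow> t0 + real n * h \<le> T \<Longrightarrow>
      norm (iter h n - u (t0 + real n * h)) \<le> C1 * h ^ 4 \<and> evaluable h n"
    using small_steps by blast
  obtain C2 where C2: "C2 \<ge> 0"
    "\<And>h v. 0 < h \<Longrightarrow> h \<le> H \<Longrightarrow> v \<in> V \<Longrightarrow> v \<in> D \<Longrightarrow> stage h v \<in> V \<Longrightarrow> norm (step h v) \<le> C2"
    using step_bounded by blast
  \<comment> \<open>The second summand is for \<open>h > h0\<close>, where the error is at most \<open>C2 + G\<close>.\<close>
  define C where "C = C1 + (C2 + G) / h0 ^ 4"
  have "norm (iter h n - u (t0 + real n * h)) \<le> C * h ^ 4"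
    if h: "h > 0" and n: "t0 + real n * h \<le> T" and eval: "evaluable h n" for h n
  proof -
    have split: "C * h ^ 4 = C1 * h ^ 4 + (C2 + G) * (h ^ 4 / h0 ^ 4)"
      by (simp add: C_def algebra_simps)
    have pos: "0 \<le> C1 * h ^ 4" "0 \<le> (C2 + G) * (h ^ 4 / h0 ^ 4)"
      using C1 C2(1) G h by auto
    show ?thesis
    proof (cases "h \<le> h0")
      case True
      then show ?thesis using C1(3)[OF h True n] split pos by linarith
    next
      case False
      show ?thesis
      proof (cases n)
        case 0
        then show ?thesis using split pos by simp
      next
        case (Suc m)
        have "h \<le> real n * h" using Suc h by simp
        then have hH: "h \<le> H" using n by linarith
        have m: "iter h m \<in> V" "stage h (iter h m) \<in> V" "evaluable h m"
          using eval by (auto simp: exprb42_within_def Suc)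
        have "norm (iter h n) \<le> C2"
          using C2(2)[OF h hH m(1) iter_in_domain[OF h m(3)] m(2)] by (simp add: Suc)
        moreover have "t0 + real n * h \<in> {t0..T}" using n h by simp
        then have "norm (u (t0 + real n * h)) \<le> G" by (intro g_le u_in_strip)
        ultimately have "norm (iter h n - u (t0 + real n * h)) \<le> C2 + G" by (intro norm_diff_mono)
        also have "\<dots> \<le> (C2 + G) * (h ^ 4 / h0 ^ 4)"
        proof -
          have "h0 ^ 4 \<le> h ^ 4" using False C1(2) by (intro power_mono) auto
          then have "1 \<le> h ^ 4 / h0 ^ 4" using C1(2) by simp
          then show ?thesis using mult_left_mono[of 1 "h ^ 4 / h0 ^ 4" "C2 + G"] C2(1) G by simp
        qed
        finally show ?thesis using split pos by linarith
      qed
    qed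
  qed
  then show ?thesis using C1(2,3) by blast
qed

end

theorem theorem4p1:
  fixes A g :: "'a::banach \<Rightarrow> 'a"
    and D :: "'a set"
    and u u1 u2 u3 u4 :: "real \<Rightarrow> 'a"
    and u0 :: 'a
    and t0 T r :: real
    and g1 :: "'a \<Rightarrow> 'a \<Rightarrow>\<^sub>L 'a"
    and g2 :: "'a \<Rightarrow> 'a \<Rightarrow>\<^sub>L 'a \<Rightarrow>\<^sub>L 'a"
    and g3 :: "'a \<Rightarrow> 'a \<Rightarrow>\<^sub>L 'a \<Rightarrow>\<^sub>L 'a \<Rightarrow>\<^sub>L 'a"
    and g4 :: "'a \<Rightarrow> 'a \<Rightarrow>\<^sub>L 'a \<Rightarrow>\<^sub>L 'a \<Rightarrow>\<^sub>L 'a \<Rightarrow>\<^sub>L 'a"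
  assumes "t0 < T"
    \<comment> \<open>(i)\<close>
    and "\<exists>S. semigroup_generator S D A"
    \<comment> \<open>(ii), the exact solution\<close>
    and "u t0 = u0"
    and "\<And>t. t \<in> {t0..T} \<Longrightarrow> u t \<in> D \<and> u1 t = rhs A g (u t)"
    and "\<And>t. t \<in> {t0..T} \<Longrightarrow> (u has_vector_derivative u1 t) (at t within {t0..T})"
    and "\<And>t. t \<in> {t0..T} \<Longrightarrow> (u1 has_vector_derivative u2 t) (at t within {t0..T})"
    and "\<And>t. t \<in> {t0..T} \<Longrightarrow> (u2 has_vector_derivative u3 t) (at t within {t0..T})"
    and "\<And>t. t \<in> {t0..T} \<Longrightarrow> (u3 has_vector_derivative u4 t) (at t within {t0..T})"
    and "bounded (u1 ` {t0..T})" "bounded (u2 ` {t0..T})"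
        "bounded (u3 ` {t0..T})" "bounded (u4 ` {t0..T})"
    \<comment> \<open>(ii), the nonlinearity\<close>
    and "r > 0"
    and "\<And>v. v \<in> strip u {t0..T} r \<Longrightarrow> (g has_derivative blinfun_apply (g1 v)) (at v)"
    and "\<And>v. v \<in> strip u {t0..T} r \<Longrightarrow> (g1 has_derivative blinfun_apply (g2 v)) (at v)"
    and "\<And>v. v \<in> strip u {t0..T} r \<Longrightarrow> (g2 has_derivative blinfun_apply (g3 v)) (at v)"
    and "\<And>v. v \<in> strip u {t0..T} r \<Longrightarrow> (g3 has_derivative blinfun_apply (g4 v)) (at v)"
    and "bounded (g1 ` strip u {t0..T} r)" "bounded (g2 ` strip u {t0..T} r)"
        "bounded (g3 ` strip u {t0..T} r)" "bounded (g4 ` strip u {t0..T} r)"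
    \<comment> \<open>(iii)\<close>
    and "\<And>t. t \<in> {t0..T} \<Longrightarrow>
           g3 (u t) (u1 t) (u1 t) (u1 t) + 3 *\<^sub>R g2 (u t) (u1 t) (u2 t) \<in> D"
    and "bounded ((\<lambda>t. A (g3 (u t) (u1 t) (u1 t) (u1 t) + 3 *\<^sub>R g2 (u t) (u1 t) (u2 t)))
                  ` {t0..T})"
  shows "(\<exists>C. \<forall>h>0. \<forall>n. t0 + real n * h \<le> T \<longrightarrow>
              exprb42_within (strip u {t0..T} r) D A g g1 h u0 n \<longrightarrow>
              norm (exprb42 D A g g1 h u0 n - u (t0 + real n * h)) \<le> C * h ^ 4) \<and>
         (\<exists>h0>0. \<forall>h. 0 < h \<and> h \<le> h0 \<longrightarrow> (\<forall>n. t0 + real n * h \<le> T \<longrightarrow>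
              exprb42_within (strip u {t0..T} r) D A g g1 h u0 n))"
proof -
  define V where "V = strip u {t0..T} r"
  define f3 where "f3 t = g3 (u t) (u1 t) (u1 t) (u1 t) + 3 *\<^sub>R g2 (u t) (u1 t) (u2 t)" for t
  note sol = assms(4-8) and du_bd = assms(9-12) and dg = assms(14-17)[folded V_def]
    and dg_bd = assms(18-21)[folded V_def]
  have bound: "\<exists>a. \<forall>x\<in>X. norm (f x) \<le> a" if "bounded (f ` X)"
    for f :: "'x \<Rightarrow> 'y::real_normed_vector" and X
    using that by (auto simp: bounded_iff)
  have u_cont: "continuous_on {t0..T} u"
    using sol(2) by (intro continuous_on_vector_derivative) blast
  have u_V: "u t \<in> V" if "t \<in> {t0..T}" for t
    using that assms(13) by (force simp: V_def strip_def)
  have gu_cont: "continuous_on {t0..T} (\<lambda>t. g (u t))"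
    by (rule continuous_on_vector_derivative, rule has_vector_derivative_chain[OF sol(2) dg(1)])
      (use u_V in auto)
  obtain a1 a2 a3 a4 where a: "\<forall>t\<in>{t0..T}. norm (u1 t) \<le> a1" "\<forall>t\<in>{t0..T}. norm (u2 t) \<le> a2"
      "\<forall>t\<in>{t0..T}. norm (u3 t) \<le> a3" "\<forall>t\<in>{t0..T}. norm (u4 t) \<le> a4"
    using du_bd[THEN bound] by blast
  obtain b1 b2 b3 b4 where b: "\<forall>v\<in>V. norm (g1 v) \<le> b1" "\<forall>v\<in>V. norm (g2 v) \<le> b2"
      "\<forall>v\<in>V. norm (g3 v) \<le> b3" "\<forall>v\<in>V. norm (g4 v) \<le> b4"
    using dg_bd[THEN bound] by blast
  obtain c1 c2 c3 where c: "\<forall>t\<in>{t0..T}. norm (u t) \<le> c1" "\<forall>t\<in>{t0..T}. norm (g (u t)) \<le> c2"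
      "\<forall>t\<in>{t0..T}. norm (A (f3 t)) \<le> c3"
    using bound[OF compact_imp_bounded[OF compact_continuous_image[OF u_cont compact_Icc]]]
      bound[OF compact_imp_bounded[OF compact_continuous_image[OF gu_cont compact_Icc]]]
      bound[OF assms(23)[folded f3_def]] by blast
  have near: "\<exists>t\<in>{t0..T}. v \<in> ball (u t) r \<and> ball (u t) r \<subseteq> V" if "v \<in> V" for v
    using that by (auto simp: V_def strip_def)
  have v_le: "norm v \<le> c1 + r" if v: "v \<in> V" for v
  proof -
    obtain t where "t \<in> {t0..T}" "v \<in> ball (u t) r" using near[OF v] by blast
    then have "norm (u t) \<le> c1" "norm (v - u t) \<le> r"
      using c by (auto simp: dist_norm norm_minus_commute)
    then show ?thesis using norm_triangle_ineq[of "u t" "v - u t"] by simp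
  qed
  have g_le: "norm (g v) \<le> c2 + b1 * r" if v: "v \<in> V" for v
  proof -
    obtain t where t: "t \<in> {t0..T}" "v \<in> ball (u t) r" "ball (u t) r \<subseteq> V" using near[OF v] by blast
    have b1: "b1 \<ge> 0" using b(1) v norm_ge_zero order_trans by blast
    have "norm (g v - g (u t)) \<le> b1 * norm (v - u t)"
    proof (rule differentiable_bound[OF convex_ball _ _ t(2)])
      fix z assume "z \<in> ball (u t) r"
      then have z: "z \<in> V" using t by blast
      show "(g has_derivative blinfun_apply (g1 z)) (at z within ball (u t) r)"
        by (rule has_derivative_at_withinI[OF dg(1)[OF z]])
      show "onorm (blinfun_apply (g1 z)) \<le> b1"
        using b(1) z by (simp add: norm_blinfun.rep_eq[symmetric])
    qed (use assms(13) in simp)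
    also have "\<dots> \<le> b1 * r" using t(2) b1 by (intro mult_left_mono) (auto simp: dist_norm norm_minus_commute)
    finally have "norm (g v - g (u t)) \<le> b1 * r" .
    moreover have "norm (g (u t)) \<le> c2" using c(2) t(1) by blast
    ultimately show ?thesis using norm_triangle_ineq[of "g (u t)" "g v - g (u t)"] by simp
  qed
  define G where "G = Max {1, a1, a2, a3, a4, b1, b2, b3, b4, c1 + r, c2 + b1 * r, c3}"
  have G: "1 \<le> G" "a1 \<le> G" "a2 \<le> G" "a3 \<le> G" "a4 \<le> G" "b1 \<le> G" "b2 \<le> G" "b3 \<le> G" "b4 \<le> G"
    "c1 + r \<le> G" "c2 + b1 * r \<le> G" "c3 \<le> G"
    unfolding G_def by (intro Max_ge; simp)+
  obtain S where S: "semigroup_generator S D A" using assms(2) by blast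
  obtain M where M: "M \<ge> 1"
    "\<And>B. norm B \<le> G \<Longrightarrow> semigroup_generator (exp_op D (\<lambda>x. A x + blinfun_apply B x)) D (\<lambda>x. A x + B x)"
    "\<And>B t. norm B \<le> G \<Longrightarrow> 0 \<le> t \<Longrightarrow> t \<le> T - t0 \<Longrightarrow> norm (exp_op D (\<lambda>x. A x + blinfun_apply B x) t) \<le> M"
    using perturbed_exp_op[OF S, of G "T - t0"] by blast
  have J: "jacobian A g1 v = (\<lambda>x. A x + g1 v x)" for v by (simp add: jacobian_def fun_eq_iff)
  have g1_le: "norm (g1 v) \<le> G" if "v \<in> V" for v using b(1) G that by force
  \<comment> \<open>The semigroup of \<open>A\<close>, written as a perturbation by \<open>0\<close> in order to share the bound \<open>M\<close>.\<close>
  let ?S = "exp_op D (\<lambda>x. A x + blinfun_apply 0 x)"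
  have S0: "semigroup_generator ?S D (\<lambda>x. A x + blinfun_apply 0 x)" using M(2)[of 0] G by simp
  interpret S: generated_semigroup ?S D "\<lambda>x. A x + blinfun_apply 0 x" by unfold_locales (rule S0)
  obtain K w N where N: "K \<ge> 1" "w \<ge> 0" "\<And>x. norm x \<le> N x" "\<And>x. N x \<le> K * norm x"
    "\<And>x y. N (x + y) \<le> N x + N y" "\<And>t x. t \<ge> 0 \<Longrightarrow> N (?S t x) \<le> exp (w * t) * N x"
    by (rule S.quasi_contractive_norm) (rule that, assumption+)
  define \<kappa> where "\<kappa> = w + K * M\<^sup>2 * G"
  have N_E: "N (exp_op D (jacobian A g1 v) t x) \<le> exp (\<kappa> * t) * N x"
    if v: "v \<in> V" and t: "0 \<le> t" "t \<le> T - t0" for v t x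
  proof -
    let ?E = "exp_op D (jacobian A g1 v)"
    have N0: "N x \<ge> 0" using norm_ge_zero N(3) by (rule order_trans)
    have "norm (?E t x - ?S t x) \<le> M\<^sup>2 * t * norm (g1 v - 0) * norm x"
      unfolding J using t G by (intro semigroup_difference_le[OF S0 M(2)[OF g1_le[OF v]]] M(3) g1_le v) auto
    also have "\<dots> \<le> M\<^sup>2 * t * G * N x"
      using t N(3)[of x] g1_le[OF v] G by (intro mult_mono) auto
    finally have "K * norm (?E t x - ?S t x) \<le> K * (M\<^sup>2 * t * G * N x)" using N(1) by (intro mult_left_mono) auto
    then have "N (?E t x) \<le> exp (w * t) * N x + K * (M\<^sup>2 * t * G * N x)"
      using N(5)[of "?S t x" "?E t x - ?S t x"] N(6)[OF t(1), of x] N(4)[of "?E t x - ?S t x"] by simp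
    also have "\<dots> = (exp (w * t) + K * M\<^sup>2 * G * t) * N x" by (simp add: algebra_simps)
    also have "\<dots> \<le> exp (w * t + K * M\<^sup>2 * G * t) * N x"
      using N(1,2) G t N0 by (intro mult_right_mono exp_add_le) auto
    finally show ?thesis by (simp add: \<kappa>_def distrib_right)
  qed
  have u_D: "u t \<in> D" and u1_eq: "u1 t = rhs A g (u t)" if "t \<in> {t0..T}" for t
    using sol(1)[OF that] by blast+
  have u_le: "norm (u1 t) \<le> G" "norm (u2 t) \<le> G" "norm (u3 t) \<le> G" "norm (u4 t) \<le> G"
    "norm (A (g3 (u t) (u1 t) (u1 t) (u1 t) + 3 *\<^sub>R g2 (u t) (u1 t) (u2 t))) \<le> G" if "t \<in> {t0..T}" for t
    using a[THEN bspec, OF that] c(3)[THEN bspec, OF that] G unfolding f3_def by linarith+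
  have V_le: "norm (g1 v) \<le> G" "norm (g2 v) \<le> G" "norm (g3 v) \<le> G" "norm (g4 v) \<le> G"
    "norm (g v) \<le> G" "norm v \<le> G" if "v \<in> V" for v
    using b[THEN bspec, OF that] v_le[OF that] g_le[OF that] G by linarith+
  have gen: "semigroup_generator (exp_op D (jacobian A g1 v)) D (jacobian A g1 v)"
    and E_le: "\<And>t. 0 \<le> t \<Longrightarrow> t \<le> T - t0 \<Longrightarrow> norm (exp_op D (jacobian A g1 v) t) \<le> M" if "v \<in> V" for v
    unfolding J using M(2,3) g1_le[OF that] by blast+
  have \<kappa>: "\<kappa> \<ge> 0" using N(1,2) G by (simp add: \<kappa>_def)
  note facts = assms(1,13) sol du_bd dg[unfolded V_def] assms(22) G(1) u_D u1_eq u_le V_le[unfolded V_def]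
    gen[unfolded V_def] E_le[unfolded V_def] M(1) N(1,3-5) N_E[unfolded V_def] \<kappa>
  interpret exprb_setting A g D u u1 u2 u3 u4 t0 T r g1 g2 g3 g4 G M \<kappa> K N
    by (rule exprb_setting.intro; fact facts)
  show ?thesis using fourth_order_convergence assms(3) by simp
qed

end
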